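(* Let $1<p<\infty$ and let $\Omega\subseteq\mathbb{R}^N$ be an open set such that $\lambda_{1,p}(\Omega)>0$. For a constant $\lambda$ such that $$\lambda_{1,p}(\Omega)\le\lambda<\mathcal{E}_p(\Omega),$$ let $v\in W^{1,p}_0(\Omega)$ be a nonnegative subsolution of the equation $-\Delta_p u=\lambda\,u^{p-1}$ in $\Omega$. Then: (i) if $\mathcal{E}_p(\Omega)<+\infty$, there exist two constants $\mathcal{C}=\mathcal{C}(N,p,\lambda,\Omega)>0$ and $\alpha=\alpha(p,\lambda,\Omega)>0$ such that $$0\le v(x)\le\mathcal{C}\,\|v\|_{L^p(\Omega)}\,e^{-\alpha|x|},\qquad\text{for a.e. }x\in\Omega.\qquad(\ast)$$ Moreover, the constant $\alpha$ depends decreasingly on $\lambda$ and $$\lim_{\lambda\nearrow\mathcal{E}_p(\Omega)}\alpha=0;$$ (ii) if $\mathcal{E}_p(\Omega)=+\infty$, then for every $\alpha>0$ there exists a constant $\mathcal{C}=\mathcal{C}(N,p,\lambda,\Omega,\alpha)>0$ such that $(\ast)$ holds.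
   Context: $N\in\mathbb{N}\setminus\{0\}$ is the dimension, functions are real valued, $B_R=\{x\in\mathbb{R}^N:|x|<R\}$. $W^{1,p}_0(\Omega)$ is the closure of $C^\infty_0(\Omega)$ in $W^{1,p}(\Omega)$. Set $$\lambda_{1,p}(\Omega)=\inf\Big\{\int_\Omega|\nabla\varphi|^p\,dx:\varphi\in W^{1,p}_0(\Omega),\ \int_\Omega|\varphi|^p\,dx=1\Big\},$$ with value $+\infty$ for the empty set, and $$\mathcal{E}_p(\Omega)=\sup_{R>0}\lambda_{1,p}(\Omega\setminus\overline{B_R})\in[0,+\infty].$$ A nonnegative function $v\in W^{1,p}_0(\Omega)$ is a subsolution of $-\Delta_p u=\lambda u^{p-1}$ in $\Omega$ if $$\int_\Omega\langle|\nabla v|^{p-2}\nabla v,\nabla\varphi\rangle\,dx\le\lambda\int_\Omega v^{p-1}\varphi\,dx\qquad\text{for every }\varphi\in W^{1,p}_0(\Omega),\ \varphi\ge0.$$ The notation $C=C(\dots)$ means that the constant depends only on the listed quantities (in particular not on $v$). *)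

theory Defs
  imports "HOL-Analysis.Analysis"
begin

primrec Ck :: "nat \<Rightarrow> ('a::euclidean_space \<Rightarrow> real) \<Rightarrow> bool" where
  "Ck 0 f \<longleftrightarrow> continuous_on UNIV f"
| "Ck (Suc k) f \<longleftrightarrow>
     (\<forall>x. f differentiable (at x)) \<and> (\<forall>b\<in>Basis. Ck k (\<lambda>x. frechet_derivative f (at x) b))"

definition smooth :: "('a::euclidean_space \<Rightarrow> real) \<Rightarrow> bool" where
  "smooth f \<longleftrightarrow> (\<forall>k. Ck k f)"

text \<open>A function in $C^\infty_0(\Omega)$ is represented by its extension by zero to the whole space.\<close>

definition test_functions :: "'a::euclidean_space set \<Rightarrow> ('a \<Rightarrow> real) set" where
  "test_functions \<Omega> =
     {\<phi>. smooth \<phi> \<and> compact (closure {x. \<phi> x \<noteq> 0}) \<and> closure {x. \<phi> x \<noteq> 0} \<subseteq> \<Omega>}"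

definition grad :: "('a::euclidean_space \<Rightarrow> real) \<Rightarrow> 'a \<Rightarrow> 'a" where
  "grad f x = (\<Sum>b\<in>Basis. frechet_derivative f (at x) b *\<^sub>R b)"

definition Lp :: "real \<Rightarrow> 'a::euclidean_space set \<Rightarrow> ('a \<Rightarrow> 'b::euclidean_space) set" where
  "Lp p \<Omega> = {f. f \<in> borel_measurable (lebesgue_on \<Omega>) \<and>
                 integrable (lebesgue_on \<Omega>) (\<lambda>x. norm (f x) powr p)}"

definition Lp_norm :: "real \<Rightarrow> 'a::euclidean_space set \<Rightarrow> ('a \<Rightarrow> 'b::euclidean_space) \<Rightarrow> real" where
  "Lp_norm p \<Omega> f = (LINT x|lebesgue_on \<Omega>. norm (f x) powr p) powr (1 / p)"

definition has_weak_gradient ::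
    "'a::euclidean_space set \<Rightarrow> ('a \<Rightarrow> real) \<Rightarrow> ('a \<Rightarrow> 'a) \<Rightarrow> bool" where
  "has_weak_gradient \<Omega> u Du \<longleftrightarrow>
     (\<forall>K. compact K \<and> K \<subseteq> \<Omega> \<longrightarrow> u absolutely_integrable_on K \<and> Du absolutely_integrable_on K) \<and>
     (\<forall>\<phi>\<in>test_functions \<Omega>.
        (LINT x|lebesgue_on \<Omega>. u x *\<^sub>R grad \<phi> x) = - (LINT x|lebesgue_on \<Omega>. \<phi> x *\<^sub>R Du x))"

text \<open>
  Weak gradients are unique only up to null sets. The Sobolev spaces are therefore given as
  relations: \<open>sobolev p \<Omega> u Du\<close> says that \<open>u\<close> belongs to $W^{1,p}(\Omega)$ and that \<open>Du\<close> is a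
  representative of its weak gradient, and \<open>sobolev0\<close> likewise for $W^{1,p}_0(\Omega)$. None of the
  integrals below depends on the representative.
\<close>

definition sobolev ::
    "real \<Rightarrow> 'a::euclidean_space set \<Rightarrow> ('a \<Rightarrow> real) \<Rightarrow> ('a \<Rightarrow> 'a) \<Rightarrow> bool" where
  "sobolev p \<Omega> u Du \<longleftrightarrow> u \<in> Lp p \<Omega> \<and> Du \<in> Lp p \<Omega> \<and> has_weak_gradient \<Omega> u Du"

definition sobolev0 ::
    "real \<Rightarrow> 'a::euclidean_space set \<Rightarrow> ('a \<Rightarrow> real) \<Rightarrow> ('a \<Rightarrow> 'a) \<Rightarrow> bool" where
  "sobolev0 p \<Omega> u Du \<longleftrightarrow> sobolev p \<Omega> u Du \<and>
     (\<forall>e>0. \<exists>\<phi>\<in>test_functions \<Omega>.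
        Lp_norm p \<Omega> (\<lambda>x. u x - \<phi> x) + Lp_norm p \<Omega> (\<lambda>x. Du x - grad \<phi> x) < e)"

definition lambda1 :: "real \<Rightarrow> 'a::euclidean_space set \<Rightarrow> ereal" where
  "lambda1 p \<Omega> =
     Inf {ereal (LINT x|lebesgue_on \<Omega>. norm (D\<phi> x) powr p) | \<phi> D\<phi>.
            sobolev0 p \<Omega> \<phi> D\<phi> \<and> (LINT x|lebesgue_on \<Omega>. \<bar>\<phi> x\<bar> powr p) = 1}"

definition lambda_ess :: "real \<Rightarrow> 'a::euclidean_space set \<Rightarrow> ereal" where
  "lambda_ess p \<Omega> = (SUP R\<in>{0<..}. lambda1 p (\<Omega> - closure (ball 0 R)))"

text \<open>
  For \<open>1 < p < 2\<close> the vector field $|\nabla v|^{p-2}\nabla v$ is read as zero where $\nabla v = 0$;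
  this is what the expression below evaluates to.
\<close>

definition nonneg_subsolution ::
    "real \<Rightarrow> 'a::euclidean_space set \<Rightarrow> real \<Rightarrow> ('a \<Rightarrow> real) \<Rightarrow> bool" where
  "nonneg_subsolution p \<Omega> l v \<longleftrightarrow>
     (AE x in lebesgue_on \<Omega>. 0 \<le> v x) \<and>
     (\<exists>Dv. sobolev0 p \<Omega> v Dv \<and>
        (\<forall>\<phi> D\<phi>. sobolev0 p \<Omega> \<phi> D\<phi> \<and> (AE x in lebesgue_on \<Omega>. 0 \<le> \<phi> x) \<longrightarrow>
           (LINT x|lebesgue_on \<Omega>. (norm (Dv x) powr (p - 2) *\<^sub>R Dv x) \<bullet> D\<phi> x)
             \<le> l * (LINT x|lebesgue_on \<Omega>. v x powr (p - 1) * \<phi> x)))"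

definition exp_decay_bound ::
    "real \<Rightarrow> 'a::euclidean_space set \<Rightarrow> real \<Rightarrow> real \<Rightarrow> ('a \<Rightarrow> real) \<Rightarrow> bool" where
  "exp_decay_bound p \<Omega> C \<alpha> v \<longleftrightarrow>
     (AE x in lebesgue_on \<Omega>. 0 \<le> v x \<and> v x \<le> C * Lp_norm p \<Omega> v * exp (- \<alpha> * norm x))"

end

theory Submission
  imports Defs
begin

text \<open>
  The subsolution $v$ is tested with $\eta^p G(v)$, where $\eta$ cuts off a ball around the origin and
  $G$ is a convex truncation of the identity at a level $k$. Young's inequality absorbs the gradient of
  $\eta$, and for every $\mu > \lambda$ one obtains a Caccioppoli inequality (\<open>energy_estimate\<close>)
  $$\int |\nabla(\eta\, G(v))|^p \le \mu \int v^{p-1} G(v)\, \eta^p + C \int |\nabla \eta|^p (v-k)_+^p.$$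
  The theorem results from two different lower bounds of the left hand side.

  First let $G$ be the identity and let $\eta$ vanish on $B_r$ for some $r > R$. Then $\eta v$ belongs
  to $W^{1,p}_0(\Omega\setminus\overline{B_R})$, and the left hand side is at least
  $L \int \eta^p v^p$ for every $L \le \lambda_{1,p}(\Omega\setminus\overline{B_R})$. If
  $\lambda < \mu < L$, the first term on the right is absorbed. As $\nabla\eta$ lives in an annulus of
  width one, the mass $a(r)$ of $v^p$ outside $B_r$ satisfies
  $(L-\mu)\, a(r+1) \le C\,(a(r) - a(r+1))$ (\<open>hole_filling\<close>) and decays geometrically. By
  definition of $\mathcal{E}_p(\Omega)$ such an $L$ exists for every $\lambda < \mathcal{E}_p(\Omega)$.
  Since $C$ does not depend on $L$, the ratio is as small as desired if
  $\mathcal{E}_p(\Omega) = +\infty$; this is the difference between the two parts of the theorem.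

  Secondly, the left hand side is bounded below by a Faber-Krahn inequality, and De Giorgi's iteration on
  the exterior regions $\{|x| \ge r\}$ yields $v^p \le K\, a(R)$ almost everywhere on $|x| \ge R+1$
  (\<open>subsolution_locally_bounded\<close>). Exterior regions instead of balls allow the same cut-offs to be used
  in both arguments, and the two results combine to the pointwise decay (\<open>geometric_tail_decay\<close>).

  The Faber-Krahn inequality has an elementary proof. Translations of Sobolev functions satisfy
  $\int |w(x+h)-w(x)|^p\,dx \le C\, |h|^p \int |\nabla w|^p$. If $h$ ranges over a ball with twice the
  measure of the support of $w$, then for each $x$ at least half of the $h$ have $w(x+h) = 0$;
  averaging over $h$ bounds $\int |w|^p$ (\<open>faber_krahn\<close>).

  It remains to arrange that the rate decreases in $\lambda$ and tends to zero. A subsolution for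
  $\lambda$ is one for every larger constant, so the supremum of the admissible rates is nonincreasing
  in $\lambda$. Multiplying it by a strictly decreasing function that vanishes at
  $\mathcal{E}_p(\Omega)$ gives both properties.

  Since $W^{1,p}_0$ is a closure of smooth functions, all cut-offs and truncations are chosen smooth, and
  the product and chain rules pass to the limit along approximating sequences
  (\<open>sobolev0_cutoff_compose\<close>).
\<close>

section \<open>Smooth functions\<close>

lemma Ck_differentiable: "Ck (Suc k) f \<Longrightarrow> f differentiable (at x)"
  by simp

lemma Ck_SucI:
  assumes "\<And>x. (f has_derivative (\<lambda>h. f' x h)) (at x)"
    and "\<And>b. b \<in> Basis \<Longrightarrow> Ck k (\<lambda>x. f' x b)"
  shows "Ck (Suc k) f"
proof -
  have "frechet_derivative f (at x) = f' x" for x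
    using frechet_derivative_at[OF assms(1)[of x]] by (simp add: eta_contract_eq)
  then show ?thesis
    using assms by (auto simp: differentiable_def)
qed

lemma Ck_has_derivative:
  "Ck (Suc k) f \<Longrightarrow> (f has_derivative frechet_derivative f (at x)) (at x)"
  by (simp add: frechet_derivative_works)

lemma Ck_Suc_imp_Ck: "Ck (Suc k) f \<Longrightarrow> Ck k f"
proof (induction k arbitrary: f)
  case 0
  then show ?case
    by (auto intro!: continuous_at_imp_continuous_on differentiable_imp_continuous_within)
next
  case (Suc k)
  then show ?case by (metis Ck.simps(2))
qed

lemma Ck_const: "Ck k (\<lambda>x. c)"
proof (induction k arbitrary: c)
  case (Suc k)
  show ?case by (rule Ck_SucI[where f'="\<lambda>_ _. 0"]) (auto intro: Suc)
qed auto

lemma Ck_add: "Ck k f \<Longrightarrow> Ck k g \<Longrightarrow> Ck k (\<lambda>x. f x + g x)"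
proof (induction k arbitrary: f g)
  case 0
  then show ?case by (auto intro: continuous_on_add)
next
  case (Suc k)
  show ?case
    by (rule Ck_SucI[OF has_derivative_add[OF Ck_has_derivative[OF Suc.prems(1)]
          Ck_has_derivative[OF Suc.prems(2)]]])
       (use Suc in auto)
qed

lemma Ck_mult: "Ck k f \<Longrightarrow> Ck k g \<Longrightarrow> Ck k (\<lambda>x. f x * g x)"
proof (induction k arbitrary: f g)
  case 0
  then show ?case by (auto intro: continuous_on_mult)
next
  case (Suc k)
  show ?case
    by (rule Ck_SucI[OF has_derivative_mult[OF Ck_has_derivative[OF Suc.prems(1)]
          Ck_has_derivative[OF Suc.prems(2)]]])
       (use Suc Ck_Suc_imp_Ck in \<open>auto intro!: Ck_add Suc.IH\<close>)
qed

lemma frechet_derivative_real: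
  fixes g :: "real \<Rightarrow> real"
  assumes "g differentiable (at y)"
  shows "frechet_derivative g (at y) h = frechet_derivative g (at y) 1 * h"
proof -
  have "linear (frechet_derivative g (at y))"
    using linear_frechet_derivative[OF assms] .
  from linear_cmul[OF this, of h 1] show ?thesis by simp
qed

text \<open>Differentiability of the inner function is assumed to every order because the inductive step on the
  outer function multiplies by a derivative of the inner one.\<close>

lemma Ck_compose:
  fixes g :: "real \<Rightarrow> real"
  assumes "\<And>k. Ck k u" "Ck k g"
  shows "Ck k (\<lambda>x. g (u x))"
  using assms(2)
proof (induction k arbitrary: g)
  case 0
  have "continuous_on UNIV u" using assms(1)[of 0] by simp
  then show ?case using 0
    by (simp add: continuous_on_compose2[of UNIV g])
next
  case (Suc k)
  have du: "(u has_derivative frechet_derivative u (at x)) (at x)" for x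
    using Ck_has_derivative[OF assms(1)] .
  have dg: "(g has_derivative (\<lambda>h. frechet_derivative g (at y) 1 * h)) (at y)" for y
    using Ck_has_derivative[OF Suc.prems] frechet_derivative_real Suc.prems
    by (metis (no_types, lifting) Ck_differentiable ext)
  show ?case
  proof (rule Ck_SucI)
    show "((\<lambda>x. g (u x)) has_derivative
        (\<lambda>h. frechet_derivative g (at (u x)) 1 * frechet_derivative u (at x) h)) (at x)" for x
      using diff_chain_at[OF du dg] by (simp add: o_def)
    show "Ck k (\<lambda>x. frechet_derivative g (at (u x)) 1 * frechet_derivative u (at x) b)"
      if b: "b \<in> Basis" for b
    proof (rule Ck_mult)
      show "Ck k (\<lambda>x. frechet_derivative g (at (u x)) 1)"
        by (rule Suc.IH) (use Suc.prems in simp)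
      show "Ck k (\<lambda>x. frechet_derivative u (at x) b)"
        using assms(1)[of "Suc k"] b by simp
    qed
  qed
qed

lemma Ck_powr:
  assumes "\<And>k. Ck k u" "\<And>x. 0 < u x"
  shows "Ck k (\<lambda>x. u x powr a)"
proof (induction k arbitrary: a)
  case 0
  have "continuous_on UNIV u" using assms(1)[of 0] by simp
  then show ?case using assms(2) by (auto intro!: continuous_intros simp: less_imp_neq[symmetric])
next
  case (Suc k)
  have du: "(u has_derivative frechet_derivative u (at x)) (at x)" for x
    using Ck_has_derivative[OF assms(1)] .
  show ?case
  proof (rule Ck_SucI)
    show "((\<lambda>x. u x powr a) has_derivative
        (\<lambda>h. a * (u x powr (a - 1) * frechet_derivative u (at x) h))) (at x)" for x
      by (rule has_derivative_eq_rhs[OF has_derivative_powr[OF du has_derivative_const]])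
         (use assms(2)[of x] in \<open>auto simp: fun_eq_iff powr_diff\<close>)
    show "Ck k (\<lambda>x. a * (u x powr (a - 1) * frechet_derivative u (at x) b))"
      if b: "b \<in> Basis" for b
      using assms(1)[of "Suc k"] b by (auto intro!: Ck_mult Ck_const Suc)
  qed
qed

lemma smooth_const: "smooth (\<lambda>x. c)" by (simp add: smooth_def Ck_const)
lemma smooth_add: "smooth f \<Longrightarrow> smooth g \<Longrightarrow> smooth (\<lambda>x. f x + g x)" by (simp add: smooth_def Ck_add)
lemma smooth_mult: "smooth f \<Longrightarrow> smooth g \<Longrightarrow> smooth (\<lambda>x. f x * g x)" by (simp add: smooth_def Ck_mult)
lemma smooth_compose: "smooth g \<Longrightarrow> smooth u \<Longrightarrow> smooth (\<lambda>x. g (u x))" for g :: "real \<Rightarrow> real"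
  by (simp add: smooth_def Ck_compose)
lemma smooth_powr: "smooth u \<Longrightarrow> (\<And>x. 0 < u x) \<Longrightarrow> smooth (\<lambda>x. u x powr a)"
  by (simp add: smooth_def Ck_powr)

lemma smooth_inner: "smooth (\<lambda>x. x \<bullet> c)"
proof -
  have "Ck k (\<lambda>x. x \<bullet> c)" for k
  proof (cases k)
    case (Suc m)
    show ?thesis unfolding Suc
      by (rule Ck_SucI[where f'="\<lambda>_ h. h \<bullet> c"]) (auto intro!: derivative_eq_intros Ck_const)
  qed (auto intro!: continuous_intros)
  then show ?thesis by (simp add: smooth_def)
qed

lemma smooth_ident: "smooth (\<lambda>x::real. x)"
  using smooth_inner[of "1::real"] by simp

lemma smooth_diff: "smooth f \<Longrightarrow> smooth g \<Longrightarrow> smooth (\<lambda>x. f x - g x)"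
  using smooth_add[OF _ smooth_mult[OF smooth_const[of "-1"]], of f g] by simp

lemma smooth_norm_squared: "smooth (\<lambda>x. x \<bullet> x)"
proof -
  have "Ck k (\<lambda>x::'a. x \<bullet> x)" for k
  proof (cases k)
    case (Suc m)
    have "Ck m (\<lambda>x::'a. 2 * (x \<bullet> b))" for b
      using smooth_inner[of b] by (auto simp: smooth_def intro!: Ck_mult Ck_const)
    then show ?thesis unfolding Suc
      by (intro Ck_SucI[where f'="\<lambda>x h. 2 * (x \<bullet> h)"])
         (auto intro!: derivative_eq_intros simp: inner_commute)
  qed (auto intro!: continuous_intros)
  then show ?thesis by (simp add: smooth_def)
qed

lemma smooth_has_derivative: "smooth f \<Longrightarrow> (f has_derivative frechet_derivative f (at x)) (at x)"
  unfolding smooth_def by (blast intro: Ck_has_derivative)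

lemma smooth_continuous_on: "smooth f \<Longrightarrow> continuous_on S f"
  by (metis Ck.simps(1) continuous_on_subset smooth_def subset_UNIV)

text \<open>The gradient is assembled from the partial derivatives, so linearity of the derivative identifies it
  as the Riesz representative.\<close>

lemma frechet_derivative_eq_grad:
  assumes "f differentiable (at x)"
  shows "frechet_derivative f (at x) h = grad f x \<bullet> h"
proof -
  interpret linear "frechet_derivative f (at x)"
    using linear_frechet_derivative[OF assms] .
  have "frechet_derivative f (at x) h = frechet_derivative f (at x) (\<Sum>b\<in>Basis. (h \<bullet> b) *\<^sub>R b)"
    by (simp add: euclidean_representation)
  also have "\<dots> = grad f x \<bullet> h"
    by (simp add: sum scaleR grad_def inner_sum_left inner_commute[of h] mult.commute)
  finally show ?thesis .
qed

lemma grad_eqI: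
  assumes "(f has_derivative (\<lambda>h. a \<bullet> h)) (at x)"
  shows "grad f x = a"
proof -
  have "frechet_derivative f (at x) = (\<lambda>h. a \<bullet> h)"
    using frechet_derivative_at[OF assms] by simp
  then show ?thesis
    by (simp add: grad_def euclidean_representation)
qed

lemma smooth_has_grad: "smooth f \<Longrightarrow> (f has_derivative (\<lambda>h. grad f x \<bullet> h)) (at x)"
  using smooth_has_derivative[of f x] frechet_derivative_eq_grad[of f x]
  by (metis (no_types, lifting) differentiable_def ext)

lemma smooth_continuous_grad:
  assumes "smooth f" shows "continuous_on S (grad f)"
proof -
  have "Ck (Suc 0) f" using assms unfolding smooth_def by blast
  then have "continuous_on S (\<lambda>x. frechet_derivative f (at x) b)" if "b \<in> Basis" for b
    using that by (auto intro: continuous_on_subset)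
  then show ?thesis
    unfolding grad_def[abs_def] by (intro continuous_intros) auto
qed

lemma smooth_frechet_derivative: "smooth f \<Longrightarrow> b \<in> Basis \<Longrightarrow> smooth (\<lambda>x. frechet_derivative f (at x) b)"
  unfolding smooth_def by (metis Ck.simps(2))

lemma grad_mult:
  assumes "smooth f" "smooth g"
  shows "grad (\<lambda>x. f x * g x) x = f x *\<^sub>R grad g x + g x *\<^sub>R grad f x"
  by (rule grad_eqI, rule has_derivative_eq_rhs[OF has_derivative_mult[OF
      smooth_has_grad[OF assms(1)] smooth_has_grad[OF assms(2)]]])
     (auto simp: inner_add_left fun_eq_iff mult.commute)

lemma smooth_has_deriv:
  fixes g :: "real \<Rightarrow> real"
  shows "smooth g \<Longrightarrow> (g has_real_derivative deriv g y) (at y)"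
  by (metis DERIV_deriv_iff_real_differentiable differentiable_def smooth_has_derivative)

lemma smooth_deriv:
  fixes g :: "real \<Rightarrow> real"
  assumes "smooth g" shows "smooth (deriv g)"
proof -
  have "frechet_derivative g (at y) 1 = deriv g y" for y
    using frechet_derivative_at[OF smooth_has_deriv[OF assms, unfolded has_field_derivative_def], of y]
    by (metis mult.right_neutral)
  then show ?thesis using smooth_frechet_derivative[OF assms, of 1] by simp
qed

lemma grad_compose:
  fixes g :: "real \<Rightarrow> real"
  assumes "smooth g" "smooth u"
  shows "grad (\<lambda>x. g (u x)) x = deriv g (u x) *\<^sub>R grad u x"
proof (rule grad_eqI)
  have "((g \<circ> u) has_derivative (*) (deriv g (u x)) \<circ> (\<lambda>h. grad u x \<bullet> h)) (at x)"
    using diff_chain_at[OF smooth_has_grad[OF assms(2)], of g "(*) (deriv g (u x))" x]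
      smooth_has_deriv[OF assms(1), of "u x"] by (simp add: has_field_derivative_def)
  then show "((\<lambda>x. g (u x)) has_derivative (\<bullet>) (deriv g (u x) *\<^sub>R grad u x)) (at x)"
    by (simp add: o_def inner_scaleR_left[abs_def])
qed

lemma grad_const: "grad (\<lambda>x. c) x = 0"
  by (rule grad_eqI) simp

section \<open>Radial cut-offs and smooth truncations\<close>

text \<open>The derivatives of $e^{-s/t}$, extended by zero to $t \le 0$, have the form $P(1/t)\, e^{-s/t}$ with a
  polynomial $P$. Working with the whole family makes smoothness an induction with the derivative of a
  member being a member again.\<close>

definition flat_exp :: "real poly \<Rightarrow> real \<Rightarrow> real \<Rightarrow> real" where
  "flat_exp P s t = (if t > 0 then poly P (1 / t) * exp (- s / t) else 0)"

lemma poly_exp_tendsto_0: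
  fixes s :: real assumes "s > 0"
  shows "((\<lambda>u. poly P u * exp (- s * u)) \<longlongrightarrow> 0) at_top"
proof -
  have 1: "((\<lambda>u::real. u ^ i * exp (- s * u)) \<longlongrightarrow> 0) at_top" for i
  proof -
    have "((\<lambda>u. (1 / s) ^ i * ((s * u) ^ i / exp (s * u))) \<longlongrightarrow> (1/s)^i * 0) at_top"
      by (intro tendsto_mult tendsto_const filterlim_compose[OF tendsto_power_div_exp_0]
          filterlim_tendsto_pos_mult_at_top[OF tendsto_const] assms filterlim_ident)
    then show ?thesis
      using assms by (simp add: power_mult_distrib exp_minus field_simps)
  qed
  have "((\<lambda>u. \<Sum>i\<le>degree P. coeff P i * (u ^ i * exp (- s * u))) \<longlongrightarrow> (\<Sum>i\<le>degree P. coeff P i * 0)) at_top"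
    by (intro tendsto_sum tendsto_mult tendsto_const 1)
  then show ?thesis
    by (simp add: poly_altdef sum_distrib_right mult.assoc)
qed

lemma flat_exp_has_derivative:
  assumes "s > 0"
  shows "(flat_exp P s has_real_derivative
      flat_exp ([:0, 0, 1:] * ([:s:] * P - pderiv P)) s t) (at t)"
proof -
  consider "t > 0" | "t < 0" | "t = 0" by linarith
  then show ?thesis
  proof cases
    case 1
    have "((\<lambda>t. poly P (1 / t) * exp (- s / t)) has_real_derivative
       (poly (pderiv P) (1/t) * (- 1 / t^2)) * exp (- s / t) + exp (-s/t) * (s/t^2) * poly P (1/t)) (at t)"
      using 1 by (auto intro!: derivative_eq_intros DERIV_chain2[OF poly_DERIV] simp: power2_eq_square)
    moreover have ev: "\<forall>\<^sub>F x in nhds t. poly P (1 / x) * exp (- s / x) = flat_exp P s x"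
      using eventually_nhds_in_open[of "{0<..}" t] 1
      by (auto simp: flat_exp_def elim!: eventually_mono)
    ultimately have "(flat_exp P s has_real_derivative
       (poly (pderiv P) (1/t) * (- 1 / t^2)) * exp (- s / t) + exp (-s/t) * (s/t^2) * poly P (1/t)) (at t)"
      by (simp only: DERIV_cong_ev[OF refl ev refl])
    then show ?thesis
      by (rule DERIV_cong) (use 1 in \<open>simp add: flat_exp_def power2_eq_square field_simps\<close>)
  next
    case 2
    have "\<forall>\<^sub>F x in nhds t. 0 = flat_exp P s x"
      using eventually_nhds_in_open[of "{..<0}" t] 2
      by (auto simp: flat_exp_def elim!: eventually_mono)
    then show ?thesis
      using DERIV_cong_ev[of t t "\<lambda>_. 0" "flat_exp P s" 0 0] 2 by (simp add: flat_exp_def)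
  next
    case 3
    have "((\<lambda>h. flat_exp P s h / h) \<longlongrightarrow> 0) (at 0)"
    proof (rule filterlim_split_at)
      have "((\<lambda>h. 0) \<longlongrightarrow> (0::real)) (at_left (0::real))" by simp
      then show "((\<lambda>h. flat_exp P s h / h) \<longlongrightarrow> 0) (at_left 0)"
        by (rule Lim_transform_eventually) (auto simp: flat_exp_def eventually_at_filter)
      have "((\<lambda>h. poly ([:0,1:] * P) (inverse h) * exp (- s * inverse h)) \<longlongrightarrow> 0) (at_right (0::real))"
        using filterlim_compose[OF poly_exp_tendsto_0[OF assms] filterlim_inverse_at_top_right] .
      then show "((\<lambda>h. flat_exp P s h / h) \<longlongrightarrow> 0) (at_right 0)"
        by (rule Lim_transform_eventually)
           (auto simp: flat_exp_def eventually_at_filter divide_inverse mult_ac)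
    qed
    then show ?thesis
      unfolding 3 DERIV_def by (simp add: flat_exp_def)
  qed
qed

lemma smooth_flat_exp:
  assumes "s > 0" shows "smooth (flat_exp P s)"
proof -
  have "Ck k (flat_exp P s)" for k
  proof (induction k arbitrary: P)
    case 0
    then show ?case
      using DERIV_isCont[OF flat_exp_has_derivative[OF assms]]
      by (simp add: continuous_at_imp_continuous_on)
  next
    case (Suc k)
    show ?case
      by (rule Ck_SucI[OF flat_exp_has_derivative[OF assms, unfolded has_field_derivative_def]])
         (use Suc in auto)
  qed
  then show ?thesis by (simp add: smooth_def)
qed

text \<open>For $s = 1$ this is the usual smooth transition from 0 to 1, and in general it is the $s$-th power of
  that function. The flat exponential has the special feature that its real powers $e^{-s/t}$ are again
  smooth at the origin; a generic cut-off $\eta$ could make $\eta^p$ only finitely differentiable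
  where it vanishes.\<close>

definition transition :: "real \<Rightarrow> real \<Rightarrow> real" where
  "transition s t = flat_exp 1 s t * (flat_exp 1 1 t + flat_exp 1 1 (1 - t)) powr (- s)"

lemma flat_exp_sum_pos: "0 < flat_exp 1 1 t + flat_exp 1 1 (1 - t)"
  by (auto simp: flat_exp_def intro: add_pos_pos)

lemma smooth_transition: "s > 0 \<Longrightarrow> smooth (transition s)"
  unfolding transition_def[abs_def]
  by (intro smooth_mult smooth_powr smooth_add smooth_flat_exp flat_exp_sum_pos
      smooth_compose[of "flat_exp 1 1" "\<lambda>t. 1 - t"] smooth_diff smooth_const smooth_ident) auto

lemma transition_powr: "s > 0 \<Longrightarrow> transition s t = transition 1 t powr s"
proof -
  assume s: "s > 0"
  have "flat_exp 1 s t = flat_exp 1 1 t powr s"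
    using s by (simp add: flat_exp_def exp_powr_real)
  then show ?thesis
    using flat_exp_sum_pos[of t] by (simp add: transition_def powr_minus_divide powr_divide)
qed

lemma transition_range: "0 \<le> transition 1 t" "transition 1 t \<le> 1" "t \<le> 0 \<Longrightarrow> transition 1 t = 0" "t \<ge> 1 \<Longrightarrow> transition 1 t = 1"
proof -
  have pos: "0 < flat_exp 1 1 t + flat_exp 1 1 (1 - t)" by (rule flat_exp_sum_pos)
  have ge: "0 \<le> flat_exp 1 1 t" "0 \<le> flat_exp 1 1 (1 - t)" by (auto simp: flat_exp_def)
  have eq: "transition 1 t = flat_exp 1 1 t / (flat_exp 1 1 t + flat_exp 1 1 (1 - t))"
    using pos by (simp add: transition_def powr_minus divide_inverse)
  show "0 \<le> transition 1 t" "transition 1 t \<le> 1" using pos ge by (auto simp: eq)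
  show "t \<le> 0 \<Longrightarrow> transition 1 t = 0" by (simp add: eq flat_exp_def)
  show "t \<ge> 1 \<Longrightarrow> transition 1 t = 1" using pos by (simp add: eq flat_exp_def)
qed

lemma deriv_transition_bounded: "\<exists>M>0. \<forall>t. \<bar>deriv (transition 1) t\<bar> \<le> M"
proof -
  have "compact (deriv (transition 1) ` {0..1})"
    by (intro compact_continuous_image smooth_continuous_on smooth_deriv smooth_transition) auto
  then obtain M where M: "\<And>t. t \<in> {0..1} \<Longrightarrow> \<bar>deriv (transition 1) t\<bar> \<le> M"
    by (metis (no_types, lifting) bounded_iff compact_imp_bounded imageI real_norm_def)
  have "deriv (transition 1) t = 0" if "t \<notin> {0..1}" for t
  proof -
    define c where "c = transition 1 t"
    have "\<forall>\<^sub>F x in nhds t. transition 1 x = c"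
    proof (cases "t < 0")
      case True
      then show ?thesis using eventually_nhds_in_open[of "{..<0}" t]
        by (auto simp: c_def transition_range elim!: eventually_mono)
    next
      case False
      with that have "1 < t" by auto
      then show ?thesis using eventually_nhds_in_open[of "{1<..}" t]
        by (auto simp: c_def transition_range elim!: eventually_mono)
    qed
    then have "deriv (transition 1) t = deriv (\<lambda>_. c) t" by (rule deriv_cong_ev) simp
    then show ?thesis by simp
  qed
  then have "\<bar>deriv (transition 1) t\<bar> \<le> max 1 M" for t
    using M[of t] by (cases "t \<in> {0..1}") auto
  then show ?thesis by (intro exI[of _ "max 1 M"]) auto
qed

lemma deriv_transition_powr:
  assumes "p > 1"
  shows "deriv (transition p) t = p * transition 1 t powr (p - 1) * deriv (transition 1) t"
proof (cases "t > 0")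
  case True
  then have pos: "transition 1 t > 0"
    using flat_exp_sum_pos[of t] by (auto simp: transition_def flat_exp_def)
  have "((\<lambda>t. transition 1 t powr p) has_real_derivative p * transition 1 t powr (p - 1) * deriv (transition 1) t) (at t)"
    using DERIV_fun_powr[OF smooth_has_deriv[OF smooth_transition[of 1]] pos, of p] by simp
  moreover have "(\<lambda>t. transition 1 t powr p) = transition p" using assms by (simp add: transition_powr[of p] fun_eq_iff)
  ultimately show ?thesis by (metis DERIV_imp_deriv)
next
  case False
  have "(transition p has_real_derivative deriv (transition p) t) (at t)"
    using smooth_has_deriv[OF smooth_transition] assms by simp
  then have "deriv (transition p) t = 0"
  proof (rule DERIV_local_min[of _ _ _ 1])
    show "\<forall>y. \<bar>t - y\<bar> < 1 \<longrightarrow> transition p t \<le> transition p y"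
      using False assms by (simp add: transition_powr[of p] transition_range)
  qed auto
  then show ?thesis using False assms by (simp add: transition_range)
qed

text \<open>The second function is the power $\eta^p$ that the test functions of the $p$-Laplacian require.
  It is carried along, with its gradient, because its smoothness does not follow from that of
  $\eta$.\<close>

definition radial_cutoff :: "real \<Rightarrow> real \<Rightarrow> real \<Rightarrow> real \<Rightarrow> ('a::euclidean_space \<Rightarrow> real) \<Rightarrow> ('a \<Rightarrow> real) \<Rightarrow> bool" where
  "radial_cutoff p r s B \<eta> \<zeta> \<longleftrightarrow> smooth \<eta> \<and> smooth \<zeta> \<and>
      (\<forall>x. 0 \<le> \<eta> x \<and> \<eta> x \<le> 1 \<and> \<zeta> x = \<eta> x powr p \<and>
         grad \<zeta> x = (p * \<eta> x powr (p - 1)) *\<^sub>R grad \<eta> x \<and> norm (grad \<eta> x) \<le> B \<and>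
         (norm x \<le> r \<longrightarrow> \<eta> x = 0 \<and> grad \<eta> x = 0) \<and> (s \<le> norm x \<longrightarrow> \<eta> x = 1 \<and> grad \<eta> x = 0))"

text \<open>The profile is composed with the squared norm, which is smooth at the origin. In the transition
  layer the factor $2|x|/(s^2 - r^2) \le 2s/(s^2-r^2)$ is at most $2/(s-r)$.\<close>

lemma exists_radial_cutoff:
  fixes p :: real
  assumes "p > 1"
  shows "\<exists>M>0. \<forall>r s. r < s \<longrightarrow> (\<exists>\<eta> \<zeta> :: 'a::euclidean_space \<Rightarrow> real. radial_cutoff p r s (M / (s - r)) \<eta> \<zeta>)"
proof -
  obtain M where M: "M > 0" "\<And>t. \<bar>deriv (transition 1) t\<bar> \<le> M" using deriv_transition_bounded by auto
  show ?thesis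
  proof (intro exI[of _ "2*M"] conjI allI impI)
    show "0 < 2 * M" using M by simp
    fix r s :: real assume rs: "r < s"
    show "\<exists>\<eta> \<zeta> :: 'a \<Rightarrow> real. radial_cutoff p r s (2 * M / (s - r)) \<eta> \<zeta>"
    proof (cases "r < 0")
      case True
      \<comment> \<open>No point has norm at most r, so the constant 1 qualifies. Negative radii make the
        estimates on exterior regions cover the whole space.\<close>
      show ?thesis
        unfolding radial_cutoff_def
      proof (rule exI[of _ "\<lambda>_. 1"], rule exI[of _ "\<lambda>_. 1"], intro conjI allI)
        fix x :: 'a
        have "\<not> norm x \<le> r" using True norm_ge_zero[of x] by linarith
        then show "norm x \<le> r \<longrightarrow> 1 = (0::real) \<and> grad (\<lambda>x::'a. 1::real) x = 0" by blast
        show "norm (grad (\<lambda>x::'a. 1::real) x) \<le> 2 * M / (s - r)" using rs M by (simp add: grad_const)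
      qed (simp_all add: smooth_const grad_const)
    next
      case False
      \<comment> \<open>The affine function q of the squared norm runs from 0 to 1 between the two spheres.\<close>
      define d where "d = s\<^sup>2 - r\<^sup>2"
      have d: "d > 0" using rs False by (simp add: d_def power_strict_mono)
      have d_eq: "d = (s - r) * (s + r)" by (simp add: d_def power2_eq_square algebra_simps)
      define q :: "'a \<Rightarrow> real" where "q = (\<lambda>x. 1/d * (x \<bullet> x - r\<^sup>2))"
      have q: "smooth q" unfolding q_def
        by (intro smooth_mult smooth_const smooth_diff smooth_norm_squared)
      have gq: "grad q x = (2/d) *\<^sub>R x" for x
        unfolding q_def using d
        by (intro grad_eqI) (auto intro!: derivative_eq_intros simp: inner_commute)
      have s1: "smooth (transition 1)" "smooth (transition p)" using assms smooth_transition by auto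
      have ge: "grad (\<lambda>x. transition 1 (q x)) x = deriv (transition 1) (q x) *\<^sub>R (2/d) *\<^sub>R x" for x
        by (simp add: grad_compose[OF s1(1) q] gq)
      have gz: "grad (\<lambda>x. transition p (q x)) x = deriv (transition p) (q x) *\<^sub>R (2/d) *\<^sub>R x" for x
        by (simp add: grad_compose[OF s1(2) q] gq)
      \<comment> \<open>Values 0 and 1 are extremal, so the derivative vanishes there, endpoints included.\<close>
      have D0: "deriv (transition 1) t = 0" if "t \<le> 0 \<or> 1 \<le> t" for t
      proof (cases "t \<le> 0")
        case True
        show ?thesis
          by (rule DERIV_local_min[OF smooth_has_deriv[OF s1(1)], of 1])
            (use True in \<open>auto simp: transition_range\<close>)
      next
        case False
        then show ?thesis
          by (intro DERIV_local_max[OF smooth_has_deriv[OF s1(1)], of 1])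
            (use that in \<open>auto simp: transition_range\<close>)
      qed
      have out: "q x \<le> 0" if "norm x \<le> r" for x
        using that d power_mono[OF that norm_ge_zero, of 2]
        by (simp add: q_def power2_norm_eq_inner divide_le_0_iff)
      have inn: "1 \<le> q x" if "s \<le> norm x" for x
        using that d power_mono[OF that, of 2] False rs
        by (simp add: q_def power2_norm_eq_inner d_def field_simps)
      have bd: "norm (grad (\<lambda>x. transition 1 (q x)) x) \<le> 2 * M / (s - r)" for x
      proof (cases "norm x < s")
        case True
        have "norm (grad (\<lambda>x. transition 1 (q x)) x) = \<bar>deriv (transition 1) (q x)\<bar> * (2/d * norm x)"
          using d by (simp add: ge abs_mult)
        also have "\<dots> \<le> M * (2/d * (s + r))"
          using M True False d by (intro mult_mono) auto
        also have "\<dots> = 2 * M / (s - r)"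
          using rs False d by (simp add: d_eq field_simps)
        finally show ?thesis .
      next
        case nl: False
        then show ?thesis using inn[of x] rs M by (simp add: ge D0)
      qed
      show ?thesis
        unfolding radial_cutoff_def
      proof (rule exI[of _ "\<lambda>x. transition 1 (q x)"], rule exI[of _ "\<lambda>x. transition p (q x)"], intro conjI allI impI)
        show "smooth (\<lambda>x. transition 1 (q x))" "smooth (\<lambda>x. transition p (q x))"
          using s1 q by (auto intro: smooth_compose)
        fix x
        show "grad (\<lambda>x. transition p (q x)) x = (p * transition 1 (q x) powr (p - 1)) *\<^sub>R grad (\<lambda>x. transition 1 (q x)) x"
          by (simp add: ge gz deriv_transition_powr[OF assms])
        show "norm (grad (\<lambda>x. transition 1 (q x)) x) \<le> 2 * M / (s - r)" by (rule bd)
        show "transition p (q x) = transition 1 (q x) powr p" using assms by (intro transition_powr) auto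
      qed (use out inn in \<open>simp_all add: transition_range ge D0\<close>)
    qed
  qed
qed

text \<open>A smooth substitute for $(t-k)_+$. The inequality $G(t) \le (t-k)_+\, G'(t)$ is what makes the
  Caccioppoli inequality work: every occurrence of $G$ next to a gradient can be paid for by $G'$. It is
  required only on $t \ge 0$, so that the identity with $k = 0$ is an instance.\<close>

definition truncation :: "real \<Rightarrow> (real \<Rightarrow> real) \<Rightarrow> bool" where
  "truncation k G \<longleftrightarrow> smooth G \<and> G 0 = 0 \<and> (\<forall>t. 0 \<le> deriv G t \<and> deriv G t \<le> 1) \<and>
     (\<forall>t\<ge>0. 0 \<le> G t \<and> G t \<le> max 0 (t - k) * deriv G t)"

lemma deriv_id: "deriv (\<lambda>t::real. t) t = 1"
  by (rule DERIV_imp_deriv) (rule DERIV_ident)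

lemma truncation_id: "truncation 0 (\<lambda>t. t)"
  by (simp add: truncation_def smooth_ident deriv_id)

text \<open>The function $t\, e^{-1/t}$ has derivative $(1 + 1/t)\, e^{-1/t}$, which lies between $e^{-1/t}$
  and 1 because $1 + u \le e^u$; the same inequality gives $t\, e^{-1/t} \ge t - 1$. Rescaling moves
  the threshold to $m$ and the width to $d$.\<close>

lemma exists_smooth_truncation:
  fixes m d :: real
  assumes "d > 0" "m \<ge> 0"
  shows "\<exists>G. truncation m G \<and> (\<forall>t\<le>m. G t = 0) \<and> (\<forall>t. t - (m + d) \<le> G t)"
proof -
  define g where "g = (\<lambda>t. t * flat_exp 1 1 t)"
  have gs: "smooth g" unfolding g_def
    by (intro smooth_mult smooth_ident smooth_flat_exp) auto
  have dg: "deriv g t = (if t > 0 then (1 + 1/t) * exp (-1/t) else 0)" for t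
  proof -
    have "(g has_real_derivative (flat_exp 1 1 t + flat_exp ([:0, 0, 1:] * ([:1:] * 1 - pderiv 1)) 1 t * t)) (at t)"
      unfolding g_def by (auto intro!: derivative_eq_intros flat_exp_has_derivative)
    from DERIV_imp_deriv[OF this] show ?thesis
      by (auto simp: flat_exp_def pderiv_1 field_simps)
  qed
  have 1: "0 \<le> deriv g t" "deriv g t \<le> 1" "0 \<le> g t" "t \<le> 0 \<Longrightarrow> g t = 0" for t
  proof -
    have "(1 + 1/t) * exp (-1/t) \<le> exp (1/t) * exp (-1/t)"
      by (intro mult_right_mono exp_ge_add_one_self) auto
    then show "deriv g t \<le> 1" by (auto simp: dg exp_minus)
    show "0 \<le> deriv g t" by (simp add: dg)
  qed (auto simp: g_def flat_exp_def)
  have 2: "g t \<le> max 0 t * deriv g t" for t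
    unfolding dg by (auto simp: g_def flat_exp_def field_simps)
  have 3: "t - 1 \<le> g t" for t
  proof (cases "t > 0")
    case True
    have "t - 1 = t * (1 + - 1/t)" using True by (simp add: field_simps)
    also have "\<dots> \<le> t * exp (-1/t)"
      using True by (intro mult_left_mono exp_ge_add_one_self) auto
    finally show ?thesis using True by (simp add: g_def flat_exp_def)
  qed (auto simp: g_def flat_exp_def)
  define G where "G = (\<lambda>t. d * g (1/d * (t - m)))"
  have Gs: "smooth G" unfolding G_def
    by (intro smooth_mult smooth_const smooth_compose[OF gs] smooth_diff smooth_ident)
  have dG: "deriv G t = deriv g (1/d * (t - m))" for t
  proof (rule DERIV_imp_deriv)
    show "(G has_real_derivative deriv g (1/d * (t - m))) (at t)"
      unfolding G_def using assms
      by (auto intro!: derivative_eq_intros DERIV_chain2[OF smooth_has_deriv[OF gs]])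
  qed
  show ?thesis
    unfolding truncation_def
  proof (intro exI[of _ G] conjI allI impI)
    fix t
    show "G 0 = 0" using assms by (simp add: G_def 1 divide_nonpos_pos)
    show "t \<le> m \<Longrightarrow> G t = 0" using assms by (simp add: G_def 1 divide_nonpos_pos)
    show "0 \<le> G t" using assms 1 by (simp add: G_def)
    have "G t \<le> d * (max 0 (1/d * (t - m)) * deriv g (1/d * (t - m)))"
      unfolding G_def using assms by (intro mult_left_mono 2) auto
    also have "\<dots> = max 0 (t - m) * deriv G t"
      using assms by (simp add: dG max_mult_distrib_left max_def divide_le_0_iff field_simps)
    finally show "G t \<le> max 0 (t - m) * deriv G t" .
    show "t - (m + d) \<le> G t"
      using mult_left_mono[OF 3[of "1/d * (t - m)"], of d] assms by (simp add: G_def right_diff_distrib)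
  qed (use Gs 1 in \<open>auto simp: dG\<close>)
qed

section \<open>Test functions and their translates\<close>

lemma norm_powr_le:
  fixes a :: "'b::real_normed_vector" and b :: "'c::real_normed_vector"
  assumes "norm a \<le> c * norm b" "p > 0"
  shows "norm a powr p \<le> c powr p * norm b powr p"
  using powr_mono2[of p "norm a" "c * norm b"] assms by (simp add: powr_mult)

lemma powr_minus_1_mult: "0 \<le> x \<Longrightarrow> x powr (p - 1) * x = x powr p" for x p :: real
  using powr_add[of x "p - 1" 1] by (cases "x = 0") auto

lemma powr_add_le:
  fixes a b :: "'b::real_normed_vector"
  assumes "p > 0"
  shows "norm (a + b) powr p \<le> 2 powr p * (norm a powr p + norm b powr p)"
proof -
  have "norm (a + b) powr p \<le> (2 * max (norm a) (norm b)) powr p"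
    using norm_triangle_ineq[of a b] assms by (intro powr_mono2) auto
  also have "\<dots> = 2 powr p * (max (norm a) (norm b) powr p)"
    by (simp add: powr_mult)
  also have "\<dots> \<le> 2 powr p * (norm a powr p + norm b powr p)"
    by (intro mult_left_mono) (auto simp: max_def)
  finally show ?thesis .
qed

text \<open>The sharp constant $2^{p-1}$ matters: with it, doubling a translation multiplies the integral of the
  $p$-th power of the difference by at most $2^p$, with no
  loss under iteration.\<close>

lemma powr_add_le_convex:
  fixes a b p :: real
  assumes "p \<ge> 1" "a \<ge> 0" "b \<ge> 0"
  shows "(a + b) powr p \<le> 2 powr (p - 1) * (a powr p + b powr p)"
proof (cases "a = 0 \<or> b = 0")
  case True
  have "1 \<le> 2 powr (p - 1)" using assms by (simp add: ge_one_powr_ge_zero)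
  then show ?thesis using True mult_right_mono[of 1 "2 powr (p - 1)" "a powr p"]
      mult_right_mono[of 1 "2 powr (p - 1)" "b powr p"] by auto
next
  case False
  then have "((1 - 1/2) *\<^sub>R a + (1/2) *\<^sub>R b) powr p \<le> (1 - 1/2) * a powr p + (1/2) * b powr p"
    using assms by (intro convex_onD[OF powr_convex]) auto
  then have "((a + b) / 2) powr p \<le> (a powr p + b powr p) / 2"
    by (simp add: field_simps)
  then have "2 powr p * ((a + b) / 2) powr p \<le> 2 powr p * ((a powr p + b powr p) / 2)"
    by (intro mult_left_mono) auto
  moreover have "2 powr p * ((a + b) / 2) powr p = (a + b) powr p"
    using assms by (simp add: powr_divide)
  ultimately show ?thesis by (simp add: powr_diff)
qed

lemma grad_eq_0_outside_support:
  assumes "x \<notin> closure {x. f x \<noteq> 0}"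
  shows "grad f x = 0"
proof -
  have "(f has_derivative (\<lambda>h. 0 \<bullet> h)) (at x)"
  proof (rule has_derivative_transform_within_open[of "\<lambda>_. 0"])
    show "open (- closure {x. f x \<noteq> 0})" by auto
    show "\<And>y. y \<in> - closure {x. f x \<noteq> 0} \<Longrightarrow> 0 = f y"
      using closure_subset[of "{x. f x \<noteq> 0}"] by auto
  qed (use assms in auto)
  then show ?thesis by (rule grad_eqI)
qed

lemma eq_0_outside_support: "x \<notin> closure {x. f x \<noteq> 0} \<Longrightarrow> f x = 0"
  using closure_subset[of "{x. f x \<noteq> 0}"] by auto

lemma test_functions_outside:
  assumes "f \<in> test_functions \<Omega>" "x \<notin> \<Omega>"
  shows "f x = 0" "grad f x = 0"
  using assms eq_0_outside_support[of x f] grad_eq_0_outside_support[of x f] by (auto simp: test_functions_def)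

lemma test_functions_subset: "f \<in> test_functions \<Omega> \<Longrightarrow> f \<in> test_functions UNIV"
  by (simp add: test_functions_def)

lemma test_functions_bounds:
  fixes f :: "'a::euclidean_space \<Rightarrow> real"
  assumes "f \<in> test_functions UNIV"
  obtains M r where "M > 0" "r > 0" "\<And>x. \<bar>f x\<bar> \<le> M" "\<And>x. norm (grad f x) \<le> M"
    "\<And>x. norm x > r \<Longrightarrow> f x = 0 \<and> grad f x = 0"
proof -
  let ?K = "closure {x. f x \<noteq> 0}"
  have K: "compact ?K" and sm: "smooth f" using assms by (auto simp: test_functions_def)
  have "bounded (f ` ?K)" "bounded (grad f ` ?K)"
    using K sm by (auto intro!: compact_imp_bounded compact_continuous_image
        smooth_continuous_on smooth_continuous_grad)
  then obtain M1 M2 where M: "\<And>x. x \<in> ?K \<Longrightarrow> \<bar>f x\<bar> \<le> M1" "\<And>x. x \<in> ?K \<Longrightarrow> norm (grad f x) \<le> M2"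
    unfolding bounded_iff by (metis imageI real_norm_def)
  obtain r where r: "\<And>x. x \<in> ?K \<Longrightarrow> norm x \<le> r"
    using compact_imp_bounded[OF K] unfolding bounded_iff by auto
  show ?thesis
  proof (rule that[of "max 1 (max M1 M2)" "max 1 r"])
    fix x
    show "\<bar>f x\<bar> \<le> max 1 (max M1 M2)"
      using M(1)[of x] eq_0_outside_support[of x f] by (cases "x \<in> ?K") auto
    show "norm (grad f x) \<le> max 1 (max M1 M2)"
      using M(2)[of x] grad_eq_0_outside_support[of x f] by (cases "x \<in> ?K") auto
    show "max 1 r < norm x \<Longrightarrow> f x = 0 \<and> grad f x = 0"
      using r[of x] eq_0_outside_support[of x f] grad_eq_0_outside_support[of x f] by auto
  qed auto
qed

lemma smooth_borel: "smooth f \<Longrightarrow> f \<in> borel_measurable borel"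
  by (intro borel_measurable_continuous_onI smooth_continuous_on)

lemma smooth_grad_borel: "smooth f \<Longrightarrow> grad f \<in> borel_measurable borel"
  by (intro borel_measurable_continuous_onI smooth_continuous_grad)

lemma integrable_bounded_support:
  fixes g :: "'a::euclidean_space \<Rightarrow> 'b::euclidean_space"
  assumes g[measurable]: "g \<in> borel_measurable borel"
    and "\<And>x. norm (g x) \<le> M" "\<And>x. norm x > r \<Longrightarrow> g x = 0"
  shows "integrable lborel g"
proof (rule Bochner_Integration.integrable_bound)
  show "integrable lborel (\<lambda>x. indicator (cball 0 r) x *\<^sub>R M :: real)"
    by (rule borel_integrable_compact) auto
  show "AE x in lborel. norm (g x) \<le> norm (indicator (cball 0 r) x *\<^sub>R M)"
    using assms by (auto simp: indicator_def intro: order_trans[OF _ abs_ge_self])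
qed simp

lemma integral_translation:
  fixes g :: "'a::euclidean_space \<Rightarrow> 'b::euclidean_space"
  assumes g[measurable]: "g \<in> borel_measurable borel"
  shows "(\<integral>x. g (x + h) \<partial>lborel) = (\<integral>x. g x \<partial>lborel)"
proof -
  have "(\<integral>x. g x \<partial>lborel) = (\<integral>x. g x \<partial>distr lborel borel ((+) h))"
    by (simp add: lborel_distr_plus)
  also have "\<dots> = (\<integral>x. g (h + x) \<partial>lborel)"
    by (rule integral_distr) auto
  finally show ?thesis by (simp add: add.commute)
qed

lemma integrable_translation:
  fixes g :: "'a::euclidean_space \<Rightarrow> 'b::euclidean_space"
  assumes "integrable lborel g"
  shows "integrable lborel (\<lambda>x. g (x + h))"
proof -
  have "integrable (distr lborel borel ((+) h)) g"
    using assms by (simp only: lborel_distr_plus)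
  then show ?thesis
    by (subst (asm) integrable_distr_eq) (use assms in \<open>auto simp: add.commute\<close>)
qed

text \<open>Pointwise convergence together with a common bound and a common bounded support, as dominated
  convergence needs it. The scales $c_n$ are $n + 1$ for the divergence theorem and $2^n$ for the
  translation estimate.\<close>

lemma difference_quotient:
  fixes f :: "'a::euclidean_space \<Rightarrow> real" and c :: "nat \<Rightarrow> real"
  assumes "f \<in> test_functions UNIV" "\<And>n. 1 \<le> c n" "filterlim c at_top sequentially"
  shows "(\<lambda>n. c n * (f (x + h /\<^sub>R c n) - f x)) \<longlonglongrightarrow> grad f x \<bullet> h"
    and "\<exists>M r. \<forall>n x. \<bar>c n * (f (x + h /\<^sub>R c n) - f x)\<bar> \<le> M \<and>
       (norm x > r \<longrightarrow> c n * (f (x + h /\<^sub>R c n) - f x) = 0)"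
proof -
  have sm: "smooth f" using assms(1) by (simp add: test_functions_def)
  have "((\<lambda>t. f (x + t *\<^sub>R h)) has_derivative (\<lambda>t. grad f (x + 0 *\<^sub>R h) \<bullet> (t *\<^sub>R h))) (at 0)"
    by (rule has_derivative_compose[OF _ smooth_has_grad[OF sm]])
       (auto intro!: derivative_eq_intros)
  then have "((\<lambda>t. f (x + t *\<^sub>R h)) has_real_derivative grad f x \<bullet> h) (at 0)"
    by (simp add: has_field_derivative_def mult.commute[of _ "grad f x \<bullet> h"])
  then have lim: "((\<lambda>t. (f (x + t *\<^sub>R h) - f x) / t) \<longlongrightarrow> grad f x \<bullet> h) (at 0)"
    by (simp add: DERIV_def)
  have "filterlim (\<lambda>n. inverse (c n)) (at 0) sequentially"
    using filterlim_compose[OF filterlim_inverse_at_right_top assms(3)]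
    by (auto simp: filterlim_at elim!: eventually_mono)
  from filterlim_compose[OF lim this]
  show "(\<lambda>n. c n * (f (x + h /\<^sub>R c n) - f x)) \<longlonglongrightarrow> grad f x \<bullet> h"
    by (simp add: divide_inverse mult.commute)
  obtain M r where M: "M > 0" "r > 0" "\<And>x. norm (grad f x) \<le> M"
    "\<And>x. norm x > r \<Longrightarrow> f x = 0"
    using test_functions_bounds[OF assms(1)] by metis
  have lip: "\<bar>f (x + y) - f x\<bar> \<le> M * norm y" for x y
  proof -
    have "norm (f (x + y) - f x) \<le> M * norm (x + y - x)"
    proof (rule differentiable_bound[of UNIV f "\<lambda>x h. grad f x \<bullet> h"])
      show "onorm ((\<bullet>) (grad f z)) \<le> M" for z
        using M(1) order_trans[OF Cauchy_Schwarz_ineq2 mult_right_mono[OF M(3)[of z] norm_ge_zero]]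
        by (intro onorm_bound) auto
    qed (auto intro: has_derivative_at_withinI smooth_has_grad[OF sm])
    then show ?thesis by simp
  qed
  show "\<exists>M r. \<forall>n x. \<bar>c n * (f (x + h /\<^sub>R c n) - f x)\<bar> \<le> M \<and>
       (norm x > r \<longrightarrow> c n * (f (x + h /\<^sub>R c n) - f x) = 0)"
  proof (rule exI[of _ "M * norm h"], rule exI[of _ "r + norm h"], intro allI conjI impI)
    fix n and x :: 'a
    have c: "c n \<ge> 1" by (rule assms)
    have "\<bar>c n * (f (x + h /\<^sub>R c n) - f x)\<bar> \<le> c n * (M * norm (h /\<^sub>R c n))"
      using c lip[of x "h /\<^sub>R c n"] by (simp add: abs_mult)
    also have "\<dots> = M * norm h" using c by (simp add: field_simps)
    finally show "\<bar>c n * (f (x + h /\<^sub>R c n) - f x)\<bar> \<le> M * norm h" .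
    assume x: "r + norm h < norm x"
    have "norm (h /\<^sub>R c n) \<le> norm h" using c by (simp add: field_simps mult_le_cancel_left1)
    then have "norm (x + h /\<^sub>R c n) > r" using x norm_diff_ineq[of x "h /\<^sub>R c n"] by linarith
    moreover have "norm x > r" using x norm_ge_zero[of h] by linarith
    ultimately show "c n * (f (x + h /\<^sub>R c n) - f x) = 0" using M(4) by simp
  qed
qed

lemma integrable_grad:
  assumes "f \<in> test_functions UNIV"
  shows "integrable lborel (grad f)"
proof -
  obtain M r where "\<And>x. norm (grad f x) \<le> M" "\<And>x. norm x > r \<Longrightarrow> f x = 0 \<and> grad f x = 0"
    using test_functions_bounds[OF assms] by metis
  then show ?thesis
    using assms by (intro integrable_bounded_support[of "grad f" M r] smooth_grad_borel) (auto simp: test_functions_def)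
qed

text \<open>Difference quotients have integral zero by translation invariance, and they converge to the
  derivative.\<close>

lemma integral_grad_eq_0:
  fixes f :: "'a::euclidean_space \<Rightarrow> real"
  assumes f: "f \<in> test_functions UNIV"
  shows "(\<integral>x. grad f x \<partial>lborel) = 0"
proof (rule euclidean_eqI)
  fix b :: 'a assume "b \<in> Basis"
  have sm: "smooth f" using f by (simp add: test_functions_def)
  note [measurable] = smooth_borel[OF sm] smooth_grad_borel[OF sm]
  define D where "D = (\<lambda>n x. real (Suc n) * (f (x + b /\<^sub>R real (Suc n)) - f x))"
  have c: "filterlim (\<lambda>n. real (Suc n)) at_top sequentially" 
    by (intro filterlim_compose[OF filterlim_real_sequentially] filterlim_Suc)
  have c1: "1 \<le> real (Suc n)" for n by simp
  obtain M r where Mr: "\<And>n x. \<bar>D n x\<bar> \<le> M" "\<And>n x. norm x > r \<Longrightarrow> D n x = 0"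
    using difference_quotient(2)[OF f, of "\<lambda>n. real (Suc n)", OF c1 c, of b] unfolding D_def by metis
  obtain M' r' where Mr': "\<And>x. \<bar>f x\<bar> \<le> M'" "\<And>x. norm x > r' \<Longrightarrow> f x = 0"
    using test_functions_bounds[OF f] by metis
  have fi: "integrable lborel f" by (rule integrable_bounded_support[of _ M' r']) (use Mr' in auto)
  have "(\<lambda>n. \<integral>x. D n x \<partial>lborel) \<longlonglongrightarrow> (\<integral>x. grad f x \<bullet> b \<partial>lborel)"
  proof (rule integral_dominated_convergence[where w="\<lambda>x. indicator (cball 0 r) x *\<^sub>R M"])
    show "integrable lborel (\<lambda>x::'a. indicator (cball 0 r) x *\<^sub>R M :: real)"
      by (rule borel_integrable_compact) auto
    show "AE x in lborel. (\<lambda>n. D n x) \<longlonglongrightarrow> grad f x \<bullet> b"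
      unfolding D_def using difference_quotient(1)[OF f, of "\<lambda>n. real (Suc n)", OF c1 c, of _ b] by auto
    show "AE x in lborel. norm (D n x) \<le> indicator (cball 0 r) x *\<^sub>R M" for n
      using Mr by (auto simp: indicator_def)
  qed (auto simp: D_def)
  moreover have "(\<integral>x. D n x \<partial>lborel) = 0" for n
  proof -
    have s: "integrable lborel (\<lambda>x. f (x + h))" for h
    proof (rule integrable_bounded_support[of _ M' "r' + norm h"])
      fix x :: 'a assume "r' + norm h < norm x"
      then show "f (x + h) = 0" using Mr'(2)[of "x + h"] norm_diff_ineq[of x h] by linarith
    qed (use Mr' in auto)
    show ?thesis unfolding D_def
      by (simp add: Bochner_Integration.integral_diff[OF s fi] integral_translation del: of_nat_Suc)
  qed
  ultimately have "(\<integral>x. grad f x \<bullet> b \<partial>lborel) = 0" by (simp add: LIMSEQ_const_iff)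
  then show "(\<integral>x. grad f x \<partial>lborel) \<bullet> b = 0 \<bullet> b"
    using integrable_grad[OF f] by simp
qed

text \<open>Let $I(h)$ be the left hand side. Convexity gives $I(2h) \le 2^p I(h)$, hence
  $I(h) \le \int |2^n (f(x + 2^{-n} h) - f(x))|^p\,dx$ for all $n$, and the right hand side converges
  to $\int |\nabla f \cdot h|^p$.\<close>

lemma translation_estimate:
  fixes f :: "'a::euclidean_space \<Rightarrow> real"
  assumes f: "f \<in> test_functions UNIV" and p: "p > 1"
  shows "(\<integral>x. \<bar>f (x + h) - f x\<bar> powr p \<partial>lborel) \<le> norm h powr p * (\<integral>x. norm (grad f x) powr p \<partial>lborel)"
proof -
  have sm: "smooth f" using f by (simp add: test_functions_def)
  note [measurable] = smooth_borel[OF sm] smooth_grad_borel[OF sm]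
  obtain M r where Mr: "M > 0" "\<And>x. \<bar>f x\<bar> \<le> M" "\<And>x. norm (grad f x) \<le> M"
    "\<And>x. norm x > r \<Longrightarrow> f x = 0 \<and> grad f x = 0"
    using test_functions_bounds[OF f] by metis
  define I where "I h = (\<integral>x. \<bar>f (x + h) - f x\<bar> powr p \<partial>lborel)" for h
  have int: "integrable lborel (\<lambda>x. \<bar>f (x + h) - f x\<bar> powr p)" for h
  proof (rule integrable_bounded_support[of _ "(2 * M) powr p" "r + norm h"])
    fix x
    show "norm (\<bar>f (x + h) - f x\<bar> powr p) \<le> (2 * M) powr p"
      using Mr(2)[of x] Mr(2)[of "x + h"] p by (auto intro!: powr_mono2)
    assume x: "r + norm h < norm x"
    then have "norm (x + h) > r" using norm_diff_ineq[of x h] by linarith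
    moreover have "norm x > r" using x norm_ge_zero[of h] by linarith
    ultimately show "\<bar>f (x + h) - f x\<bar> powr p = 0" using Mr(4) by simp
  qed simp
  have double: "I (2 *\<^sub>R h) \<le> 2 powr p * I h" for h
  proof -
    have int': "integrable lborel (\<lambda>x. \<bar>f (x + h + h) - f (x + h)\<bar> powr p)"
      using integrable_translation[OF int[of h], of h] by simp
    have "I (2 *\<^sub>R h) \<le> (\<integral>x. 2 powr (p - 1) * (\<bar>f (x + h + h) - f (x + h)\<bar> powr p + \<bar>f (x + h) - f x\<bar> powr p) \<partial>lborel)"
      unfolding I_def
    proof (rule integral_mono)
      fix x
      have "\<bar>f (x + 2 *\<^sub>R h) - f x\<bar> powr p \<le> (\<bar>f (x + h + h) - f (x + h)\<bar> + \<bar>f (x + h) - f x\<bar>) powr p"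
        using p by (intro powr_mono2) (auto simp: scaleR_2 add.assoc)
      also have "\<dots> \<le> 2 powr (p - 1) * (\<bar>f (x + h + h) - f (x + h)\<bar> powr p + \<bar>f (x + h) - f x\<bar> powr p)"
        using p by (intro powr_add_le_convex) auto
      finally show "\<bar>f (x + 2 *\<^sub>R h) - f x\<bar> powr p \<le> \<dots>" .
    qed (use int int' in auto)
    also have "\<dots> = 2 powr (p - 1) * (I h + I h)"
      using int int' integral_translation[of "\<lambda>x. \<bar>f (x + h) - f x\<bar> powr p" h] by (simp add: I_def)
    finally show ?thesis by (simp add: powr_diff)
  qed
  have iter: "I h \<le> (2 ^ n) powr p * I (h /\<^sub>R 2 ^ n)" for n
  proof (induction n)
    case (Suc n)
    have "I (h /\<^sub>R 2 ^ n) \<le> 2 powr p * I (h /\<^sub>R 2 ^ Suc n)"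
      using double[of "h /\<^sub>R 2 ^ Suc n"] by simp
    then have "(2 ^ n) powr p * I (h /\<^sub>R 2 ^ n) \<le> (2 ^ n) powr p * (2 powr p * I (h /\<^sub>R 2 ^ Suc n))"
      by (intro mult_left_mono) auto
    also have "\<dots> = (2 ^ Suc n) powr p * I (h /\<^sub>R 2 ^ Suc n)"
      by (simp add: powr_mult)
    finally show ?case using Suc by linarith
  qed simp
  define D where "D = (\<lambda>n x. 2 ^ n * (f (x + h /\<^sub>R 2 ^ n) - f x))"
  have c: "filterlim (\<lambda>n. 2 ^ n :: real) at_top sequentially"
    by (rule filterlim_at_infinity_imp_filterlim_at_top[OF filterlim_realpow_sequentially_gt1]) auto
  have c1: "1 \<le> (2::real) ^ n" for n by simp
  obtain M' r' where Mr': "\<And>n x. \<bar>D n x\<bar> \<le> M'" "\<And>n x. norm x > r' \<Longrightarrow> D n x = 0"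
    using difference_quotient(2)[OF f, of "\<lambda>n. 2 ^ n", OF c1 c, of h] unfolding D_def by metis
  have lim: "(\<lambda>n. \<integral>x. \<bar>D n x\<bar> powr p \<partial>lborel) \<longlonglongrightarrow> (\<integral>x. \<bar>grad f x \<bullet> h\<bar> powr p \<partial>lborel)"
  proof (rule integral_dominated_convergence[where w="\<lambda>x. indicator (cball 0 r') x *\<^sub>R (M' powr p)"])
    show "integrable lborel (\<lambda>x::'a. indicator (cball 0 r') x *\<^sub>R (M' powr p) :: real)"
      by (rule borel_integrable_compact) auto
    have "(\<lambda>n. D n x) \<longlonglongrightarrow> grad f x \<bullet> h" for x
      unfolding D_def using difference_quotient(1)[OF f, of "\<lambda>n. 2 ^ n", OF c1 c, of _ h] by auto
    then show "AE x in lborel. (\<lambda>n. \<bar>D n x\<bar> powr p) \<longlonglongrightarrow> \<bar>grad f x \<bullet> h\<bar> powr p"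
      using p by (intro AE_I2 tendsto_powr2 tendsto_rabs tendsto_const) auto
    show "AE x in lborel. norm (\<bar>D n x\<bar> powr p) \<le> indicator (cball 0 r') x *\<^sub>R (M' powr p)" for n
      using Mr' p by (auto simp: indicator_def intro!: powr_mono2)
  qed (auto simp: D_def)
  have "I h \<le> (\<integral>x. \<bar>D n x\<bar> powr p \<partial>lborel)" for n
    using iter[of n] by (simp add: D_def I_def abs_mult powr_mult)
  then have "I h \<le> (\<integral>x. \<bar>grad f x \<bullet> h\<bar> powr p \<partial>lborel)"
    by (intro LIMSEQ_le_const[OF lim]) auto
  also have "\<dots> \<le> (\<integral>x. norm h powr p * norm (grad f x) powr p \<partial>lborel)"
  proof (rule integral_mono)
    have b: "norm (norm (grad f x) powr p) \<le> M powr p" for x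
      using Mr p by (auto intro!: powr_mono2)
    then show "integrable lborel (\<lambda>x. norm h powr p * norm (grad f x) powr p)"
      using Mr by (intro integrable_mult_right integrable_bounded_support[of _ "M powr p" r]) auto
    have le: "\<bar>grad f x \<bullet> h\<bar> powr p \<le> norm h powr p * norm (grad f x) powr p" for x
      using p Cauchy_Schwarz_ineq2[of "grad f x" h] powr_mono2[of p "\<bar>grad f x \<bullet> h\<bar>" "norm (grad f x) * norm h"]
      by (simp add: powr_mult mult.commute)
    then show "\<bar>grad f x \<bullet> h\<bar> powr p \<le> norm h powr p * norm (grad f x) powr p" for x .
    show "integrable lborel (\<lambda>x. \<bar>grad f x \<bullet> h\<bar> powr p)"
    proof (rule integrable_bounded_support[of _ "norm h powr p * M powr p" r])
      show "norm (\<bar>grad f x \<bullet> h\<bar> powr p) \<le> norm h powr p * M powr p" for x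
        using order_trans[OF le[of x] mult_left_mono[OF b[of x, simplified]]] by simp
    qed (use Mr in auto)
  qed
  finally show ?thesis by (simp add: I_def)
qed

section \<open>Approximation and chain rule in Sobolev spaces\<close>

lemma borel_measurable_lebesgue_on: "g \<in> borel_measurable borel \<Longrightarrow> g \<in> borel_measurable (lebesgue_on \<Omega>)"
  by (intro measurable_restrict_space1 measurable_completion) simp

lemma smooth_measurable: "smooth f \<Longrightarrow> f \<in> borel_measurable (lebesgue_on \<Omega>)"
  "smooth f \<Longrightarrow> grad f \<in> borel_measurable (lebesgue_on \<Omega>)"
  by (auto intro: borel_measurable_lebesgue_on smooth_borel smooth_grad_borel)

lemma lebesgue_on_eq_lborel:
  fixes g :: "'a::euclidean_space \<Rightarrow> 'b::euclidean_space"
  assumes "g \<in> borel_measurable borel" "\<And>x. x \<notin> \<Omega> \<Longrightarrow> g x = 0" "\<Omega> \<in> sets lebesgue"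
  shows "integral\<^sup>L (lebesgue_on \<Omega>) g = integral\<^sup>L lborel g"
    and "integrable (lebesgue_on \<Omega>) g \<longleftrightarrow> integrable lborel g"
proof -
  have "(\<lambda>x. indicator \<Omega> x *\<^sub>R g x) = g" using assms(2) by (auto simp: indicator_def)
  then show "integral\<^sup>L (lebesgue_on \<Omega>) g = integral\<^sup>L lborel g"
    "integrable (lebesgue_on \<Omega>) g \<longleftrightarrow> integrable lborel g"
    using assms by (simp_all add: integral_restrict_space integrable_restrict_space
        integral_completion integrable_completion)
qed

lemma lebesgue_on_subset:
  assumes "\<Omega>' \<subseteq> \<Omega>" "\<Omega> \<in> sets lebesgue" "\<Omega>' \<in> sets lebesgue"
  shows "lebesgue_on \<Omega>' = restrict_space (lebesgue_on \<Omega>) \<Omega>'"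
  using assms by (subst restrict_restrict_space) (auto simp: Int_absorb1)

lemma measurable_lebesgue_on_subset:
  assumes "\<Omega>' \<subseteq> \<Omega>" "\<Omega> \<in> sets lebesgue" "\<Omega>' \<in> sets lebesgue" "f \<in> borel_measurable (lebesgue_on \<Omega>)"
  shows "f \<in> borel_measurable (lebesgue_on \<Omega>')"
  using assms by (simp add: lebesgue_on_subset[OF assms(1-3)] measurable_restrict_space1)

lemma sets_lebesgue_on_subset:
  assumes "\<Omega>' \<subseteq> \<Omega>" "\<Omega> \<in> sets lebesgue" "\<Omega>' \<in> sets lebesgue"
  shows "\<Omega>' \<inter> space (lebesgue_on \<Omega>) \<in> sets (lebesgue_on \<Omega>)"
  using assms by (auto simp: sets_restrict_space_iff Int_absorb2)

lemma integrable_lebesgue_on_subset: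
  fixes f :: "'a::euclidean_space \<Rightarrow> 'b::euclidean_space"
  assumes "\<Omega>' \<subseteq> \<Omega>" "\<Omega> \<in> sets lebesgue" "\<Omega>' \<in> sets lebesgue" "integrable (lebesgue_on \<Omega>) f"
  shows "integrable (lebesgue_on \<Omega>') f"
  unfolding lebesgue_on_subset[OF assms(1-3)] integrable_restrict_space[OF sets_lebesgue_on_subset[OF assms(1-3)]]
  using sets_lebesgue_on_subset[OF assms(1-3)] assms by (intro integrable_mult_indicator) (auto simp: Int_absorb2)

lemma integral_lebesgue_on_subset:
  fixes f :: "'a::euclidean_space \<Rightarrow> real"
  assumes "\<Omega>' \<subseteq> \<Omega>" "\<Omega> \<in> sets lebesgue" "\<Omega>' \<in> sets lebesgue" "integrable (lebesgue_on \<Omega>) f" "\<And>x. 0 \<le> f x"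
  shows "integral\<^sup>L (lebesgue_on \<Omega>') f \<le> integral\<^sup>L (lebesgue_on \<Omega>) f"
  unfolding lebesgue_on_subset[OF assms(1-3)] integral_restrict_space[OF sets_lebesgue_on_subset[OF assms(1-3)]]
proof (rule integral_mono)
  show "integrable (lebesgue_on \<Omega>) (\<lambda>x. indicat_real \<Omega>' x *\<^sub>R f x)"
    using sets_lebesgue_on_subset[OF assms(1-3)] assms by (intro integrable_mult_indicator) (auto simp: Int_absorb2)
qed (use assms in \<open>auto simp: indicator_def\<close>)

lemma LpI:
  assumes "f \<in> borel_measurable (lebesgue_on \<Omega>)" "integrable (lebesgue_on \<Omega>) W"
    "\<And>x. norm (f x) powr p \<le> W x"
  shows "f \<in> Lp p \<Omega>"
proof -
  have [measurable]: "f \<in> borel_measurable (lebesgue_on \<Omega>)" by fact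
  have "integrable (lebesgue_on \<Omega>) (\<lambda>x. norm (f x) powr p)"
    by (rule Bochner_Integration.integrable_bound[OF assms(2)])
       (use assms(3) order_trans[OF _ abs_ge_self] in auto)
  then show ?thesis using assms(1) by (simp add: Lp_def)
qed

lemma LpD:
  assumes "f \<in> Lp p \<Omega>"
  shows "f \<in> borel_measurable (lebesgue_on \<Omega>)" "integrable (lebesgue_on \<Omega>) (\<lambda>x. norm (f x) powr p)"
  using assms by (auto simp: Lp_def)

lemma Lp_add:
  assumes "f \<in> Lp p \<Omega>" "g \<in> Lp p \<Omega>" "p > 0"
  shows "(\<lambda>x. f x + g x) \<in> Lp p \<Omega>"
  by (rule LpI[where W="\<lambda>x. 2 powr p * (norm (f x) powr p + norm (g x) powr p)"])
     (use assms powr_add_le LpD[OF assms(1)] LpD[OF assms(2)] in \<open>auto intro!: borel_measurable_add\<close>)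

lemma Lp_diff:
  assumes "f \<in> Lp p \<Omega>" "g \<in> Lp p \<Omega>" "p > 0"
  shows "(\<lambda>x. f x - g x) \<in> Lp p \<Omega>"
proof -
  have "(\<lambda>x. - g x) \<in> Lp p \<Omega>" using assms(2) by (auto simp: Lp_def)
  from Lp_add[OF assms(1) this assms(3)] show ?thesis by simp
qed

lemma test_functions_Lp:
  fixes f :: "'a::euclidean_space \<Rightarrow> real"
  assumes f: "f \<in> test_functions \<Omega>" and \<Omega>: "\<Omega> \<in> sets lebesgue" and p: "p > 0"
  shows "f \<in> Lp p \<Omega>" "grad f \<in> Lp p \<Omega>"
proof -
  have sm: "smooth f" using f by (simp add: test_functions_def)
  note [measurable] = smooth_borel[OF sm] smooth_grad_borel[OF sm]
  obtain M r where M: "M > 0" "\<And>x. \<bar>f x\<bar> \<le> M" "\<And>x. norm (grad f x) \<le> M" 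
    "\<And>x. norm x > r \<Longrightarrow> f x = 0 \<and> grad f x = 0"
    using test_functions_bounds[OF test_functions_subset[OF f]] by metis
  note out = test_functions_outside[OF f]
  have "integrable lborel (\<lambda>x. norm (f x) powr p)"
    by (rule integrable_bounded_support[of _ "M powr p" r]) (use M p in \<open>auto intro!: powr_mono2\<close>)
  then have "integrable (lebesgue_on \<Omega>) (\<lambda>x. norm (f x) powr p)"
    by (subst lebesgue_on_eq_lborel) (use out \<Omega> in auto)
  then show "f \<in> Lp p \<Omega>" using smooth_measurable[OF sm] by (simp add: Lp_def)
  have "integrable lborel (\<lambda>x. norm (grad f x) powr p)"
    by (rule integrable_bounded_support[of _ "M powr p" r]) (use M p in \<open>auto intro!: powr_mono2\<close>)
  then have "integrable (lebesgue_on \<Omega>) (\<lambda>x. norm (grad f x) powr p)"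
    by (subst lebesgue_on_eq_lborel) (use out \<Omega> in auto)
  then show "grad f \<in> Lp p \<Omega>" using smooth_measurable[OF sm] by (simp add: Lp_def)
qed

lemma powr_tendsto_0D:
  fixes f :: "nat \<Rightarrow> 'b::real_normed_vector"
  assumes "(\<lambda>n. norm (f n) powr p) \<longlonglongrightarrow> 0" "p > 0"
  shows "f \<longlonglongrightarrow> 0"
proof -
  have "(\<lambda>n. (norm (f n) powr p) powr (1 / p)) \<longlonglongrightarrow> 0 powr (1 / p)"
    using assms by (intro tendsto_powr2 tendsto_const) auto
  then show ?thesis using assms(2) by (simp add: powr_powr tendsto_norm_zero_iff)
qed

lemma Lp_norm_powr: "p > 0 \<Longrightarrow> Lp_norm p \<Omega> f powr p = (LINT x|lebesgue_on \<Omega>. norm (f x) powr p)"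
  by (simp add: Lp_norm_def powr_powr)

lemma Lp_norm_nonneg: "0 \<le> Lp_norm p \<Omega> f"
  by (simp add: Lp_norm_def)

text \<open>Passing to a subsequence gives almost everywhere convergence in addition, which is what nonlinear
  functions of $u$ and Fatou's lemma need.\<close>

lemma sobolev0_approx:
  fixes u :: "'a::euclidean_space \<Rightarrow> real"
  assumes s: "sobolev0 p \<Omega> u Du" and p: "p > 0" and \<Omega>: "\<Omega> \<in> sets lebesgue"
  obtains \<phi> :: "nat \<Rightarrow> 'a \<Rightarrow> real" where "\<And>n. \<phi> n \<in> test_functions \<Omega>"
    "(\<lambda>n. LINT x|lebesgue_on \<Omega>. norm (u x - \<phi> n x) powr p) \<longlonglongrightarrow> 0"
    "(\<lambda>n. LINT x|lebesgue_on \<Omega>. norm (Du x - grad (\<phi> n) x) powr p) \<longlonglongrightarrow> 0"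
    "AE x in lebesgue_on \<Omega>. (\<lambda>n. \<phi> n x) \<longlonglongrightarrow> u x"
proof -
  let ?M = "lebesgue_on \<Omega>"
  have uL: "u \<in> Lp p \<Omega>" "Du \<in> Lp p \<Omega>" using s by (auto simp: sobolev0_def sobolev_def)
  have "\<exists>\<phi>\<in>test_functions \<Omega>. Lp_norm p \<Omega> (\<lambda>x. u x - \<phi> x) + Lp_norm p \<Omega> (\<lambda>x. Du x - grad \<phi> x) < inverse (real (Suc n))" for n
  proof -
    have "0 < inverse (real (Suc n))" by simp
    then show ?thesis using s unfolding sobolev0_def by blast
  qed
  then obtain \<phi> where \<phi>: "\<And>n. \<phi> n \<in> test_functions \<Omega>" and
    b: "\<And>n. Lp_norm p \<Omega> (\<lambda>x. u x - \<phi> n x) + Lp_norm p \<Omega> (\<lambda>x. Du x - grad (\<phi> n) x) < inverse (real (Suc n))"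
    by metis
  have L: "(\<lambda>x. u x - \<phi> n x) \<in> Lp p \<Omega>" "(\<lambda>x. Du x - grad (\<phi> n) x) \<in> Lp p \<Omega>" for n
    using Lp_diff[OF uL(1) test_functions_Lp(1)[OF \<phi> \<Omega> p] p] Lp_diff[OF uL(2) test_functions_Lp(2)[OF \<phi> \<Omega> p] p] by auto
  have b': "Lp_norm p \<Omega> (\<lambda>x. u x - \<phi> n x) \<le> inverse (real (Suc n))"
    "Lp_norm p \<Omega> (\<lambda>x. Du x - grad (\<phi> n) x) \<le> inverse (real (Suc n))" for n
    using b[of n] Lp_norm_nonneg[of p \<Omega> "\<lambda>x. u x - \<phi> n x"] Lp_norm_nonneg[of p \<Omega> "\<lambda>x. Du x - grad (\<phi> n) x"]
    by linarith+
  have null: "(\<lambda>n. LINT x|?M. norm (F n x) powr p) \<longlonglongrightarrow> 0"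
    if "\<And>n. Lp_norm p \<Omega> (F n) \<le> inverse (real (Suc n))" for F :: "nat \<Rightarrow> 'a \<Rightarrow> 'b::euclidean_space"
  proof -
    have "(\<lambda>n. Lp_norm p \<Omega> (F n)) \<longlonglongrightarrow> 0"
      by (rule tendsto_sandwich[OF _ _ tendsto_const LIMSEQ_inverse_real_of_nat])
         (intro always_eventually allI Lp_norm_nonneg that)+
    then have "(\<lambda>n. Lp_norm p \<Omega> (F n) powr p) \<longlonglongrightarrow> 0 powr p"
      using p by (intro tendsto_powr2 tendsto_const always_eventually allI Lp_norm_nonneg) auto
    then show ?thesis using p by (simp add: Lp_norm_powr)
  qed
  note l1 = null[OF b'(1)] and l2 = null[OF b'(2)]
  have "\<exists>r::nat\<Rightarrow>nat. strict_mono r \<and> (AE x in ?M. (\<lambda>n. norm (u x - \<phi> (r n) x) powr p) \<longlonglongrightarrow> 0)"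
    by (rule tendsto_L1_AE_subseq) (use l1 LpD(2)[OF L(1)] in auto)
  then obtain r where r: "strict_mono r"
    and ae: "AE x in ?M. (\<lambda>n. norm (u x - \<phi> (r n) x) powr p) \<longlonglongrightarrow> 0" by blast
  show ?thesis
  proof (rule that[of "\<lambda>n. \<phi> (r n)"])
    show "AE x in ?M. (\<lambda>n. \<phi> (r n) x) \<longlonglongrightarrow> u x"
      using ae
    proof eventually_elim
      case (elim x)
      from powr_tendsto_0D[OF elim p] have "(\<lambda>n. u x - (u x - \<phi> (r n) x)) \<longlonglongrightarrow> u x - 0"
        by (intro tendsto_diff tendsto_const)
      then show ?case by simp
    qed
  qed (use \<phi> LIMSEQ_subseq_LIMSEQ[OF l1 r] LIMSEQ_subseq_LIMSEQ[OF l2 r] in \<open>auto simp: o_def\<close>)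
qed

text \<open>Replaces Hoelder's inequality: $t \le e$ or $t \le e^{1-p}\, t^p$.\<close>

lemma Lp_times_bounded:
  fixes a :: "'a::euclidean_space \<Rightarrow> 'b::euclidean_space"
  assumes a: "a \<in> Lp p \<Omega>" and b: "integrable (lebesgue_on \<Omega>) b" "\<And>x. 0 \<le> b x" "\<And>x. b x \<le> B"
    and p: "p > 1"
  shows "integrable (lebesgue_on \<Omega>) (\<lambda>x. norm (a x) * b x)"
    and "e > 0 \<Longrightarrow> (LINT x|lebesgue_on \<Omega>. norm (a x) * b x) \<le>
      e * (LINT x|lebesgue_on \<Omega>. b x) + B * e powr (1 - p) * (LINT x|lebesgue_on \<Omega>. norm (a x) powr p)"
proof -
  let ?M = "lebesgue_on \<Omega>"
  note [measurable] = LpD(1)[OF a] borel_measurable_integrable[OF b(1)]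
  have bound: "norm (a x) * b x \<le> e * b x + B * e powr (1 - p) * norm (a x) powr p" if e: "e > 0" for e x
  proof (cases "norm (a x) \<le> e")
    case True
    have "0 \<le> B * e powr (1 - p) * norm (a x) powr p"
      using b(2,3)[of x] by simp
    moreover have "norm (a x) * b x \<le> e * b x" using True b(2) by (intro mult_right_mono)
    ultimately show ?thesis by linarith
  next
    case False
    then have pos: "norm (a x) > 0" using e by linarith
    have "norm (a x) = norm (a x) powr (1 - p) * norm (a x) powr p"
      using pos by (simp flip: powr_add)
    also have "\<dots> \<le> e powr (1 - p) * norm (a x) powr p"
      using False e p by (intro mult_right_mono powr_mono2') auto
    finally have "norm (a x) * b x \<le> (e powr (1 - p) * norm (a x) powr p) * B"
      using b(2,3) by (intro mult_mono) auto
    moreover have "0 \<le> e * b x" using e b(2) by simp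
    ultimately show ?thesis by (simp add: mult_ac)
  qed
  have int: "integrable (?M) (\<lambda>x. e * b x + B * e powr (1 - p) * norm (a x) powr p)" for e
    using b(1) LpD(2)[OF a] by simp
  show i: "integrable (?M) (\<lambda>x. norm (a x) * b x)"
    by (rule Bochner_Integration.integrable_bound[OF int[of 1]])
       (use bound[of 1] b(2) in \<open>auto simp: abs_mult intro!: AE_I2 order_trans[OF _ abs_ge_self]\<close>)
  show "(LINT x|?M. norm (a x) * b x) \<le>
      e * (LINT x|?M. b x) + B * e powr (1 - p) * (LINT x|?M. norm (a x) powr p)" if "e > 0"
    using integral_mono[OF i int bound[OF that]] b(1) LpD(2)[OF a] by simp
qed

lemma Lp_times_bounded_tendsto_0:
  fixes a :: "nat \<Rightarrow> 'a::euclidean_space \<Rightarrow> 'b::euclidean_space"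
  assumes a: "\<And>n. a n \<in> Lp p \<Omega>" and b: "integrable (lebesgue_on \<Omega>) b" "\<And>x. 0 \<le> b x" "\<And>x. b x \<le> B"
    and p: "p > 1" and lim: "(\<lambda>n. LINT x|lebesgue_on \<Omega>. norm (a n x) powr p) \<longlonglongrightarrow> 0"
  shows "(\<lambda>n. LINT x|lebesgue_on \<Omega>. norm (a n x) * b x) \<longlonglongrightarrow> 0"
proof (rule LIMSEQ_I)
  let ?M = "lebesgue_on \<Omega>"
  fix r :: real assume r: "r > 0"
  define b0 where "b0 = (LINT x|?M. b x)"
  have b0: "b0 \<ge> 0" unfolding b0_def using b(2) by (intro integral_nonneg_AE) auto
  define e where "e = r / (2 * (b0 + 1))"
  have e: "e > 0" "e * b0 < r / 2 + 0"
    using r b0 by (auto simp: e_def field_simps)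
  have "(\<lambda>n. e * b0 + B * e powr (1 - p) * (LINT x|?M. norm (a n x) powr p)) \<longlonglongrightarrow> e * b0 + B * e powr (1 - p) * 0"
    by (intro tendsto_intros lim)
  from order_tendstoD(2)[OF this, of r]
  have "eventually (\<lambda>n. e * b0 + B * e powr (1 - p) * (LINT x|?M. norm (a n x) powr p) < r) sequentially"
    using e r by simp
  then obtain N where N: "\<And>n. n \<ge> N \<Longrightarrow> e * b0 + B * e powr (1 - p) * (LINT x|?M. norm (a n x) powr p) < r"
    by (auto simp: eventually_sequentially)
  show "\<exists>N. \<forall>n\<ge>N. norm ((LINT x|?M. norm (a n x) * b x) - 0) < r"
  proof (intro exI allI impI)
    fix n assume "n \<ge> N"
    have "0 \<le> (LINT x|?M. norm (a n x) * b x)"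
      using b(2) by (intro integral_nonneg_AE) auto
    then show "norm ((LINT x|?M. norm (a n x) * b x) - 0) < r"
      using Lp_times_bounded(2)[OF a b p e(1), of n] N[OF \<open>n \<ge> N\<close>] by (simp add: b0_def)
  qed
qed

lemma Lp_absolutely_integrable_on:
  fixes a :: "'a::euclidean_space \<Rightarrow> 'b::euclidean_space"
  assumes a: "a \<in> Lp p \<Omega>" and K: "compact K" "K \<subseteq> \<Omega>" and p: "p > 1" and \<Omega>: "\<Omega> \<in> sets lebesgue"
  shows "a absolutely_integrable_on K"
proof -
  have Ks: "K \<in> sets borel" using K by (simp add: borel_compact)
  have [measurable]: "a \<in> borel_measurable (lebesgue_on \<Omega>)" using LpD[OF a] by auto
  have KM: "K \<in> sets (lebesgue_on \<Omega>)" using Ks K \<Omega> by (auto simp: sets_restrict_space_iff)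
  have "integrable lborel (\<lambda>x. indicat_real K x *\<^sub>R (1::real))"
    by (rule borel_integrable_compact[OF K(1)]) auto
  then have "integrable lborel (indicat_real K)" by simp
  then have "integrable (lebesgue_on \<Omega>) (indicat_real K)"
    using Ks K \<Omega> by (subst lebesgue_on_eq_lborel) (auto simp: indicator_eq_0_iff)
  from Lp_times_bounded(1)[OF a this _ _ p, of 1]
  have i: "integrable (lebesgue_on \<Omega>) (\<lambda>x. norm (a x) * indicat_real K x)" by simp
  have "integrable (lebesgue_on \<Omega>) (\<lambda>x. indicat_real K x *\<^sub>R a x)"
    by (rule Bochner_Integration.integrable_bound[OF i]) (use KM in auto)
  then have "integrable lebesgue (\<lambda>x. indicat_real \<Omega> x *\<^sub>R indicat_real K x *\<^sub>R a x)"
    using \<Omega> by (subst (asm) integrable_restrict_space) auto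
  moreover have "(\<lambda>x. indicat_real \<Omega> x *\<^sub>R indicat_real K x *\<^sub>R a x) = (\<lambda>x. indicat_real K x *\<^sub>R a x)"
    using K by (auto simp: indicator_def fun_eq_iff)
  ultimately show ?thesis by (simp add: set_integrable_def)
qed

lemma test_functions_mult:
  assumes "f \<in> test_functions \<Omega>" "g \<in> test_functions \<Omega>"
  shows "(\<lambda>x. f x * g x) \<in> test_functions \<Omega>"
proof -
  have sub: "closure {x. f x * g x \<noteq> 0} \<subseteq> closure {x. f x \<noteq> 0}"
    by (rule closure_mono) auto
  have "compact (closure {x. f x * g x \<noteq> 0})"
    using compact_Int_closed[of "closure {x. f x \<noteq> 0}" "closure {x. f x * g x \<noteq> 0}"] sub assms
    by (simp add: Int_absorb1 test_functions_def)
  then show ?thesis using assms sub by (auto simp: test_functions_def intro: smooth_mult)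
qed

text \<open>The integration by parts formula holds for test functions, and both sides pass to the limit; so the
  limit of the gradients is automatically the weak gradient of the limit.\<close>

lemma sobolev0I:
  fixes u :: "'a::euclidean_space \<Rightarrow> real"
  assumes uL: "u \<in> Lp p \<Omega>" "Du \<in> Lp p \<Omega>" and p: "p > 1" and \<Omega>: "\<Omega> \<in> sets lebesgue"
    and \<phi>: "\<And>n. \<phi> n \<in> test_functions \<Omega>"
    and l1: "(\<lambda>n. LINT x|lebesgue_on \<Omega>. norm (u x - \<phi> n x) powr p) \<longlonglongrightarrow> 0"
    and l2: "(\<lambda>n. LINT x|lebesgue_on \<Omega>. norm (Du x - grad (\<phi> n) x) powr p) \<longlonglongrightarrow> 0"
  shows "sobolev0 p \<Omega> u Du"
proof -
  let ?M = "lebesgue_on \<Omega>"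
  have p0: "p > 0" using p by simp
  have L: "(\<lambda>x. u x - \<phi> n x) \<in> Lp p \<Omega>" "(\<lambda>x. Du x - grad (\<phi> n) x) \<in> Lp p \<Omega>" for n
    using Lp_diff[OF uL(1) test_functions_Lp(1)[OF \<phi> \<Omega> p0] p0] Lp_diff[OF uL(2) test_functions_Lp(2)[OF \<phi> \<Omega> p0] p0] by auto
  have "has_weak_gradient \<Omega> u Du"
    unfolding has_weak_gradient_def
  proof (intro conjI ballI allI impI)
    fix \<zeta> assume \<zeta>: "\<zeta> \<in> test_functions \<Omega>"
    have sm: "smooth \<zeta>" using \<zeta> by (simp add: test_functions_def)
    obtain M r where M: "M > 0" "\<And>x. \<bar>\<zeta> x\<bar> \<le> M" "\<And>x. norm (grad \<zeta> x) \<le> M"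
      "\<And>x. norm x > r \<Longrightarrow> \<zeta> x = 0 \<and> grad \<zeta> x = 0"
      using test_functions_bounds[OF test_functions_subset[OF \<zeta>]] by metis
    note out = test_functions_outside[OF \<zeta>]
    let ?U = "LINT x|?M. u x *\<^sub>R grad \<zeta> x"
    let ?V = "LINT x|?M. \<zeta> x *\<^sub>R Du x"
    let ?Un = "\<lambda>n. LINT x|?M. \<phi> n x *\<^sub>R grad \<zeta> x"
    let ?Vn = "\<lambda>n. LINT x|?M. \<zeta> x *\<^sub>R grad (\<phi> n) x"
    note [measurable] = smooth_borel[OF sm] smooth_grad_borel[OF sm] smooth_measurable[OF sm] LpD(1)[OF uL(1)] LpD(1)[OF uL(2)]
    have "integrable lborel (\<lambda>x. norm (grad \<zeta> x))"
      by (rule integrable_bounded_support[of _ M r]) (use M in auto)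
    then have b1: "integrable (?M) (\<lambda>x. norm (grad \<zeta> x))"
      by (subst lebesgue_on_eq_lborel) (use out \<Omega> in auto)
    have "integrable lborel (\<lambda>x. \<bar>\<zeta> x\<bar>)"
      by (rule integrable_bounded_support[of _ M r]) (use M in auto)
    then have b2: "integrable (?M) (\<lambda>x. \<bar>\<zeta> x\<bar>)"
      by (subst lebesgue_on_eq_lborel) (use out \<Omega> in auto)
    have c1: "(\<lambda>n. LINT x|?M. norm (u x - \<phi> n x) * norm (grad \<zeta> x)) \<longlonglongrightarrow> 0"
      by (rule Lp_times_bounded_tendsto_0[OF L(1) b1 _ _ p l1]) (use M in auto)
    have c2: "(\<lambda>n. LINT x|?M. norm (Du x - grad (\<phi> n) x) * \<bar>\<zeta> x\<bar>) \<longlonglongrightarrow> 0"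
      by (rule Lp_times_bounded_tendsto_0[OF L(2) b2 _ _ p l2]) (use M in auto)
    have ui: "integrable (?M) (\<lambda>x. w x *\<^sub>R grad \<zeta> x)" if "w \<in> Lp p \<Omega>" for w :: "'a \<Rightarrow> real"
    proof (rule Bochner_Integration.integrable_bound)
      show "integrable (?M) (\<lambda>x. norm (w x) * norm (grad \<zeta> x))"
        by (rule Lp_times_bounded(1)[OF that b1 _ _ p]) (use M in auto)
    qed (use LpD(1)[OF that] in auto)
    have Dui: "integrable (?M) (\<lambda>x. \<zeta> x *\<^sub>R w x)" if "w \<in> Lp p \<Omega>" for w :: "'a \<Rightarrow> 'a"
    proof (rule Bochner_Integration.integrable_bound)
      show "integrable (?M) (\<lambda>x. norm (w x) * \<bar>\<zeta> x\<bar>)"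
        by (rule Lp_times_bounded(1)[OF that b2 _ _ p]) (use M in auto)
    qed (use LpD(1)[OF that] in \<open>auto simp: mult.commute\<close>)
    have e1: "(\<lambda>n. ?U - ?Un n) \<longlonglongrightarrow> 0"
    proof (rule Lim_null_comparison[OF _ c1], intro always_eventually allI)
      fix n
      have "?U - ?Un n
        = (LINT x|?M. (u x - \<phi> n x) *\<^sub>R grad \<zeta> x)"
        using ui[OF uL(1)] ui[OF test_functions_Lp(1)[OF \<phi> \<Omega> p0]] by (simp add: scaleR_left_diff_distrib)
      then show "norm (?U - ?Un n)
          \<le> (LINT x|?M. norm (u x - \<phi> n x) * norm (grad \<zeta> x))"
        using integral_norm_bound[of "?M" "\<lambda>x. (u x - \<phi> n x) *\<^sub>R grad \<zeta> x"] by simp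
    qed
    have e2: "(\<lambda>n. ?V - ?Vn n) \<longlonglongrightarrow> 0"
    proof (rule Lim_null_comparison[OF _ c2], intro always_eventually allI)
      fix n
      have "?V - ?Vn n
        = (LINT x|?M. \<zeta> x *\<^sub>R (Du x - grad (\<phi> n) x))"
        using Dui[OF uL(2)] Dui[OF test_functions_Lp(2)[OF \<phi> \<Omega> p0]] by (simp add: scaleR_right_diff_distrib)
      then show "norm (?V - ?Vn n)
          \<le> (LINT x|?M. norm (Du x - grad (\<phi> n) x) * \<bar>\<zeta> x\<bar>)"
        using integral_norm_bound[of "?M" "\<lambda>x. \<zeta> x *\<^sub>R (Du x - grad (\<phi> n) x)"] by (simp add: mult.commute)
    qed
    have parts: "?Un n + ?Vn n = 0" for n
    proof -
      have smn: "smooth (\<phi> n)" using \<phi> by (simp add: test_functions_def)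
      note [measurable] = smooth_borel[OF smn] smooth_grad_borel[OF smn]
      have pr: "(\<lambda>x. \<phi> n x * \<zeta> x) \<in> test_functions UNIV"
        using test_functions_mult[OF \<phi> \<zeta>] test_functions_subset by blast
      have "?Un n + ?Vn n
        = (LINT x|?M. \<phi> n x *\<^sub>R grad \<zeta> x + \<zeta> x *\<^sub>R grad (\<phi> n) x)"
        using ui[OF test_functions_Lp(1)[OF \<phi> \<Omega> p0]] Dui[OF test_functions_Lp(2)[OF \<phi> \<Omega> p0]] by simp
      also have "\<dots> = (\<integral>x. \<phi> n x *\<^sub>R grad \<zeta> x + \<zeta> x *\<^sub>R grad (\<phi> n) x \<partial>lborel)"
        by (rule lebesgue_on_eq_lborel) (use out \<Omega> in auto)
      also have "\<dots> = (\<integral>x. grad (\<lambda>x. \<phi> n x * \<zeta> x) x \<partial>lborel)"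
        by (simp add: grad_mult[OF smn sm])
      also have "\<dots> = 0" by (rule integral_grad_eq_0[OF pr])
      finally show ?thesis .
    qed
    have "(\<lambda>n. (?U - ?Un n)
       + (?V - ?Vn n)) \<longlonglongrightarrow> 0 + 0"
      by (rule tendsto_add[OF e1 e2])
    moreover have "(?U - ?Un n)
       + (?V - ?Vn n) 
       = ?U + ?V" for n
      using parts[of n] by (simp add: algebra_simps)
    ultimately have "?U + ?V = 0"
      by (simp add: LIMSEQ_const_iff)
    then show "?U = - ?V"
      by (simp add: eq_neg_iff_add_eq_0)
  qed (use Lp_absolutely_integrable_on[OF _ _ _ p \<Omega>] uL in auto)
  moreover have "\<exists>\<phi>\<in>test_functions \<Omega>. Lp_norm p \<Omega> (\<lambda>x. u x - \<phi> x) + Lp_norm p \<Omega> (\<lambda>x. Du x - grad \<phi> x) < e"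
    if "e > 0" for e
  proof -
    have "(\<lambda>n. Lp_norm p \<Omega> (\<lambda>x. u x - \<phi> n x) + Lp_norm p \<Omega> (\<lambda>x. Du x - grad (\<phi> n) x)) \<longlonglongrightarrow> 0 powr (1/p) + 0 powr (1/p)"
      unfolding Lp_norm_def using p0
      by (intro tendsto_add tendsto_powr2 tendsto_const l1 l2) auto
    then have "eventually (\<lambda>n. Lp_norm p \<Omega> (\<lambda>x. u x - \<phi> n x) + Lp_norm p \<Omega> (\<lambda>x. Du x - grad (\<phi> n) x) < e) sequentially"
      using that by (auto dest: order_tendstoD)
    then show ?thesis using \<phi> by (auto simp: eventually_sequentially)
  qed
  ultimately show ?thesis using uL by (simp add: sobolev0_def sobolev_def)
qed

lemma smooth_lipschitz:
  fixes G :: "real \<Rightarrow> real"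
  assumes "smooth G" "\<And>t. \<bar>deriv G t\<bar> \<le> A"
  shows "\<bar>G s - G t\<bar> \<le> A * \<bar>s - t\<bar>"
proof -
  have "norm (G s - G t) \<le> A * norm (s - t)"
    by (rule field_differentiable_bound[of UNIV G "deriv G"])
       (use assms smooth_has_deriv[OF assms(1)] in \<open>auto intro: has_field_derivative_at_within\<close>)
  then show ?thesis by simp
qed

text \<open>If $\varphi_n \to v$ then $\psi\, G(\varphi_n)$ are test functions with limit $\psi\, G(v)$. In the
  gradients the only term that is not controlled by $\varphi_n - v$ and its gradient is
  $(G'(\varphi_n) - G'(v))\, \nabla v$, which tends to zero by dominated convergence. The target domain
  may be smaller than $\Omega$, since it only has to contain the part of the support of $\psi$ in
  $\Omega$.\<close>

lemma sobolev0_cutoff_compose: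
  fixes v :: "'a::euclidean_space \<Rightarrow> real"
  assumes s: "sobolev0 p \<Omega> v Dv" and p: "p > 1" and \<Omega>: "open \<Omega>" "open \<Omega>'" "\<Omega>' \<subseteq> \<Omega>"
    and G: "smooth G" "G 0 = 0" "\<And>t. \<bar>deriv G t\<bar> \<le> A"
    and \<psi>: "smooth \<psi>" "\<And>x. \<bar>\<psi> x\<bar> \<le> A" "\<And>x. norm (grad \<psi> x) \<le> A" "closure {x. \<psi> x \<noteq> 0} \<inter> \<Omega> \<subseteq> \<Omega>'"
  shows "sobolev0 p \<Omega>' (\<lambda>x. \<psi> x * G (v x))
     (\<lambda>x. (\<psi> x * deriv G (v x)) *\<^sub>R Dv x + G (v x) *\<^sub>R grad \<psi> x)"
proof -
  let ?M = "lebesgue_on \<Omega>"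
  have p0: "p > 0" using p by simp
  have A0: "A \<ge> 0" using G(3)[of 0] by linarith
  have \<Omega>s: "\<Omega> \<in> sets lebesgue" "\<Omega>' \<in> sets lebesgue" using \<Omega> by auto
  have vL: "v \<in> Lp p \<Omega>" "Dv \<in> Lp p \<Omega>" using s by (auto simp: sobolev0_def sobolev_def)
  obtain \<phi> :: "nat \<Rightarrow> 'a \<Rightarrow> real" where \<phi>: "\<And>n. \<phi> n \<in> test_functions \<Omega>"
    and l1: "(\<lambda>n. LINT x|?M. norm (v x - \<phi> n x) powr p) \<longlonglongrightarrow> 0"
    and l2: "(\<lambda>n. LINT x|?M. norm (Dv x - grad (\<phi> n) x) powr p) \<longlonglongrightarrow> 0"
    and ae: "AE x in ?M. (\<lambda>n. \<phi> n x) \<longlonglongrightarrow> v x"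
    by (rule sobolev0_approx[OF s p0 \<Omega>s(1)]) (rule that)
  have sm: "smooth (\<phi> n)" for n using \<phi> by (simp add: test_functions_def)
  have L: "(\<lambda>x. v x - \<phi> n x) \<in> Lp p \<Omega>" "(\<lambda>x. Dv x - grad (\<phi> n) x) \<in> Lp p \<Omega>" for n
    using Lp_diff[OF vL(1) test_functions_Lp(1)[OF \<phi> \<Omega>s(1) p0] p0] Lp_diff[OF vL(2) test_functions_Lp(2)[OF \<phi> \<Omega>s(1) p0] p0] by auto
  note [measurable] = LpD(1)[OF vL(1)] LpD(1)[OF vL(2)] smooth_borel[OF G(1)] smooth_borel[OF smooth_deriv[OF G(1)]]
    smooth_measurable[OF \<psi>(1)] smooth_measurable[OF sm]
  define w where "w = (\<lambda>x. \<psi> x * G (v x))"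
  define Dw where "Dw = (\<lambda>x. (\<psi> x * deriv G (v x)) *\<^sub>R Dv x + G (v x) *\<^sub>R grad \<psi> x)"
  have Gle: "\<bar>G t\<bar> \<le> A * \<bar>t\<bar>" for t
    using smooth_lipschitz[OF G(1,3), of t 0] G(2) by simp
  have wb: "norm (w x) powr p \<le> (A * A) powr p * norm (v x) powr p" for x
  proof -
    have "\<bar>\<psi> x\<bar> * \<bar>G (v x)\<bar> \<le> A * (A * \<bar>v x\<bar>)" using \<psi>(2) Gle A0 by (intro mult_mono) auto
    then show ?thesis using p0 by (intro norm_powr_le) (auto simp: w_def abs_mult mult.assoc)
  qed
  have "w \<in> Lp p \<Omega>"
    by (rule LpI[OF _ _ wb]) (use LpD[OF vL(1)] in \<open>auto simp: w_def\<close>)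
  have Y: "(\<lambda>x. (\<psi> x * deriv G (v x)) *\<^sub>R Dv x) \<in> Lp p \<Omega>"
  proof (rule LpI)
    show "integrable (?M) (\<lambda>x. (A * A) powr p * norm (Dv x) powr p)" using LpD[OF vL(2)] by auto
    fix x
    have "\<bar>\<psi> x * deriv G (v x)\<bar> \<le> A * A" unfolding abs_mult using \<psi>(2) G(3) A0 by (intro mult_mono) auto
    then show "norm ((\<psi> x * deriv G (v x)) *\<^sub>R Dv x) powr p \<le> (A * A) powr p * norm (Dv x) powr p"
      using p0 by (intro norm_powr_le) (auto intro: mult_right_mono)
  qed auto
  have Z: "(\<lambda>x. G (v x) *\<^sub>R grad \<psi> x) \<in> Lp p \<Omega>"
  proof (rule LpI)
    show "integrable (?M) (\<lambda>x. (A * A) powr p * norm (v x) powr p)" using LpD[OF vL(1)] by auto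
    fix x
    have "\<bar>G (v x)\<bar> * norm (grad \<psi> x) \<le> (A * \<bar>v x\<bar>) * A" using \<psi>(3) Gle A0 by (intro mult_mono) auto
    then show "norm (G (v x) *\<^sub>R grad \<psi> x) powr p \<le> (A * A) powr p * norm (v x) powr p"
      using p0 by (intro norm_powr_le) (auto simp: mult_ac)
  qed auto
  have "Dw \<in> Lp p \<Omega>" unfolding Dw_def by (rule Lp_add[OF Y Z p0])
  have sub: "f \<in> Lp p \<Omega>'" if "f \<in> Lp p \<Omega>" for f :: "'a \<Rightarrow> 'b::euclidean_space"
    using that measurable_lebesgue_on_subset[OF \<Omega>(3) \<Omega>s] integrable_lebesgue_on_subset[OF \<Omega>(3) \<Omega>s]
    by (auto simp: Lp_def)
  define wn where "wn = (\<lambda>n x. \<psi> x * G (\<phi> n x))"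
  have test: "wn n \<in> test_functions \<Omega>'" for n
  proof -
    have c1: "closure {x. wn n x \<noteq> 0} \<subseteq> closure {x. \<phi> n x \<noteq> 0}"
      unfolding wn_def using G(2) by (intro closure_mono) auto
    have c2: "closure {x. wn n x \<noteq> 0} \<subseteq> closure {x. \<psi> x \<noteq> 0}"
      unfolding wn_def by (intro closure_mono) auto
    have "compact (closure {x. wn n x \<noteq> 0})"
      using compact_Int_closed[of "closure {x. \<phi> n x \<noteq> 0}" "closure {x. wn n x \<noteq> 0}"] c1 \<phi>[of n]
      by (simp add: Int_absorb1 test_functions_def)
    moreover have "closure {x. wn n x \<noteq> 0} \<subseteq> \<Omega>'"
      using c1 c2 \<psi>(4) \<phi>[of n] unfolding test_functions_def by blast
    moreover have "smooth (wn n)"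
      unfolding wn_def by (intro smooth_mult \<psi> smooth_compose[OF G(1)] sm)
    ultimately show ?thesis by (simp add: test_functions_def)
  qed
  have gwn: "grad (wn n) x = (\<psi> x * deriv G (\<phi> n x)) *\<^sub>R grad (\<phi> n) x + G (\<phi> n x) *\<^sub>R grad \<psi> x" for n x
    unfolding wn_def by (simp add: grad_mult[OF \<psi>(1) smooth_compose[OF G(1) sm]] grad_compose[OF G(1) sm])
  define E where "E = (\<lambda>n x. (\<bar>deriv G (v x) - deriv G (\<phi> n x)\<bar> * norm (Dv x)) powr p)"
  have Eb: "E n x \<le> (2 * A) powr p * norm (Dv x) powr p" for n x
  proof -
    have "\<bar>deriv G (v x) - deriv G (\<phi> n x)\<bar> * norm (Dv x) \<le> (2 * A) * norm (Dv x)"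
      using G(3)[of "v x"] G(3)[of "\<phi> n x"] by (intro mult_right_mono) auto
    then have "E n x \<le> ((2 * A) * norm (Dv x)) powr p"
      unfolding E_def using p0 by (intro powr_mono2) auto
    then show ?thesis by (simp add: powr_mult A0)
  qed
  have E0: "0 \<le> E n x" for n x by (simp add: E_def)
  have Dvi: "integrable (?M) (\<lambda>x. (2 * A) powr p * norm (Dv x) powr p)"
    using LpD[OF vL(2)] by auto
  have [measurable]: "E n \<in> borel_measurable (?M)" for n
    unfolding E_def by measurable
  have Ei: "integrable (?M) (E n)" for n
    by (rule Bochner_Integration.integrable_bound[OF Dvi])
       (use Eb E0 in \<open>auto intro!: AE_I2 order_trans[OF _ abs_ge_self]\<close>)
  have l3: "(\<lambda>n. integral\<^sup>L (?M) (E n)) \<longlonglongrightarrow> (LINT x|?M. 0)"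
  proof (rule integral_dominated_convergence[OF _ _ Dvi])
    show "AE x in ?M. (\<lambda>n. E n x) \<longlonglongrightarrow> 0"
      using ae
    proof eventually_elim
      case (elim x)
      have "isCont (deriv G) (v x)"
        using smooth_continuous_on[OF smooth_deriv[OF G(1)], of UNIV] by (simp add: continuous_on_eq_continuous_at)
      from isCont_tendsto_compose[OF this elim]
      have "(\<lambda>n. (\<bar>deriv G (v x) - deriv G (\<phi> n x)\<bar> * norm (Dv x)) powr p) \<longlonglongrightarrow> (\<bar>deriv G (v x) - deriv G (v x)\<bar> * norm (Dv x)) powr p"
        using p0 by (intro tendsto_powr2 tendsto_intros) auto
      then show ?case by (simp add: E_def)
    qed
  qed (use Eb E0 in auto)
  let ?e1 = "\<lambda>n. LINT x|?M. norm (v x - \<phi> n x) powr p"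
  let ?e2 = "\<lambda>n. LINT x|?M. norm (Dv x - grad (\<phi> n) x) powr p"
  let ?c = "(A * A) powr p"
  have "sobolev0 p \<Omega>' w Dw"
  proof (rule sobolev0I[OF sub[OF \<open>w \<in> Lp p \<Omega>\<close>] sub[OF \<open>Dw \<in> Lp p \<Omega>\<close>] p \<Omega>s(2) test])
    show "(\<lambda>n. LINT x|lebesgue_on \<Omega>'. norm (w x - wn n x) powr p) \<longlonglongrightarrow> 0"
    proof (rule Lim_null_comparison)
      show "(\<lambda>n. ?c * ?e1 n) \<longlonglongrightarrow> 0"
        using tendsto_mult[OF tendsto_const l1] by simp
      have "(LINT x|lebesgue_on \<Omega>'. norm (w x - wn n x) powr p) \<le> ?c * ?e1 n" for n
      proof -
        have "norm (w x - wn n x) powr p \<le> ?c * norm (v x - \<phi> n x) powr p" for x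
        proof -
          have "\<bar>\<psi> x\<bar> * \<bar>G (v x) - G (\<phi> n x)\<bar> \<le> A * (A * \<bar>v x - \<phi> n x\<bar>)"
            using \<psi>(2) smooth_lipschitz[OF G(1,3)] A0 by (intro mult_mono) auto
          then show ?thesis using p0
            by (intro norm_powr_le) (auto simp: w_def wn_def abs_mult mult.assoc simp flip: right_diff_distrib)
        qed
        then have "(LINT x|lebesgue_on \<Omega>'. norm (w x - wn n x) powr p) \<le> (LINT x|lebesgue_on \<Omega>'. ?c * norm (v x - \<phi> n x) powr p)"
          by (intro integral_mono' integrable_mult_right integrable_lebesgue_on_subset[OF \<Omega>(3) \<Omega>s] LpD(2)[OF L(1)]) auto
        also have "\<dots> \<le> (LINT x|?M. ?c * norm (v x - \<phi> n x) powr p)"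
          by (intro integral_lebesgue_on_subset[OF \<Omega>(3) \<Omega>s] integrable_mult_right LpD(2)[OF L(1)]) auto
        finally show ?thesis by simp
      qed
      then show "\<forall>\<^sub>F n in sequentially. norm (LINT x|lebesgue_on \<Omega>'. norm (w x - wn n x) powr p) \<le> ?c * ?e1 n"
        by (intro always_eventually allI) (simp add: integral_nonneg_AE)
    qed
    show "(\<lambda>n. LINT x|lebesgue_on \<Omega>'. norm (Dw x - grad (wn n) x) powr p) \<longlonglongrightarrow> 0"
    proof (rule Lim_null_comparison)
      let ?W = "\<lambda>n x. 2 powr p * (?c * norm (v x - \<phi> n x) powr p + 2 powr p *
         (A powr p * E n x + ?c * norm (Dv x - grad (\<phi> n) x) powr p))"
      have Wi: "integrable (?M) (?W n)" for n
        using LpD(2)[OF L(1), of n] LpD(2)[OF L(2), of n] Ei[of n] by auto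
      have "(\<lambda>n. 2 powr p * (?c * ?e1 n + 2 powr p *
         (A powr p * integral\<^sup>L (?M) (E n) + ?c * ?e2 n)))
          \<longlonglongrightarrow> 2 powr p * (?c * 0 + 2 powr p * (A powr p * 0 + ?c * 0))"
        using l3 by (intro tendsto_add tendsto_mult tendsto_const l1 l2) simp
      then show "(\<lambda>n. integral\<^sup>L (?M) (?W n)) \<longlonglongrightarrow> 0"
        using LpD(2)[OF L(1)] LpD(2)[OF L(2)] Ei by simp
      have "(LINT x|lebesgue_on \<Omega>'. norm (Dw x - grad (wn n) x) powr p) \<le> integral\<^sup>L (?M) (?W n)" for n
      proof -
        have le: "norm (Dw x - grad (wn n) x) powr p \<le> ?W n x" for x
        proof -
          define X where "X = (G (v x) - G (\<phi> n x)) *\<^sub>R grad \<psi> x"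
          define Y where "Y = (\<psi> x * (deriv G (v x) - deriv G (\<phi> n x))) *\<^sub>R Dv x"
          define Z where "Z = (\<psi> x * deriv G (\<phi> n x)) *\<^sub>R (Dv x - grad (\<phi> n) x)"
          have eq: "Dw x - grad (wn n) x = X + (Y + Z)"
            by (simp add: Dw_def gwn X_def Y_def Z_def algebra_simps)
          have "\<bar>G (v x) - G (\<phi> n x)\<bar> * norm (grad \<psi> x) \<le> (A * \<bar>v x - \<phi> n x\<bar>) * A"
            using \<psi>(3) smooth_lipschitz[OF G(1,3)] A0 by (intro mult_mono) auto
          then have X: "norm X powr p \<le> ?c * norm (v x - \<phi> n x) powr p"
            using p0 by (intro norm_powr_le) (auto simp: X_def mult_ac)
          have "norm Y powr p \<le> (A * (\<bar>deriv G (v x) - deriv G (\<phi> n x)\<bar> * norm (Dv x))) powr p"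
            using p0 \<psi>(2) by (intro powr_mono2) (auto simp: Y_def abs_mult mult.assoc intro!: mult_right_mono)
          then have Y: "norm Y powr p \<le> A powr p * E n x"
            by (simp add: powr_mult A0 E_def)
          have "\<bar>\<psi> x * deriv G (\<phi> n x)\<bar> \<le> A * A" unfolding abs_mult using \<psi>(2) G(3) A0 by (intro mult_mono) auto
          then have Z: "norm Z powr p \<le> ?c * norm (Dv x - grad (\<phi> n) x) powr p"
            using p0 by (intro norm_powr_le) (auto simp: Z_def intro: mult_right_mono)
          have "norm (X + (Y + Z)) powr p \<le> 2 powr p * (norm X powr p + norm (Y + Z) powr p)"
            by (rule powr_add_le[OF p0])
          also have "\<dots> \<le> 2 powr p * (norm X powr p + 2 powr p * (norm Y powr p + norm Z powr p))"
            by (intro mult_left_mono add_left_mono powr_add_le[OF p0]) auto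
          also have "\<dots> \<le> ?W n x"
            by (intro mult_left_mono add_mono X Y Z) auto
          finally show ?thesis by (simp add: eq)
        qed
        have "(LINT x|lebesgue_on \<Omega>'. norm (Dw x - grad (wn n) x) powr p) \<le> integral\<^sup>L (lebesgue_on \<Omega>') (?W n)"
          by (intro integral_mono' integrable_lebesgue_on_subset[OF \<Omega>(3) \<Omega>s] Wi le order_trans[OF _ le]) auto
        also have "\<dots> \<le> integral\<^sup>L (?M) (?W n)"
          by (intro integral_lebesgue_on_subset[OF \<Omega>(3) \<Omega>s] Wi order_trans[OF _ le]) auto
        finally show ?thesis .
      qed
      then show "\<forall>\<^sub>F n in sequentially. norm (LINT x|lebesgue_on \<Omega>'. norm (Dw x - grad (wn n) x) powr p) \<le> integral\<^sup>L (?M) (?W n)"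
        by (intro always_eventually allI) (simp add: integral_nonneg_AE)
    qed
  qed
  then show ?thesis by (simp add: w_def Dw_def)
qed

section \<open>A Faber-Krahn inequality\<close>

text \<open>Fatou's lemma transfers the estimate from the approximating test functions. The function $g$ is a
  Borel version of the extension of $w$ by zero, so that it can be translated and integrated over the
  product space. The factor $2^p$ comes from a crude bound of the norms of the approximating
  gradients.\<close>

lemma sobolev0_translation_estimate:
  fixes w :: "'a::euclidean_space \<Rightarrow> real"
  assumes s: "sobolev0 p \<Omega> w Dw" and p: "p > 1" and \<Omega>: "\<Omega> \<in> sets lebesgue"
    and g[measurable]: "g \<in> borel_measurable borel" and eq: "AE x in lborel. indicator \<Omega> x * w x = g x"
  shows "(\<integral>\<^sup>+x. ennreal (\<bar>g (x + h) - g x\<bar> powr p) \<partial>lborel)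
     \<le> ennreal (norm h powr p * (2 powr p * (LINT x|lebesgue_on \<Omega>. norm (Dw x) powr p)))"
proof -
  let ?M = "lebesgue_on \<Omega>"
  have p0: "p > 0" using p by simp
  have DwL: "Dw \<in> Lp p \<Omega>" using s by (auto simp: sobolev0_def sobolev_def)
  obtain \<phi> :: "nat \<Rightarrow> 'a \<Rightarrow> real" where \<phi>: "\<And>n. \<phi> n \<in> test_functions \<Omega>"
    and l1: "(\<lambda>n. LINT x|?M. norm (w x - \<phi> n x) powr p) \<longlonglongrightarrow> 0"
    and l2: "(\<lambda>n. LINT x|?M. norm (Dw x - grad (\<phi> n) x) powr p) \<longlonglongrightarrow> 0"
    and ae: "AE x in ?M. (\<lambda>n. \<phi> n x) \<longlonglongrightarrow> w x"
    by (rule sobolev0_approx[OF s p0 \<Omega>]) (rule that)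
  have sm: "smooth (\<phi> n)" for n using \<phi> by (simp add: test_functions_def)
  note [measurable] = smooth_borel[OF sm] smooth_grad_borel[OF sm]
  note out = test_functions_outside[OF \<phi>]
  have "AE x in lebesgue. x \<in> \<Omega> \<longrightarrow> (\<lambda>n. \<phi> n x) \<longlonglongrightarrow> w x"
    using ae \<Omega> by (subst (asm) AE_restrict_space_iff) auto
  moreover have "AE x in lebesgue. indicator \<Omega> x * w x = g x"
    by (rule AE_completion[OF eq])
  ultimately have "AE x in lebesgue. (\<lambda>n. \<phi> n x) \<longlonglongrightarrow> g x"
  proof eventually_elim
    case (elim x)
    then show ?case using out by (cases "x \<in> \<Omega>") auto
  qed
  then have conv: "AE x in lborel. (\<lambda>n. \<phi> n x) \<longlonglongrightarrow> g x"
    by (simp add: AE_completion_iff)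
  then have "AE x in distr lborel borel ((+) h). (\<lambda>n. \<phi> n x) \<longlonglongrightarrow> g x"
    by (simp only: lborel_distr_plus)
  then have conv': "AE x in lborel. (\<lambda>n. \<phi> n (h + x)) \<longlonglongrightarrow> g (h + x)"
    by (rule AE_distrD[rotated]) simp
  \<comment> \<open>The gradients of the test functions have p-th power norms at most 2 powr p * (c + e n), with e n
    tending to 0.\<close>
  define c where "c = (LINT x|?M. norm (Dw x) powr p)"
  define e where "e n = (LINT x|?M. norm (Dw x - grad (\<phi> n) x) powr p)" for n
  have L: "(\<lambda>x. Dw x - grad (\<phi> n) x) \<in> Lp p \<Omega>" for n
    using Lp_diff[OF DwL test_functions_Lp(2)[OF \<phi> \<Omega> p0] p0] by auto
  have B: "(\<integral>x. norm (grad (\<phi> n) x) powr p \<partial>lborel) \<le> 2 powr p * (c + e n)" for n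
  proof -
    have "(\<integral>x. norm (grad (\<phi> n) x) powr p \<partial>lborel) = (LINT x|?M. norm (grad (\<phi> n) x) powr p)"
      by (rule lebesgue_on_eq_lborel[symmetric]) (use out \<Omega> in auto)
    also have "\<dots> \<le> (LINT x|?M. 2 powr p * (norm (Dw x) powr p + norm (Dw x - grad (\<phi> n) x) powr p))"
    proof (rule integral_mono')
      show "integrable (?M) (\<lambda>x. 2 powr p * (norm (Dw x) powr p + norm (Dw x - grad (\<phi> n) x) powr p))"
        using LpD(2)[OF DwL] LpD(2)[OF L] by simp
      show "norm (grad (\<phi> n) x) powr p \<le> 2 powr p * (norm (Dw x) powr p + norm (Dw x - grad (\<phi> n) x) powr p)" for x
        using powr_add_le[OF p0, of "Dw x" "grad (\<phi> n) x - Dw x"] by (simp add: norm_minus_commute)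
    qed auto
    also have "\<dots> = 2 powr p * (c + e n)"
      using LpD(2)[OF DwL] LpD(2)[OF L] by (simp add: c_def e_def)
    finally show ?thesis .
  qed
  have int: "integrable lborel (\<lambda>x. \<bar>\<phi> n (x + h) - \<phi> n x\<bar> powr p)" for n
  proof -
    have "integrable lborel (\<lambda>x. \<bar>\<phi> n x\<bar> powr p)"
      using LpD(2)[OF test_functions_Lp(1)[OF test_functions_subset[OF \<phi>] _ p0, of n]]
      by (simp add: lebesgue_on_UNIV_eq integrable_completion)
    from integrable_translation[OF this, of h] this
    have i: "integrable lborel (\<lambda>x. 2 powr p * (\<bar>\<phi> n (x + h)\<bar> powr p + \<bar>\<phi> n x\<bar> powr p))" by simp
    show ?thesis
    proof (rule Bochner_Integration.integrable_bound[OF i])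
      have "\<bar>\<phi> n (x + h) - \<phi> n x\<bar> powr p \<le> 2 powr p * (\<bar>\<phi> n (x + h)\<bar> powr p + \<bar>\<phi> n x\<bar> powr p)" for x
        using powr_add_le[OF p0, of "\<phi> n (x + h)" "- \<phi> n x"] by simp
      then show "AE x in lborel. norm (\<bar>\<phi> n (x + h) - \<phi> n x\<bar> powr p) \<le> norm (2 powr p * (\<bar>\<phi> n (x + h)\<bar> powr p + \<bar>\<phi> n x\<bar> powr p))"
        by (intro AE_I2) (auto intro!: order_trans[OF _ abs_ge_self])
    qed simp
  qed
  let ?d = "\<lambda>n x. ennreal (\<bar>\<phi> n (x + h) - \<phi> n x\<bar> powr p)"
  have "(\<integral>\<^sup>+x. ennreal (\<bar>g (x + h) - g x\<bar> powr p) \<partial>lborel)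
     = (\<integral>\<^sup>+x. liminf (\<lambda>n. ?d n x) \<partial>lborel)"
  proof (rule nn_integral_cong_AE)
    show "AE x in lborel. ennreal (\<bar>g (x + h) - g x\<bar> powr p) = liminf (\<lambda>n. ?d n x)"
      using conv conv'
    proof eventually_elim
      case (elim x)
      then have "(\<lambda>n. ?d n x) \<longlonglongrightarrow> ennreal (\<bar>g (x + h) - g x\<bar> powr p)"
        using p0 by (intro tendsto_ennrealI tendsto_powr2 tendsto_intros) (auto simp: add.commute)
      from lim_imp_Liminf[OF _ this] show ?case by simp
    qed
  qed
  also have "\<dots> \<le> liminf (\<lambda>n. \<integral>\<^sup>+x. ?d n x \<partial>lborel)"
    by (rule nn_integral_liminf) simp
  also have "\<dots> \<le> liminf (\<lambda>n. ennreal (norm h powr p * (2 powr p * (c + e n))))"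
  proof (rule Liminf_mono, intro always_eventually allI)
    fix n
    have "(\<integral>\<^sup>+x. ?d n x \<partial>lborel) = ennreal (\<integral>x. \<bar>\<phi> n (x + h) - \<phi> n x\<bar> powr p \<partial>lborel)"
      by (rule nn_integral_eq_integral[OF int]) simp
    also have "\<dots> \<le> ennreal (norm h powr p * (2 powr p * (c + e n)))"
      by (intro ennreal_leI order_trans[OF translation_estimate[OF test_functions_subset[OF \<phi>] p]] mult_left_mono B) auto
    finally show "(\<integral>\<^sup>+x. ?d n x \<partial>lborel) \<le> ennreal (norm h powr p * (2 powr p * (c + e n)))" .
  qed
  also have "\<dots> = ennreal (norm h powr p * (2 powr p * (c + 0)))"
    using l2 by (intro lim_imp_Liminf tendsto_ennrealI tendsto_mult tendsto_add tendsto_const) (auto simp: e_def[abs_def])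
  finally show ?thesis by (simp add: c_def)
qed

text \<open>The ball of translations has twice the measure allowed for the support of $g$. Hence, for each $x$, at
  least half of the translations $h$ satisfy $g(x+h) = 0$, and for these the difference is $|g(x)|$.
  Averaging over $h$ and exchanging the integrals bounds the norm of $g$ by that of its
  differences.\<close>

lemma average_translation_bound:
  fixes g :: "'a::euclidean_space \<Rightarrow> real"
  assumes g[measurable]: "g \<in> borel_measurable borel" and p: "p > 0" and m: "m > 0"
    and supp: "emeasure lborel {x. g x \<noteq> 0} \<le> ennreal m"
    and ball: "emeasure lborel (cball (0::'a) r) = ennreal (2 * m)" and r: "r \<ge> 0" and D: "D \<ge> 0"
    and trans: "\<And>h. (\<integral>\<^sup>+x. ennreal (\<bar>g (x + h) - g x\<bar> powr p) \<partial>lborel) \<le> ennreal (norm h powr p * D)"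
  shows "(\<integral>\<^sup>+x. ennreal (\<bar>g x\<bar> powr p) \<partial>lborel) \<le> ennreal (2 * r powr p * D)"
proof -
  let ?B = "cball (0::'a) r"
  let ?d = "\<lambda>x h. ennreal (\<bar>g (x + h) - g x\<bar> powr p)"
  have [measurable]: "?B \<in> sets borel" by simp
  have point: "ennreal m * ennreal (\<bar>g x\<bar> powr p) \<le> (\<integral>\<^sup>+h. indicator ?B h * ?d x h \<partial>lborel)" for x
  proof -
    let ?Z = "{h. g (x + h) \<noteq> 0}"
    have Z: "?Z \<in> sets lborel" by simp
    have "emeasure lborel ?Z = emeasure (distr lborel borel ((+) x)) {y. g y \<noteq> 0}"
      by (subst emeasure_distr) (auto simp: vimage_def)
    also have "\<dots> \<le> ennreal m" using supp by (simp add: lborel_distr_plus)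
    finally have Zm: "emeasure lborel ?Z \<le> ennreal m" .
    have "ennreal m + ennreal m = emeasure lborel ?B" using m by (simp add: ball flip: ennreal_plus)
    also have "\<dots> \<le> emeasure lborel ((?B - ?Z) \<union> ?Z)" by (intro emeasure_mono) auto
    also have "\<dots> \<le> emeasure lborel (?B - ?Z) + emeasure lborel ?Z" by (intro emeasure_subadditive) auto
    also have "\<dots> \<le> emeasure lborel (?B - ?Z) + ennreal m" by (intro add_left_mono Zm)
    finally have "ennreal m \<le> emeasure lborel (?B - ?Z)"
      by (simp add: ennreal_add_left_cancel_le add.commute)
    then have "ennreal m * ennreal (\<bar>g x\<bar> powr p) \<le> ennreal (\<bar>g x\<bar> powr p) * emeasure lborel (?B - ?Z)"
      by (subst mult.commute) (intro mult_left_mono, auto)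
    also have "\<dots> = (\<integral>\<^sup>+h. ennreal (\<bar>g x\<bar> powr p) * indicator (?B - ?Z) h \<partial>lborel)"
      by (rule nn_integral_cmult_indicator[symmetric]) simp
    also have "\<dots> \<le> (\<integral>\<^sup>+h. indicator ?B h * ?d x h \<partial>lborel)"
      by (intro nn_integral_mono) (auto simp: indicator_def)
    finally show ?thesis .
  qed
  have "ennreal m * (\<integral>\<^sup>+x. ennreal (\<bar>g x\<bar> powr p) \<partial>lborel) = (\<integral>\<^sup>+x. ennreal m * ennreal (\<bar>g x\<bar> powr p) \<partial>lborel)"
    by (rule nn_integral_cmult[symmetric]) simp
  also have "\<dots> \<le> (\<integral>\<^sup>+x. (\<integral>\<^sup>+h. indicator ?B h * ?d x h \<partial>lborel) \<partial>lborel)"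
    by (intro nn_integral_mono point)
  also have "\<dots> = (\<integral>\<^sup>+h. (\<integral>\<^sup>+x. indicator ?B h * ?d x h \<partial>lborel) \<partial>lborel)"
    by (rule lborel_pair.Fubini') (simp add: split_beta', measurable)
  also have "\<dots> = (\<integral>\<^sup>+h. indicator ?B h * (\<integral>\<^sup>+x. ?d x h \<partial>lborel) \<partial>lborel)"
    by (intro nn_integral_cong nn_integral_cmult) simp
  also have "\<dots> \<le> (\<integral>\<^sup>+h. ennreal (r powr p * D) * indicator ?B h \<partial>lborel)"
  proof (rule nn_integral_mono)
    fix h :: 'a
    have "(\<integral>\<^sup>+x. ?d x h \<partial>lborel) \<le> ennreal (r powr p * D)" if "norm h \<le> r"
      using that p D by (intro order_trans[OF trans] ennreal_leI mult_right_mono powr_mono2) auto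
    then show "indicator ?B h * (\<integral>\<^sup>+x. ?d x h \<partial>lborel) \<le> ennreal (r powr p * D) * indicator ?B h"
      by (auto simp: indicator_def)
  qed
  also have "\<dots> = ennreal (r powr p * D) * ennreal (2 * m)"
    by (subst nn_integral_cmult_indicator) (auto simp: ball)
  also have "\<dots> = ennreal m * ennreal (2 * r powr p * D)"
    using D m by (simp add: mult_ac flip: ennreal_mult)
  finally show ?thesis using m by (simp add: ennreal_mult_le_mult_iff)
qed

text \<open>The measure of the support of $w$ enters through the integral of a majorant $b$ of its indicator
  function. The radius is chosen so that the ball has twice that integral as its measure, which gives the
  exponent $p/N$. A majorant is used because the support is estimated by Chebyshev's inequality.\<close>

lemma faber_krahn:
  fixes p :: real
  assumes p: "p > 1"
  shows "\<exists>K>0. \<forall>\<Omega> w Dw b. \<Omega> \<in> sets lebesgue \<longrightarrow> sobolev0 p \<Omega> w Dw \<longrightarrow>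
     integrable (lebesgue_on \<Omega>) b \<longrightarrow> (\<forall>x. 0 \<le> b x) \<longrightarrow> (\<forall>x. w x \<noteq> 0 \<longrightarrow> 1 \<le> b x) \<longrightarrow>
     (LINT x|lebesgue_on \<Omega>. \<bar>w x\<bar> powr p) \<le> K * (LINT x|lebesgue_on \<Omega>. b x) powr (p / DIM('a))
        * (LINT x|lebesgue_on \<Omega>. norm (Dw x :: 'a::euclidean_space) powr p)"
proof -
  define V where "V = unit_ball_vol (real DIM('a))"
  have V: "V > 0" by (simp add: V_def unit_ball_vol_pos)
  define N where "N = real DIM('a)"
  have N: "N > 0" by (simp add: N_def)
  define K where "K = 2 * (2 / V) powr (p / N) * 2 powr p"
  show ?thesis
  proof (intro exI[of _ K] conjI allI impI)
    show "K > 0" using V by (simp add: K_def)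
    fix \<Omega> :: "'a set" and w b :: "'a \<Rightarrow> real" and Dw :: "'a \<Rightarrow> 'a"
    let ?M = "lebesgue_on \<Omega>"
    assume \<Omega>: "\<Omega> \<in> sets lebesgue" and s: "sobolev0 p \<Omega> w Dw" and b: "integrable (?M) b"
      and b0: "\<forall>x. 0 \<le> b x" and b1: "\<forall>x. w x \<noteq> 0 \<longrightarrow> 1 \<le> b x"
    have wL: "w \<in> Lp p \<Omega>" using s by (auto simp: sobolev0_def sobolev_def)
    note [measurable] = LpD(1)[OF wL]
    define m where "m = (LINT x|?M. b x)"
    define D where "D = 2 powr p * (LINT x|?M. norm (Dw x) powr p)"
    have m0: "m \<ge> 0" unfolding m_def using b0 by (intro integral_nonneg_AE) auto
    have D0: "D \<ge> 0" unfolding D_def by (intro mult_nonneg_nonneg integral_nonneg_AE) auto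
    have w0m: "(\<lambda>x. indicator \<Omega> x * w x) \<in> borel_measurable lebesgue"
      using LpD(1)[OF wL] \<Omega> by (subst (asm) borel_measurable_restrict_space_iff) auto
    obtain g where g[measurable]: "g \<in> borel_measurable lborel" and eq: "AE x in lborel. indicator \<Omega> x * w x = g x"
      using completion_ex_borel_measurable_real[OF w0m] by auto
    have eqL: "AE x in lebesgue. indicator \<Omega> x * w x = g x" by (rule AE_completion[OF eq])
    have W: "{x \<in> \<Omega>. w x \<noteq> 0} \<in> sets (?M)"
    proof -
      have "{x \<in> space (?M). w x \<noteq> 0} \<in> sets (?M)" by measurable
      then show ?thesis by simp
    qed
    have "emeasure lborel {x. g x \<noteq> 0} = emeasure lebesgue {x. g x \<noteq> 0}"
      using g by simp
    also have "\<dots> = emeasure lebesgue {x \<in> \<Omega>. w x \<noteq> 0}"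
    proof (rule emeasure_eq_AE)
      show "AE x in lebesgue. (x \<in> {x. g x \<noteq> 0}) = (x \<in> {x \<in> \<Omega>. w x \<noteq> 0})"
        using eqL
      proof eventually_elim
        case (elim x)
        then show ?case by (cases "x \<in> \<Omega>") auto
      qed
      show "{x. g x \<noteq> 0} \<in> sets lebesgue" using g by simp
      show "{x \<in> \<Omega>. w x \<noteq> 0} \<in> sets lebesgue" using W \<Omega> by (simp add: sets_restrict_space_iff)
    qed
    also have "\<dots> = emeasure (?M) {x \<in> \<Omega>. w x \<noteq> 0}"
      using \<Omega> by (subst emeasure_restrict_space) auto
    also have "\<dots> = (\<integral>\<^sup>+x. indicator {x \<in> \<Omega>. w x \<noteq> 0} x \<partial>?M)"
      using W by simp
    also have "\<dots> \<le> (\<integral>\<^sup>+x. ennreal (b x) \<partial>?M)"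
      using b1 by (intro nn_integral_mono) (auto simp: indicator_def)
    also have "\<dots> = ennreal m"
      unfolding m_def using b b0 by (intro nn_integral_eq_integral) auto
    finally have supp: "emeasure lborel {x. g x \<noteq> 0} \<le> ennreal m" .
    have "ennreal (LINT x|?M. \<bar>w x\<bar> powr p) = (\<integral>\<^sup>+x. ennreal (\<bar>w x\<bar> powr p) \<partial>?M)"
      using LpD(2)[OF wL] by (intro nn_integral_eq_integral[symmetric]) auto
    also have "\<dots> = (\<integral>\<^sup>+x. ennreal (\<bar>w x\<bar> powr p) * indicator \<Omega> x \<partial>lebesgue)"
      using \<Omega> by (intro nn_integral_restrict_space) auto
    also have "\<dots> = (\<integral>\<^sup>+x. ennreal (\<bar>g x\<bar> powr p) \<partial>lebesgue)"
    proof (rule nn_integral_cong_AE)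
      show "AE x in lebesgue. ennreal (\<bar>w x\<bar> powr p) * indicator \<Omega> x = ennreal (\<bar>g x\<bar> powr p)"
        using eqL
      proof eventually_elim
        case (elim x)
        then show ?case by (cases "x \<in> \<Omega>") auto
      qed
    qed
    also have "\<dots> = (\<integral>\<^sup>+x. ennreal (\<bar>g x\<bar> powr p) \<partial>lborel)"
      by (simp add: nn_integral_completion)
    also have "\<dots> \<le> ennreal (K * m powr (p / N) * (LINT x|?M. norm (Dw x) powr p))"
    proof (cases "m = 0")
      \<comment> \<open>A null support leaves no ball to average over, but then w vanishes almost everywhere.\<close>
      case True
      then have "emeasure lborel {x. g x \<noteq> 0} = 0" using supp by simp
      then have "AE x in lborel. g x = 0"
        by (subst AE_iff_measurable[OF _ refl]) auto
      then have "(\<integral>\<^sup>+x. ennreal (\<bar>g x\<bar> powr p) \<partial>lborel) = (\<integral>\<^sup>+x. 0 \<partial>(lborel::'a measure))"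
        using p by (intro nn_integral_cong_AE) (auto elim!: eventually_mono)
      then show ?thesis by simp
    next
      case False
      then have mp: "m > 0" using m0 by simp
      define r where "r = (2 * m / V) powr (1 / N)"
      have r: "r \<ge> 0" by (simp add: r_def)
      have "r > 0" using mp V by (simp add: r_def)
      then have "r ^ DIM('a) = r powr N" by (simp add: N_def powr_realpow)
      also have "\<dots> = 2 * m / V"
        using mp V N by (simp add: r_def powr_powr)
      finally have "r ^ DIM('a) = 2 * m / V" .
      then have ball: "emeasure lborel (cball (0::'a) r) = ennreal (2 * m)"
        using emeasure_cball[OF r, of "0::'a", folded V_def] V by simp
      have "(\<integral>\<^sup>+x. ennreal (\<bar>g x\<bar> powr p) \<partial>lborel) \<le> ennreal (2 * r powr p * D)"
        using p sobolev0_translation_estimate[OF s p \<Omega> _ eq]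
        by (intro average_translation_bound[OF _ _ mp supp ball r D0]) (auto simp: D_def)
      also have "2 * r powr p * D = K * m powr (p / N) * (LINT x|?M. norm (Dw x) powr p)"
        using mp V by (simp add: r_def K_def D_def powr_powr powr_mult powr_divide mult_ac)
      finally show ?thesis .
    qed
    finally show "(LINT x|?M. \<bar>w x\<bar> powr p) \<le> K * (LINT x|?M. b x) powr (p / DIM('a))
        * (LINT x|?M. norm (Dw x) powr p)"
      using \<open>K > 0\<close> by (subst (asm) ennreal_le_iff) (auto simp: m_def N_def intro!: mult_nonneg_nonneg integral_nonneg_AE)
  qed
qed

section \<open>The Caccioppoli inequality\<close>

text \<open>Fixes the representative of the weak gradient, so that it can be named in the estimates.\<close>

definition subsolution_grad :: "real \<Rightarrow> 'a::euclidean_space set \<Rightarrow> real \<Rightarrow> ('a \<Rightarrow> real) \<Rightarrow> ('a \<Rightarrow> 'a) \<Rightarrow> bool" where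
  "subsolution_grad p \<Omega> l v Dv \<longleftrightarrow> (AE x in lebesgue_on \<Omega>. 0 \<le> v x) \<and> sobolev0 p \<Omega> v Dv \<and>
     (\<forall>\<phi> D\<phi>. sobolev0 p \<Omega> \<phi> D\<phi> \<and> (AE x in lebesgue_on \<Omega>. 0 \<le> \<phi> x) \<longrightarrow>
           (LINT x|lebesgue_on \<Omega>. (norm (Dv x) powr (p - 2) *\<^sub>R Dv x) \<bullet> D\<phi> x)
             \<le> l * (LINT x|lebesgue_on \<Omega>. v x powr (p - 1) * \<phi> x))"

lemma subsolution_gradD:
  assumes "subsolution_grad p \<Omega> l v Dv"
  shows "AE x in lebesgue_on \<Omega>. 0 \<le> v x" "sobolev0 p \<Omega> v Dv" "v \<in> Lp p \<Omega>" "Dv \<in> Lp p \<Omega>"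
  using assms by (auto simp: subsolution_grad_def sobolev0_def sobolev_def)

lemma nonneg_subsolution_iff: "nonneg_subsolution p \<Omega> l v \<longleftrightarrow> (\<exists>Dv. subsolution_grad p \<Omega> l v Dv)"
  unfolding nonneg_subsolution_def subsolution_grad_def by blast

lemma sobolev0_scale:
  assumes "sobolev0 p \<Omega> w Dw" "p > 1" "open \<Omega>"
  shows "sobolev0 p \<Omega> (\<lambda>x. c * w x) (\<lambda>x. c *\<^sub>R Dw x)"
proof -
  have "sobolev0 p \<Omega> (\<lambda>x. c * w x) (\<lambda>x. (c * deriv (\<lambda>t. t) (w x)) *\<^sub>R Dw x + w x *\<^sub>R grad (\<lambda>x. c) x)"
    by (rule sobolev0_cutoff_compose[OF assms(1,2,3,3) _ smooth_ident, where A="max 1 \<bar>c\<bar>"])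
       (auto simp: smooth_const deriv_id grad_const)
  then show ?thesis by (simp add: deriv_id grad_const)
qed

lemma cutoff_truncation_sobolev0:
  assumes s: "sobolev0 p \<Omega> v Dv" and p: "p > 1" and \<Omega>: "open \<Omega>" "open \<Omega>'" "\<Omega>' \<subseteq> \<Omega>"
    and G: "truncation k G" and cut: "radial_cutoff p r s' B \<eta> \<zeta>"
    and supp: "closure {x. \<eta> x \<noteq> 0} \<inter> \<Omega> \<subseteq> \<Omega>'"
  shows "sobolev0 p \<Omega>' (\<lambda>x. \<eta> x * G (v x)) (\<lambda>x. (\<eta> x * deriv G (v x)) *\<^sub>R Dv x + G (v x) *\<^sub>R grad \<eta> x)"
proof (rule sobolev0_cutoff_compose[OF s p \<Omega>, where A="max 1 B"])
  show "smooth \<eta>" "smooth G" "G 0 = 0" using cut G by (auto simp: radial_cutoff_def truncation_def)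
  show "\<bar>deriv G t\<bar> \<le> max 1 B" for t using G by (auto simp: truncation_def abs_le_iff le_max_iff_disj intro: order_trans[of _ 0])
  show "\<bar>\<eta> x\<bar> \<le> max 1 B" "norm (grad \<eta> x) \<le> max 1 B" for x
    using cut by (auto simp: radial_cutoff_def le_max_iff_disj)
qed (rule supp)

text \<open>The infimum is over normalised functions; rescaling removes the normalisation. It is stated for real
  lower bounds $L$ since the infimum itself may be infinite.\<close>

lemma lambda1_le:
  assumes L: "ereal L \<le> lambda1 p \<Omega>" and s: "sobolev0 p \<Omega> w Dw" and p: "p > 1" and \<Omega>: "open \<Omega>"
  shows "L * (LINT x|lebesgue_on \<Omega>. \<bar>w x\<bar> powr p) \<le> (LINT x|lebesgue_on \<Omega>. norm (Dw x) powr p)"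
proof -
  let ?M = "lebesgue_on \<Omega>"
  define I where "I = (LINT x|?M. \<bar>w x\<bar> powr p)"
  define J where "J = (LINT x|?M. norm (Dw x) powr p)"
  have J0: "0 \<le> J" unfolding J_def by (intro integral_nonneg_AE) auto
  have I0: "0 \<le> I" unfolding I_def by (intro integral_nonneg_AE) auto
  have "L * I \<le> J"
  proof (cases "I = 0")
    case False
    then have I: "I > 0" using I0 by simp
    define c where "c = I powr (- (1 / p))"
    have "c powr p = I powr (- (1 / p) * p)" unfolding c_def by (rule powr_powr)
    also have "- (1 / p) * p = - 1" using p by simp
    finally have c: "c > 0" "c powr p = inverse I"
      using I by (auto simp: c_def powr_minus)
    have "(LINT x|?M. \<bar>c * w x\<bar> powr p) = c powr p * I"
      using c by (simp add: abs_mult powr_mult I_def)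
    then have one: "(LINT x|?M. \<bar>c * w x\<bar> powr p) = 1" using c I by simp
    have "lambda1 p \<Omega> \<le> ereal (LINT x|?M. norm (c *\<^sub>R Dw x) powr p)"
      unfolding lambda1_def
      by (rule Inf_lower, rule CollectI, rule exI[of _ "\<lambda>x. c * w x"], rule exI[of _ "\<lambda>x. c *\<^sub>R Dw x"])
         (use one sobolev0_scale[OF s p \<Omega>, of c] in blast)
    also have "(LINT x|?M. norm (c *\<^sub>R Dw x) powr p) = inverse I * J"
      using c by (simp add: powr_mult J_def)
    finally have "ereal L \<le> ereal (inverse I * J)" using L by (rule order_trans[rotated])
    then have "L \<le> inverse I * J" by simp
    then show ?thesis using I by (simp add: field_simps)
  qed (use J0 in simp)
  then show ?thesis by (simp add: I_def J_def)
qed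

text \<open>Young's inequality with a small factor: one of the two terms dominates according to whether
  $p\,b \le e\,a$.\<close>

lemma powr_absorb:
  fixes p e :: real
  assumes "p > 1" "e > 0"
  shows "\<exists>C>0. \<forall>a b. 0 \<le> a \<longrightarrow> 0 \<le> b \<longrightarrow> p * a powr (p - 1) * b \<le> e * a powr p + C * b powr p"
proof (intro exI[of _ "p * (p / e) powr (p - 1)"] conjI allI impI)
  show "0 < p * (p / e) powr (p - 1)" using assms by simp
  fix a b :: real assume ab: "0 \<le> a" "0 \<le> b"
  show "p * a powr (p - 1) * b \<le> e * a powr p + p * (p / e) powr (p - 1) * b powr p"
  proof (cases "p * b \<le> e * a")
    case True
    have "p * a powr (p - 1) * b \<le> a powr (p - 1) * (e * a)"
      using mult_left_mono[OF True, of "a powr (p - 1)"] by (simp add: mult_ac)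
    also have "\<dots> = e * a powr p" using powr_minus_1_mult[OF ab(1)] by (simp add: mult_ac)
    finally show ?thesis using assms by (simp add: add_increasing2)
  next
    case False
    then have "a \<le> p / e * b" using assms by (simp add: field_simps)
    then have "a powr (p - 1) \<le> (p / e * b) powr (p - 1)" using ab assms by (intro powr_mono2) auto
    also have "\<dots> = (p / e) powr (p - 1) * b powr (p - 1)" by (rule powr_mult)
    finally have "p * a powr (p - 1) * b \<le> p * ((p / e) powr (p - 1) * b powr (p - 1)) * b"
      using ab assms by (intro mult_right_mono mult_left_mono) auto
    also have "\<dots> = p * (p / e) powr (p - 1) * b powr p" using powr_minus_1_mult[OF ab(2)] by (simp add: mult_ac)
    finally show ?thesis using assms by (simp add: add_increasing)
  qed
qed

lemma powr_add_absorb: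
  fixes p e :: real
  assumes "p > 1" "e > 0"
  shows "\<exists>C>0. \<forall>a b. 0 \<le> a \<longrightarrow> 0 \<le> b \<longrightarrow> (a + b) powr p \<le> (1 + e) * a powr p + C * b powr p"
proof -
  define d where "d = (1 + e) powr (1 / p) - 1"
  have "1 powr (1 / p) < (1 + e) powr (1 / p)" using assms by (intro powr_less_mono2) auto
  then have d: "d > 0" "(1 + d) powr p = 1 + e" using assms by (auto simp: d_def powr_powr)
  show ?thesis
  proof (intro exI[of _ "(1 / d + 1) powr p"] conjI allI impI)
    have "1 / d + 1 > 0" using d by (simp add: add_pos_pos)
    then show "0 < (1 / d + 1) powr p" by simp
    fix a b :: real assume ab: "0 \<le> a" "0 \<le> b"
    show "(a + b) powr p \<le> (1 + e) * a powr p + (1 / d + 1) powr p * b powr p"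
    proof (cases "b \<le> d * a")
      case True
      then have "(a + b) powr p \<le> ((1 + d) * a) powr p"
        using ab assms by (intro powr_mono2) (auto simp: algebra_simps)
      also have "\<dots> = (1 + e) * a powr p" using ab d by (simp add: powr_mult)
      finally show ?thesis by (simp add: add_increasing2)
    next
      case False
      then have "a \<le> 1 / d * b" using d by (simp add: field_simps)
      then have "(a + b) powr p \<le> ((1 / d + 1) * b) powr p"
        using ab assms by (intro powr_mono2) (auto simp: algebra_simps)
      also have "\<dots> = (1 / d + 1) powr p * b powr p" using ab d by (simp add: powr_mult)
      finally show ?thesis using assms by (simp add: add_increasing)
    qed
  qed
qed

text \<open>The subsolution is tested with $\eta^p G(v)$. Write $X = (\eta |\nabla v|)^p$, $Y = (|\nabla\eta|\,
  (v-k)_+)^p$ and $g = G'(v)$. By the property $G(v) \le (v-k)_+ \, g$ of truncations, the integrand $I$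
  of the left side of the inequality for subsolutions satisfies $I \ge g\,((1-e) X - C_1 Y)$, whereas
  $|\nabla(\eta G(v))|^p \le g\,((1+e) X + C_2 Y)$. With $(1+e)/(1-e) = \mu/\lambda$ this gives
  $|\nabla(\eta G(v))|^p \le (\mu/\lambda)\, I + C\, Y$ pointwise. The loss in the constant
  $\lambda$ is arbitrarily small, which is essential for the decay up to the threshold.\<close>

lemma energy_estimate:
  fixes p l \<mu> :: real
  assumes p: "p > 1" and l: "0 < l" "l < \<mu>"
  shows "\<exists>C>0. \<forall>(\<Omega> :: 'a::euclidean_space set) v Dv k G r s B \<eta> \<zeta>.
     open \<Omega> \<longrightarrow> subsolution_grad p \<Omega> l v Dv \<longrightarrow> 0 \<le> k \<longrightarrow> truncation k G \<longrightarrow> radial_cutoff p r s B \<eta> \<zeta> \<longrightarrow>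
     (LINT x|lebesgue_on \<Omega>. norm ((\<eta> x * deriv G (v x)) *\<^sub>R Dv x + G (v x) *\<^sub>R grad \<eta> x) powr p)
      \<le> \<mu> * (LINT x|lebesgue_on \<Omega>. v x powr (p - 1) * (\<zeta> x * G (v x))) +
         C * (LINT x|lebesgue_on \<Omega>. (norm (grad \<eta> x) * max 0 (v x - k)) powr p)"
proof -
  \<comment> \<open>The solution of (1 + e) / (1 - e) = \<mu> / l.\<close>
  define e where "e = (\<mu> - l) / (\<mu> + l)"
  have e: "0 < e" "e < 1" "(1 + e) = \<mu> / l * (1 - e)"
    using l by (auto simp: e_def field_simps)
  obtain C1 where C1: "C1 > 0" "\<And>a b. 0 \<le> a \<Longrightarrow> 0 \<le> b \<Longrightarrow> p * a powr (p - 1) * b \<le> e * a powr p + C1 * b powr p"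
    using powr_absorb[OF p e(1)] by blast
  obtain C2 where C2: "C2 > 0" "\<And>a b. 0 \<le> a \<Longrightarrow> 0 \<le> b \<Longrightarrow> (a + b) powr p \<le> (1 + e) * a powr p + C2 * b powr p"
    using powr_add_absorb[OF p e(1)] by blast
  define q where "q = \<mu> / l"
  define C where "C = \<mu> / l * C1 + C2"
  show ?thesis
  proof (intro exI[of _ C] conjI allI impI)
    show "C > 0" using C1(1) C2(1) l by (auto simp: C_def intro!: add_pos_pos)
    fix \<Omega> :: "'a set" and v \<eta> \<zeta> :: "'a \<Rightarrow> real" and Dv :: "'a \<Rightarrow> 'a" and k G r s B
    let ?M = "lebesgue_on \<Omega>"
    assume \<Omega>: "open \<Omega>" and sub: "subsolution_grad p \<Omega> l v Dv" and k: "0 \<le> k"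
      and G: "truncation k G" and cut: "radial_cutoff p r s B \<eta> \<zeta>"
    note v0 = subsolution_gradD(1)[OF sub] and s = subsolution_gradD(2)[OF sub] and vL = subsolution_gradD(3,4)[OF sub]
    have sm: "smooth \<eta>" "smooth \<zeta>" "smooth G" using cut G by (auto simp: radial_cutoff_def truncation_def)
    have \<eta>: "0 \<le> \<eta> x" "\<eta> x \<le> 1" "\<zeta> x = \<eta> x powr p" "grad \<zeta> x = (p * \<eta> x powr (p - 1)) *\<^sub>R grad \<eta> x"
      "norm (grad \<eta> x) \<le> B" for x
      using cut by (auto simp: radial_cutoff_def)
    have G0: "G 0 = 0" "0 \<le> deriv G t" "deriv G t \<le> 1" for t using G by (auto simp: truncation_def)
    have Gp: "0 \<le> G t" "G t \<le> max 0 (t - k) * deriv G t" if "t \<ge> 0" for t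
      using G that by (auto simp: truncation_def)
    note [measurable] = LpD(1)[OF vL(1)] LpD(1)[OF vL(2)] smooth_borel[OF sm(3)] smooth_borel[OF smooth_deriv[OF sm(3)]]
      smooth_measurable[OF sm(1)] smooth_measurable[OF sm(2)]
    have B0: "B \<ge> 0" using \<eta>(5)[of 0] norm_ge_zero[of "grad \<eta> 0"] by linarith
    have \<zeta>01: "0 \<le> \<zeta> x" "\<zeta> x \<le> 1" for x using \<eta>[of x] p by (auto simp: powr_le1)
    have g\<zeta>: "norm (grad \<zeta> x) \<le> p * B" for x
    proof -
      have "p * \<eta> x powr (p - 1) * norm (grad \<eta> x) \<le> p * 1 * B"
        using \<eta>[of x] p by (intro mult_mono) (auto simp: powr_le1)
      then show ?thesis using p by (simp add: \<eta>(4))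
    qed
    have g': "norm (grad \<zeta> x) \<le> 1 + p * B" for x using g\<zeta>[of x] by linarith
    have pB0: "0 \<le> p * B" using p B0 by simp
    define Dw where "Dw = (\<lambda>x. (\<eta> x * deriv G (v x)) *\<^sub>R Dv x + G (v x) *\<^sub>R grad \<eta> x)"
    define D\<phi> where "D\<phi> = (\<lambda>x. (\<zeta> x * deriv G (v x)) *\<^sub>R Dv x + G (v x) *\<^sub>R grad \<zeta> x)"
    have "sobolev0 p \<Omega> (\<lambda>x. \<eta> x * G (v x)) Dw" unfolding Dw_def
      by (rule cutoff_truncation_sobolev0[OF s p \<Omega> \<Omega> order_refl G cut]) auto
    then have DwL: "Dw \<in> Lp p \<Omega>" by (auto simp: sobolev0_def sobolev_def)
    have \<phi>s: "sobolev0 p \<Omega> (\<lambda>x. \<zeta> x * G (v x)) D\<phi>" unfolding D\<phi>_def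
      by (rule sobolev0_cutoff_compose[OF s p \<Omega> \<Omega> order_refl sm(3), where A="1 + p * B"])
         (use G0 \<zeta>01 sm g' pB0 in \<open>auto simp: abs_le_iff intro: order_trans add_increasing2 add_increasing\<close>)
    then have D\<phi>L: "D\<phi> \<in> Lp p \<Omega>" by (auto simp: sobolev0_def sobolev_def)
    note [measurable] = LpD(1)[OF DwL] LpD(1)[OF D\<phi>L]
    define I where "I = (\<lambda>x. (norm (Dv x) powr (p - 2) *\<^sub>R Dv x) \<bullet> D\<phi> x)"
    define Y where "Y = (\<lambda>x. (norm (grad \<eta> x) * max 0 (v x - k)) powr p)"
    have flux: "norm (norm d powr (p - 2) *\<^sub>R d) = norm d powr (p - 1)" for d :: 'a
      using powr_add[of "norm d" "p - 2" 1] by (cases "d = 0") (auto simp: algebra_simps)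
    have Ii: "integrable (?M) I"
    proof (rule Bochner_Integration.integrable_bound)
      show "integrable (?M) (\<lambda>x. e * norm (Dv x) powr p + C1 * norm (D\<phi> x) powr p)"
        using LpD(2)[OF vL(2)] LpD(2)[OF D\<phi>L] by simp
      show "AE x in ?M. norm (I x) \<le> norm (e * norm (Dv x) powr p + C1 * norm (D\<phi> x) powr p)"
      proof (rule AE_I2)
        fix x
        have "\<bar>I x\<bar> \<le> norm (Dv x) powr (p - 1) * norm (D\<phi> x)"
          unfolding I_def flux[of "Dv x", symmetric] by (rule Cauchy_Schwarz_ineq2)
        also have "\<dots> \<le> p * norm (Dv x) powr (p - 1) * norm (D\<phi> x)"
          using p by (intro mult_right_mono) (auto simp: mult_le_cancel_right1)
        also have "\<dots> \<le> e * norm (Dv x) powr p + C1 * norm (D\<phi> x) powr p"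
          by (intro C1) auto
        finally show "norm (I x) \<le> norm (e * norm (Dv x) powr p + C1 * norm (D\<phi> x) powr p)" by simp
      qed
    qed (simp add: I_def)
    have Yi: "integrable (?M) Y"
    proof (rule Bochner_Integration.integrable_bound)
      show "integrable (?M) (\<lambda>x. B powr p * norm (v x) powr p)"
        using LpD(2)[OF vL(1)] by simp
      show "AE x in ?M. norm (Y x) \<le> norm (B powr p * norm (v x) powr p)"
      proof (rule AE_I2)
        fix x
        have "Y x \<le> (B * \<bar>v x\<bar>) powr p" unfolding Y_def
          using p k \<eta>(5)[of x] B0 by (intro powr_mono2 mult_mono) auto
        then show "norm (Y x) \<le> norm (B powr p * norm (v x) powr p)"
          using B0 by (simp add: powr_mult Y_def)
      qed
    qed (simp add: Y_def)
    have point: "AE x in ?M. norm (Dw x) powr p \<le> \<mu> / l * I x + C * Y x"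
      using v0
    proof eventually_elim
      case (elim x)
      define g where "g = deriv G (v x)"
      define X where "X = (\<eta> x * norm (Dv x)) powr p"
      define T where "T = max 0 (v x - k)"
      define n where "n = norm (grad \<eta> x)"
      have g: "0 \<le> g" "g \<le> 1" using G0 by (auto simp: g_def)
      have Y0: "0 \<le> Y x" by (simp add: Y_def)
      have T0: "0 \<le> T" and n0: "0 \<le> n" by (auto simp: T_def n_def)
      have GT: "0 \<le> G (v x)" "G (v x) \<le> T * g" using Gp[OF elim] by (auto simp: T_def g_def)
      have Yx: "Y x = (n * T) powr p" by (simp add: Y_def n_def T_def)
      have first: "norm (Dw x) powr p \<le> g * ((1 + e) * X + C2 * Y x)"
      proof -
        have "norm (Dw x) \<le> norm ((\<eta> x * g) *\<^sub>R Dv x) + norm (G (v x) *\<^sub>R grad \<eta> x)"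
          unfolding Dw_def g_def by (rule norm_triangle_ineq)
        also have "\<dots> = \<eta> x * g * norm (Dv x) + G (v x) * n"
          using \<eta>(1)[of x] g(1) GT(1) by (simp add: n_def)
        also have "\<dots> \<le> \<eta> x * g * norm (Dv x) + T * g * n"
          using GT n0 by (intro add_left_mono mult_right_mono)
        also have "\<dots> = g * (\<eta> x * norm (Dv x) + n * T)" by (simp add: algebra_simps)
        finally have "norm (Dw x) powr p \<le> (g * (\<eta> x * norm (Dv x) + n * T)) powr p"
          using p by (intro powr_mono2) auto
        also have "\<dots> = g powr p * (\<eta> x * norm (Dv x) + n * T) powr p"
          using g T0 n0 \<eta>(1)[of x] by (simp add: powr_mult)
        \<comment> \<open>Since g is at most 1, one factor g survives from its p-th power.\<close>
        also have "\<dots> \<le> g * (\<eta> x * norm (Dv x) + n * T) powr p"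
          using g p powr_mono'[of 1 p g] by (intro mult_right_mono) auto
        also have "\<dots> \<le> g * ((1 + e) * X + C2 * Y x)"
          unfolding X_def Yx using g T0 n0 \<eta>(1)[of x] by (intro mult_left_mono C2) auto
        finally show ?thesis .
      qed
      have second: "g * ((1 - e) * X - C1 * Y x) \<le> I x"
      proof -
        define d where "d = norm (Dv x) powr (p - 2) *\<^sub>R Dv x"
        have dd: "d \<bullet> Dv x = norm (Dv x) powr p"
        proof (cases "Dv x = 0")
          case False
          then show ?thesis using powr_add[of "norm (Dv x)" "p - 2" 2]
            by (simp add: d_def power2_norm_eq_inner[symmetric])
        qed (use p in \<open>simp add: d_def\<close>)
        have Ix: "I x = \<zeta> x * g * norm (Dv x) powr p + G (v x) * (p * \<eta> x powr (p - 1)) * (d \<bullet> grad \<eta> x)"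
          unfolding I_def D\<phi>_def d_def[symmetric] by (simp add: inner_add_right dd g_def \<eta>(4))
        have X: "\<zeta> x * norm (Dv x) powr p = X" using \<eta>(1)[of x] by (simp add: X_def \<eta>(3) powr_mult)
        have "\<bar>d \<bullet> grad \<eta> x\<bar> \<le> norm (Dv x) powr (p - 1) * n"
          using Cauchy_Schwarz_ineq2[of d "grad \<eta> x"] flux[of "Dv x"] by (simp add: d_def n_def)
        then have "G (v x) * (p * \<eta> x powr (p - 1)) * \<bar>d \<bullet> grad \<eta> x\<bar>
          \<le> (T * g) * (p * \<eta> x powr (p - 1)) * (norm (Dv x) powr (p - 1) * n)"
          using GT p T0 g by (intro mult_mono) auto
        also have "\<dots> = g * (p * (\<eta> x * norm (Dv x)) powr (p - 1) * (n * T))"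
          using \<eta>(1)[of x] by (simp add: powr_mult mult_ac)
        also have "\<dots> \<le> g * (e * X + C1 * Y x)"
          unfolding X_def Yx using g T0 n0 \<eta>(1)[of x] by (intro mult_left_mono C1) auto
        finally have "G (v x) * (p * \<eta> x powr (p - 1)) * \<bar>d \<bullet> grad \<eta> x\<bar> \<le> g * (e * X + C1 * Y x)" .
        moreover have "G (v x) * (p * \<eta> x powr (p - 1)) * (- \<bar>d \<bullet> grad \<eta> x\<bar>)
           \<le> G (v x) * (p * \<eta> x powr (p - 1)) * (d \<bullet> grad \<eta> x)"
          using GT(1) p by (intro mult_left_mono) auto
        ultimately have "- (g * (e * X + C1 * Y x)) \<le> G (v x) * (p * \<eta> x powr (p - 1)) * (d \<bullet> grad \<eta> x)"
          by linarith
        then show ?thesis unfolding Ix using X by (simp add: algebra_simps)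
      qed
      have "norm (Dw x) powr p \<le> g * ((1 + e) * X + C2 * Y x)" by (rule first)
      also have "\<dots> = \<mu> / l * (g * ((1 - e) * X - C1 * Y x)) + g * (C * Y x)"
        unfolding e(3) C_def q_def[symmetric] by (simp add: algebra_simps)
      also have "\<dots> \<le> \<mu> / l * I x + 1 * (C * Y x)"
        using second l g Y0 \<open>C > 0\<close> by (intro add_mono mult_left_mono mult_right_mono) auto
      finally show ?case by simp
    qed
    have "(LINT x|?M. norm (Dw x) powr p) \<le> (LINT x|?M. \<mu> / l * I x + C * Y x)"
      using Ii Yi LpD(2)[OF DwL] by (intro integral_mono_AE point) auto
    also have "\<dots> = \<mu> / l * integral\<^sup>L (?M) I + C * integral\<^sup>L (?M) Y"
      using Ii Yi by simp
    also have "\<dots> \<le> \<mu> / l * (l * (LINT x|?M. v x powr (p - 1) * (\<zeta> x * G (v x)))) + C * integral\<^sup>L (?M) Y"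
    proof (intro add_right_mono mult_left_mono)
      have "AE x in ?M. 0 \<le> \<zeta> x * G (v x)"
        using v0 by eventually_elim (use \<zeta>01 Gp in auto)
      then show "integral\<^sup>L (?M) I \<le> l * (LINT x|?M. v x powr (p - 1) * (\<zeta> x * G (v x)))"
        using sub \<phi>s unfolding subsolution_grad_def I_def by blast
    qed (use l in simp)
    finally show "(LINT x|?M. norm ((\<eta> x * deriv G (v x)) *\<^sub>R Dv x + G (v x) *\<^sub>R grad \<eta> x) powr p)
      \<le> \<mu> * (LINT x|?M. v x powr (p - 1) * (\<zeta> x * G (v x))) +
         C * (LINT x|?M. (norm (grad \<eta> x) * max 0 (v x - k)) powr p)"
      using l by (simp add: Dw_def Y_def)
  qed
qed

section \<open>De Giorgi iteration\<close>

text \<open>The energy of De Giorgi's iteration on exterior regions; for $k = 0$ it is the mass of $v^p$ outside a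
  ball, whose decay is to be shown.\<close>

definition tail_mass :: "real \<Rightarrow> 'a::euclidean_space set \<Rightarrow> ('a \<Rightarrow> real) \<Rightarrow> real \<Rightarrow> real \<Rightarrow> real" where
  "tail_mass p \<Omega> v r k = (LINT x|lebesgue_on \<Omega>. indicator {x. r \<le> norm x} x * max 0 (v x - k) powr p)"

lemma tail_mass_nonneg: "0 \<le> tail_mass p \<Omega> v r k"
  unfolding tail_mass_def by (intro integral_nonneg_AE) auto

lemma tail_integrable:
  assumes v: "v \<in> Lp p \<Omega>" and p: "p > 0" and k: "k \<ge> 0"
  shows "integrable (lebesgue_on \<Omega>) (\<lambda>x. indicator {x. r \<le> norm x} x * max 0 (v x - k) powr p)"
proof -
  note [measurable] = LpD(1)[OF v]
  have [measurable]: "indicator {x. r \<le> norm x} \<in> borel_measurable (lebesgue_on \<Omega>)"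
    by (intro borel_measurable_lebesgue_on borel_measurable_indicator borel_closed closed_Collect_le continuous_intros)
  show ?thesis
  proof (rule Bochner_Integration.integrable_bound[OF LpD(2)[OF v]])
    have "max 0 (v x - k) powr p \<le> \<bar>v x\<bar> powr p" for x
      using p k by (intro powr_mono2) auto
    then show "AE x in lebesgue_on \<Omega>. norm (indicator {x. r \<le> norm x} x * max 0 (v x - k) powr p) \<le> norm (norm (v x) powr p)"
      by (intro AE_I2) (auto simp: indicator_def)
  qed measurable
qed

lemma tail_mass_antimono:
  assumes v: "v \<in> Lp p \<Omega>" and p: "p > 0" and k: "0 \<le> k" "k \<le> k'" and r: "r \<le> r'"
  shows "tail_mass p \<Omega> v r' k' \<le> tail_mass p \<Omega> v r k"
  unfolding tail_mass_def
proof (rule integral_mono)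
  show "indicator {x. r' \<le> norm x} x * max 0 (v x - k') powr p \<le> indicator {x. r \<le> norm x} x * max 0 (v x - k) powr p" for x
    using p k r by (intro mult_mono powr_mono2) (auto simp: indicator_def)
qed (use tail_integrable[OF v p] k in auto)

text \<open>A cut-off between the radii and a truncation at the middle level $m = (k + k')/2$ are inserted into the
  Faber-Krahn and the Caccioppoli inequalities. The support of $\eta\, G(v)$ is contained in
  $\{v > m,\ |x| \ge r\}$, where $v - k$ exceeds half of $k' - k$; this bounds its measure by the mass
  at level $k$, and it bounds $v$ itself by a multiple of $v - k$.\<close>

lemma de_giorgi_step:
  fixes p l :: real
  assumes p: "p > 1" and l: "0 < l"
  shows "\<exists>K>0. \<forall>(\<Omega> :: 'a::euclidean_space set) v Dv r s k k'.
     open \<Omega> \<longrightarrow> subsolution_grad p \<Omega> l v Dv \<longrightarrow> r < s \<longrightarrow> 0 \<le> k \<longrightarrow> k < k' \<longrightarrow>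
     tail_mass p \<Omega> v s k' \<le> K * (k' / (k' - k) + 1 / (s - r)) powr p
        * (tail_mass p \<Omega> v r k / (k' - k) powr p) powr (p / DIM('a)) * tail_mass p \<Omega> v r k"
proof -
  obtain K1 where K1: "K1 > 0" and FK: "\<And>(\<Omega>::'a set) w Dw b. \<Omega> \<in> sets lebesgue \<Longrightarrow> sobolev0 p \<Omega> w Dw \<Longrightarrow>
     integrable (lebesgue_on \<Omega>) b \<Longrightarrow> (\<And>x. 0 \<le> b x) \<Longrightarrow> (\<And>x. w x \<noteq> 0 \<Longrightarrow> 1 \<le> b x) \<Longrightarrow>
     (LINT x|lebesgue_on \<Omega>. \<bar>w x\<bar> powr p) \<le> K1 * (LINT x|lebesgue_on \<Omega>. b x) powr (p / DIM('a))
        * (LINT x|lebesgue_on \<Omega>. norm (Dw x) powr p)"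
    using faber_krahn[OF p, where 'a='a] by blast
  \<comment> \<open>For boundedness any constant above l will do.\<close>
  define \<mu> where "\<mu> = 2 * l"
  have \<mu>: "l < \<mu>" "\<mu> > 0" using l by (auto simp: \<mu>_def)
  obtain C where C: "C > 0" and energy: "\<And>(\<Omega> :: 'a set) v Dv k G r s B \<eta> \<zeta>.
     open \<Omega> \<Longrightarrow> subsolution_grad p \<Omega> l v Dv \<Longrightarrow> 0 \<le> k \<Longrightarrow> truncation k G \<Longrightarrow> radial_cutoff p r s B \<eta> \<zeta> \<Longrightarrow>
     (LINT x|lebesgue_on \<Omega>. norm ((\<eta> x * deriv G (v x)) *\<^sub>R Dv x + G (v x) *\<^sub>R grad \<eta> x) powr p)
      \<le> \<mu> * (LINT x|lebesgue_on \<Omega>. v x powr (p - 1) * (\<zeta> x * G (v x))) +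
         C * (LINT x|lebesgue_on \<Omega>. (norm (grad \<eta> x) * max 0 (v x - k)) powr p)"
    using energy_estimate[OF p l \<mu>(1), where 'a='a] by blast
  obtain M where M: "M > 0" and cutoff: "\<And>r s. r < s \<Longrightarrow> \<exists>\<eta> \<zeta> :: 'a \<Rightarrow> real. radial_cutoff p r s (M / (s - r)) \<eta> \<zeta>"
    using exists_radial_cutoff[OF p, where 'a='a] by blast
  define \<delta> where "\<delta> = p / DIM('a)"
  define K where "K = K1 * (2 powr p) powr \<delta> * (\<mu> * 2 powr p + C * M powr p)"
  show ?thesis
  proof (intro exI[of _ K] conjI allI impI)
    show "K > 0" using K1 \<mu> C M by (auto simp: K_def intro!: mult_pos_pos add_pos_pos)
    fix \<Omega> :: "'a set" and v :: "'a \<Rightarrow> real" and Dv :: "'a \<Rightarrow> 'a" and r s k k' :: real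
    let ?M = "lebesgue_on \<Omega>"
    assume \<Omega>: "open \<Omega>" and sub: "subsolution_grad p \<Omega> l v Dv" and rs: "r < s" and k: "0 \<le> k" "k < k'"
    note v0 = subsolution_gradD(1)[OF sub] and sv = subsolution_gradD(2)[OF sub] and vL = subsolution_gradD(3)[OF sub]
    define d where "d = (k' - k) / 2"
    define m where "m = k + d"
    have d: "d > 0" "m \<ge> 0" "m + d = k'" "k \<le> m" using k by (auto simp: d_def m_def field_simps)
    obtain G where G: "truncation m G" "\<And>t. t \<le> m \<Longrightarrow> G t = 0" "\<And>t. t - k' \<le> G t"
      using exists_smooth_truncation[OF d(1,2)] d(3) by auto
    have Gb: "0 \<le> G t" "G t \<le> t" if "t \<ge> 0" for t
    proof -
      have "G t \<le> max 0 (t - m) * deriv G t" "0 \<le> G t" "deriv G t \<le> 1" using G(1) that by (auto simp: truncation_def)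
      moreover have "max 0 (t - m) * deriv G t \<le> max 0 (t - m) * 1"
        using \<open>deriv G t \<le> 1\<close> by (intro mult_left_mono) auto
      ultimately show "0 \<le> G t" "G t \<le> t" using that d(2) by (auto simp: max_def split: if_splits)
    qed
    obtain \<eta> \<zeta> :: "'a \<Rightarrow> real" where cut: "radial_cutoff p r s (M / (s - r)) \<eta> \<zeta>"
      using cutoff[OF rs] by blast
    have \<eta>: "0 \<le> \<eta> x" "\<eta> x \<le> 1" "\<zeta> x = \<eta> x powr p" "norm (grad \<eta> x) \<le> M / (s - r)"
      "norm x \<le> r \<Longrightarrow> \<eta> x = 0" "norm x \<le> r \<Longrightarrow> grad \<eta> x = 0" "s \<le> norm x \<Longrightarrow> \<eta> x = 1" for x
      using cut by (auto simp: radial_cutoff_def)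
    define w where "w = (\<lambda>x. \<eta> x * G (v x))"
    define Dw where "Dw = (\<lambda>x. (\<eta> x * deriv G (v x)) *\<^sub>R Dv x + G (v x) *\<^sub>R grad \<eta> x)"
    have w: "sobolev0 p \<Omega> w Dw" unfolding w_def Dw_def
      by (rule cutoff_truncation_sobolev0[OF sv p \<Omega> \<Omega> order_refl G(1) cut]) auto
    have wL: "w \<in> Lp p \<Omega>" using w by (auto simp: sobolev0_def sobolev_def)
    define a where "a = tail_mass p \<Omega> v r k"
    \<comment> \<open>Chebyshev: t / d powr p is at least 1 wherever w is nonzero.\<close>
    define t where "t = (\<lambda>x. indicator {x. r \<le> norm x} x * max 0 (v x - k) powr p)"
    have ti: "integrable (?M) t" unfolding t_def by (rule tail_integrable[OF vL _ k(1)]) (use p in simp)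
    have ta: "integral\<^sup>L (?M) t = a" by (simp add: t_def a_def tail_mass_def)
    have "tail_mass p \<Omega> v s k' \<le> (LINT x|?M. \<bar>w x\<bar> powr p)"
      unfolding tail_mass_def
    proof (rule integral_mono_AE)
      show "integrable (?M) (\<lambda>x. indicator {x. s \<le> norm x} x * max 0 (v x - k') powr p)"
        by (rule tail_integrable[OF vL]) (use p k in auto)
      show "integrable (?M) (\<lambda>x. \<bar>w x\<bar> powr p)" using LpD(2)[OF wL] by simp
      show "AE x in ?M. indicator {x. s \<le> norm x} x * max 0 (v x - k') powr p \<le> \<bar>w x\<bar> powr p"
        using v0
      proof eventually_elim
        case (elim x)
        have "max 0 (v x - k') powr p \<le> G (v x) powr p"
          using p G(3)[of "v x"] Gb(1)[OF elim] by (intro powr_mono2) auto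
        then show ?case using \<eta>(7)[of x] Gb(1)[OF elim] by (auto simp: indicator_def w_def)
      qed
    qed
    also have "\<dots> \<le> K1 * (LINT x|?M. t x / d powr p) powr \<delta> * (LINT x|?M. norm (Dw x) powr p)"
      unfolding \<delta>_def
    proof (rule FK[OF _ w])
      show "\<Omega> \<in> sets lebesgue" using \<Omega> by simp
      show "integrable (?M) (\<lambda>x. t x / d powr p)" using ti by simp
      show "0 \<le> t x / d powr p" for x by (simp add: t_def)
      fix x assume "w x \<noteq> 0"
      then have "\<not> norm x \<le> r" "\<not> v x \<le> m"
        using \<eta>(5)[of x] G(2)[of "v x"] by (auto simp: w_def)
      then have x: "r \<le> norm x" "m < v x" by auto
      then have "d powr p \<le> max 0 (v x - k) powr p"
        using p d by (intro powr_mono2) (auto simp: m_def)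
      then show "1 \<le> t x / d powr p" using x(1) d by (simp add: t_def)
    qed
    also have "(LINT x|?M. t x / d powr p) = a / d powr p" by (simp add: ta)
    also have "\<dots> = 2 powr p * (a / (k' - k) powr p)"
      using k by (simp add: d_def powr_divide)
    also have "K1 * (2 powr p * (a / (k' - k) powr p)) powr \<delta> * (LINT x|?M. norm (Dw x) powr p)
       \<le> K1 * (2 powr p * (a / (k' - k) powr p)) powr \<delta> * ((\<mu> * 2 powr p + C * M powr p) * (k' / (k' - k) + 1 / (s - r)) powr p * a)"
    proof (rule mult_left_mono)
      define q where "q = k' / (k' - k) + 1 / (s - r)"
      have q: "k' / (k' - k) \<le> q" "1 / (s - r) \<le> q" "0 \<le> k' / (k' - k)" "0 \<le> 1 / (s - r)" using k rs by (auto simp: q_def)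
      have i1: "(LINT x|?M. v x powr (p - 1) * (\<zeta> x * G (v x))) \<le> (LINT x|?M. (2 * q) powr p * t x)"
      proof (rule integral_mono')
        fix x
        show "v x powr (p - 1) * (\<zeta> x * G (v x)) \<le> (2 * q) powr p * t x"
        proof (cases "norm x \<le> r \<or> v x \<le> m")
          case True
          then have "\<zeta> x * G (v x) = 0" using \<eta>(3,5)[of x] G(2) by auto
          moreover have "0 \<le> (2 * q) powr p * t x" by (simp add: t_def)
          ultimately show ?thesis by (metis mult_zero_right)
        next
          case False
          then have x: "r \<le> norm x" "v x > m" by auto
          have vp: "v x > 0" using x d by simp
          have "\<zeta> x \<le> 1" "0 \<le> \<zeta> x" using \<eta>[of x] p by (auto simp: powr_le1)
          then have "\<zeta> x * G (v x) \<le> 1 * v x" using Gb[of "v x"] vp by (intro mult_mono) auto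
          then have "v x powr (p - 1) * (\<zeta> x * G (v x)) \<le> v x powr (p - 1) * v x"
            by (intro mult_left_mono) auto
          also have "\<dots> = v x powr p" using vp by (simp add: powr_minus_1_mult)
          also have "\<dots> \<le> (2 * q * (v x - k)) powr p"
          proof (rule powr_mono2)
            have dx: "d \<le> v x - k" using x by (simp add: m_def)
            then have "k * d \<le> k * (v x - k)" using k by (intro mult_left_mono) auto
            then have "v x * d \<le> (d + k) * (v x - k)" by (simp add: algebra_simps)
            also have "\<dots> \<le> k' * (v x - k)" using dx d by (intro mult_right_mono) (auto simp: m_def)
            finally have "v x \<le> k' / d * (v x - k)" using d by (simp add: field_simps)
            also have "k' / d = 2 * (k' / (k' - k))" using k by (simp add: d_def field_simps)
            also have "2 * (k' / (k' - k)) * (v x - k) \<le> 2 * q * (v x - k)"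
              using q dx d by (intro mult_right_mono mult_left_mono) auto
            finally show "v x \<le> 2 * q * (v x - k)" .
          qed (use p vp in auto)
          also have "\<dots> = (2 * q) powr p * (v x - k) powr p"
            by (rule powr_mult)
          also have "\<dots> = (2 * q) powr p * t x" using x d by (simp add: t_def m_def max_def)
          finally show ?thesis .
        qed
      qed (use ti in \<open>auto simp: t_def\<close>)
      have i2: "(LINT x|?M. (norm (grad \<eta> x) * max 0 (v x - m)) powr p) \<le> (LINT x|?M. (M * q) powr p * t x)"
      proof (rule integral_mono')
        fix x
        show "(norm (grad \<eta> x) * max 0 (v x - m)) powr p \<le> (M * q) powr p * t x"
        proof (cases "norm x \<le> r")
          case True
          then show ?thesis using \<eta>(6)[of x] by (simp add: t_def)
        next
          case False
          have "norm (grad \<eta> x) \<le> M * q" using \<eta>(4)[of x] mult_left_mono[OF q(2), of M] M by simp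
          moreover have "0 \<le> M * q" using M q(2,4) by (intro mult_nonneg_nonneg) linarith+
          ultimately have "(norm (grad \<eta> x) * max 0 (v x - m)) powr p \<le> (M * q * max 0 (v x - k)) powr p"
            using p d by (intro powr_mono2 mult_mono) auto
          also have "\<dots> = (M * q) powr p * max 0 (v x - k) powr p" by (rule powr_mult)
          finally show ?thesis using False by (simp add: t_def)
        qed
      qed (use ti in \<open>auto simp: t_def\<close>)
      have "(LINT x|?M. norm (Dw x) powr p) \<le>
        \<mu> * (LINT x|?M. v x powr (p - 1) * (\<zeta> x * G (v x))) +
         C * (LINT x|?M. (norm (grad \<eta> x) * max 0 (v x - m)) powr p)"
        unfolding Dw_def by (rule energy[OF \<Omega> sub d(2) G(1) cut])
      also have "\<dots> \<le> \<mu> * ((2 * q) powr p * a) + C * ((M * q) powr p * a)"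
        using i1 i2 \<mu> C by (intro add_mono mult_left_mono) (simp_all add: ta)
      also have "\<dots> = (\<mu> * 2 powr p + C * M powr p) * q powr p * a"
        by (simp add: powr_mult algebra_simps)
      finally show "(LINT x|?M. norm (Dw x) powr p) \<le> (\<mu> * 2 powr p + C * M powr p) * (k' / (k' - k) + 1 / (s - r)) powr p * a"
        by (simp add: q_def)
    qed (use K1 in simp)
    also have "\<dots> = K * (k' / (k' - k) + 1 / (s - r)) powr p * (a / (k' - k) powr p) powr \<delta> * a"
      by (simp only: K_def powr_mult mult_ac)
    finally show "tail_mass p \<Omega> v s k' \<le> K * (k' / (k' - k) + 1 / (s - r)) powr p
        * (tail_mass p \<Omega> v r k / (k' - k) powr p) powr (p / DIM('a)) * tail_mass p \<Omega> v r k"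
      by (simp add: a_def \<delta>_def)
  qed
qed

text \<open>The superlinear power beats the geometric growth of the constant if the start is small: inductively
  $b_j \le b_0\, q^j$ with $q = \beta^{-1/\delta}$, because $\beta^j (q^j)^\delta = 1$.\<close>

lemma fast_geometric_convergence:
  fixes b :: "nat \<Rightarrow> real"
  assumes b: "\<And>j. 0 \<le> b j" "\<And>j. b (Suc j) \<le> K * \<beta> ^ j * b j powr \<delta> * b j"
    and K: "K > 0" "\<beta> > 1" "\<delta> > 0" and start: "K * b 0 powr \<delta> \<le> \<beta> powr (- 1 / \<delta>)"
  shows "b \<longlonglongrightarrow> 0"
proof -
  define q where "q = \<beta> powr (- 1 / \<delta>)"
  have q: "0 < q" "q < 1" using K powr_less_mono[of "- 1 / \<delta>" 0 \<beta>] by (auto simp: q_def)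
  have q\<delta>: "(q ^ j) powr \<delta> = inverse (\<beta> ^ j)" for j
  proof -
    have "(q ^ j) powr \<delta> = \<beta> powr (- 1 / \<delta> * real j * \<delta>)"
      using q K by (simp add: q_def powr_powr flip: powr_realpow)
    also have "- 1 / \<delta> * real j * \<delta> = - real j" using K by simp
    finally show ?thesis using K by (simp add: powr_minus powr_realpow)
  qed
  have le: "b j \<le> b 0 * q ^ j" for j
  proof (induction j)
    case (Suc j)
    have "b j powr \<delta> \<le> (b 0 * q ^ j) powr \<delta>" using Suc b K by (intro powr_mono2) auto
    also have "\<dots> = b 0 powr \<delta> * inverse (\<beta> ^ j)" by (simp add: powr_mult q\<delta>)
    finally have "K * \<beta> ^ j * b j powr \<delta> \<le> K * \<beta> ^ j * (b 0 powr \<delta> * inverse (\<beta> ^ j))"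
      using K by (intro mult_left_mono) auto
    also have "\<dots> = K * b 0 powr \<delta>" using K by simp
    also have "\<dots> \<le> q" using start by (simp add: q_def)
    finally have "K * \<beta> ^ j * b j powr \<delta> * b j \<le> q * (b 0 * q ^ j)"
      using Suc b q by (intro mult_mono) auto
    then show ?case using b(2)[of j] by (simp add: mult_ac)
  qed simp
  have "(\<lambda>j. b 0 * q ^ j) \<longlonglongrightarrow> b 0 * 0"
    using q by (intro tendsto_mult tendsto_const LIMSEQ_realpow_zero) auto
  then show ?thesis
    by (intro tendsto_sandwich[of "\<lambda>_. 0" b sequentially "\<lambda>j. b 0 * q ^ j"]) (auto simp: b(1) le)
qed

text \<open>The radii $R + 1 - 2^{-j}$ and the levels $k (1 - 2^{-j})$ increase to $R + 1$ and $k$. If the mass at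
  the start is at most $\theta k^p$, the masses tend to zero, so that $v \le k$ beyond radius $R + 1$.\<close>

lemma subsolution_locally_bounded:
  fixes p l :: real
  assumes p: "p > 1" and l: "0 < l"
  shows "\<exists>K>0. \<forall>(\<Omega> :: 'a::euclidean_space set) v Dv R. open \<Omega> \<longrightarrow> subsolution_grad p \<Omega> l v Dv \<longrightarrow>
     (AE x in lebesgue_on \<Omega>. R + 1 \<le> norm x \<longrightarrow> v x powr p \<le> K * tail_mass p \<Omega> v R 0)"
proof -
  define \<delta> where "\<delta> = p / DIM('a)"
  have \<delta>: "\<delta> > 0" using p by (simp add: \<delta>_def)
  obtain K where K: "K > 0" and step: "\<And>(\<Omega> :: 'a set) v Dv r s k k'.
     open \<Omega> \<Longrightarrow> subsolution_grad p \<Omega> l v Dv \<Longrightarrow> r < s \<Longrightarrow> 0 \<le> k \<Longrightarrow> k < k' \<Longrightarrow>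
     tail_mass p \<Omega> v s k' \<le> K * (k' / (k' - k) + 1 / (s - r)) powr p
        * (tail_mass p \<Omega> v r k / (k' - k) powr p) powr \<delta> * tail_mass p \<Omega> v r k"
    using de_giorgi_step[OF p l, where 'a='a] unfolding \<delta>_def by blast
  define K' where "K' = K * 4 powr p * 2 powr (p * \<delta>)"
  define \<beta> where "\<beta> = 2 powr (p + p * \<delta>)"
  have K': "K' > 0" using K by (simp add: K'_def)
  have \<beta>: "\<beta> > 1" using p \<delta> powr_less_mono[of 0 "p + p * \<delta>" 2] by (simp add: \<beta>_def add_pos_pos)
  \<comment> \<open>The largest start for which the fast geometric convergence applies.\<close>
  define \<theta> where "\<theta> = (\<beta> powr (- 1 / \<delta>) / K') powr (1 / \<delta>)"
  have \<theta>: "\<theta> > 0" using \<beta> K' by (simp add: \<theta>_def)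
  have \<theta>\<delta>: "K' * \<theta> powr \<delta> = \<beta> powr (- 1 / \<delta>)" using \<beta> K' \<delta> by (simp add: \<theta>_def powr_powr)
  show ?thesis
  proof (intro exI[of _ "1 / \<theta>"] conjI allI impI)
    show "0 < 1 / \<theta>" using \<theta> by simp
    fix \<Omega> :: "'a set" and v :: "'a \<Rightarrow> real" and Dv :: "'a \<Rightarrow> 'a" and R :: real
    let ?M = "lebesgue_on \<Omega>"
    assume \<Omega>: "open \<Omega>" and sub: "subsolution_grad p \<Omega> l v Dv"
    note v0 = subsolution_gradD(1)[OF sub] and sv = subsolution_gradD(2)[OF sub] and vL = subsolution_gradD(3)[OF sub]
    define a where "a = tail_mass p \<Omega> v R 0"
    have a0: "a \<ge> 0" unfolding a_def by (rule tail_mass_nonneg)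
    have bound: "AE x in ?M. R + 1 \<le> norm x \<longrightarrow> v x \<le> k" if k: "k > 0" "a \<le> \<theta> * k powr p" for k
    proof -
      define rj kj where "rj j = R + 1 - (1/2) ^ j" and "kj j = k * (1 - (1/2) ^ j)" for j :: nat
      define b where "b j = tail_mass p \<Omega> v (rj j) (kj j) / k powr p" for j
      let ?t = "\<lambda>j. tail_mass p \<Omega> v (rj j) (kj j)"
      have kj0: "0 \<le> kj j" for j using k by (simp add: kj_def power_le_one)
      have dk: "kj (Suc j) - kj j = k * (1/2) ^ Suc j" "rj (Suc j) - rj j = (1/2) ^ Suc j" for j
        by (simp_all add: kj_def rj_def algebra_simps)
      have b0: "0 \<le> b j" for j unfolding b_def by (intro divide_nonneg_nonneg tail_mass_nonneg) auto
      have b_step: "b (Suc j) \<le> K' * \<beta> ^ j * b j powr \<delta> * b j" for j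
      proof -
        have pos: "0 < k * (1/2) ^ Suc j" "0 < (1/2::real) ^ Suc j" using k by auto
        have "?t (Suc j) \<le> K * (kj (Suc j) / (k * (1/2) ^ Suc j) + 1 / (1/2) ^ Suc j) powr p
          * (?t j / (k * (1/2) ^ Suc j) powr p) powr \<delta> * ?t j"
          using step[OF \<Omega> sub, of "rj j" "rj (Suc j)" "kj j" "kj (Suc j)"] kj0[of j] dk[of j] pos by simp
        also have "\<dots> \<le> K * (2 ^ (j + 2)) powr p * (?t j / (k * (1/2) ^ Suc j) powr p) powr \<delta> * ?t j"
        proof (intro mult_right_mono mult_left_mono powr_mono2)
          have "kj (Suc j) / (k * (1/2) ^ Suc j) \<le> 2 ^ Suc j"
            using k by (simp add: kj_def field_simps power_one_over)
          then show "kj (Suc j) / (k * (1/2) ^ Suc j) + 1 / (1/2) ^ Suc j \<le> 2 ^ (j + 2)"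
            by (simp add: power_one_over)
          show "0 \<le> kj (Suc j) / (k * (1/2) ^ Suc j) + 1 / (1/2) ^ Suc j"
            using kj0[of "Suc j"] k by (intro add_nonneg_nonneg divide_nonneg_nonneg) auto
        qed (use K p tail_mass_nonneg in auto)
        finally have "b (Suc j) \<le> K * (2 ^ (j + 2)) powr p * (?t j / (k * (1/2) ^ Suc j) powr p) powr \<delta> * b j"
          using k by (simp add: b_def divide_right_mono)
        also have "?t j / (k * (1/2) ^ Suc j) powr p = b j * (2 ^ Suc j) powr p"
        proof -
          have "(k * (1/2) ^ Suc j) powr p = k powr p / (2 ^ Suc j) powr p"
            by (simp only: power_one_over powr_mult powr_divide) simp
          then show ?thesis by (simp add: b_def)
        qed
        also have "K * (2 ^ (j + 2)) powr p * (b j * (2 ^ Suc j) powr p) powr \<delta> * b j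
           = K * ((2 ^ (j + 2)) powr p * ((2 ^ Suc j) powr p) powr \<delta>) * b j powr \<delta> * b j"
          by (simp only: powr_mult mult_ac)
        also have "(2 ^ (j + 2)) powr p * ((2 ^ Suc j) powr p) powr \<delta> = 4 powr p * 2 powr (p * \<delta>) * \<beta> ^ j"
        proof -
          have two: "(2 ^ n) powr c = 2 powr (n * c)" for n :: nat and c :: real
            by (simp add: powr_powr flip: powr_realpow)
          have "\<beta> ^ j = 2 powr ((p + p * \<delta>) * j)"
            by (simp add: \<beta>_def powr_powr flip: powr_realpow)
          moreover have "(4::real) powr p = 2 powr (2 * p)" using two[of 2 p] by simp
          ultimately show ?thesis
            unfolding two powr_powr by (simp add: algebra_simps flip: powr_add)
        qed
        finally show ?thesis by (simp add: K'_def mult_ac)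
      qed
      have "b 0 \<le> \<theta>" using k by (simp add: b_def rj_def kj_def a_def[symmetric] field_simps)
      then have "K' * b 0 powr \<delta> \<le> K' * \<theta> powr \<delta>" using K' b0 \<delta> by (intro mult_left_mono powr_mono2) auto
      then have lim: "b \<longlonglongrightarrow> 0"
        by (intro fast_geometric_convergence[OF b0 b_step K' \<beta> \<delta>]) (simp add: \<theta>\<delta>)
      have "tail_mass p \<Omega> v (R + 1) k / k powr p \<le> b j" for j
        unfolding b_def using k kj0 p
        by (intro divide_right_mono tail_mass_antimono[OF vL]) (auto simp: kj_def rj_def)
      then have "tail_mass p \<Omega> v (R + 1) k / k powr p \<le> 0"
        by (intro LIMSEQ_le_const[OF lim]) auto
      then have "tail_mass p \<Omega> v (R + 1) k = 0"
        using k tail_mass_nonneg[of p \<Omega> v "R + 1" k] by (simp add: divide_le_0_iff)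
      then have "AE x in ?M. indicator {x. R + 1 \<le> norm x} x * max 0 (v x - k) powr p = 0"
        unfolding tail_mass_def
        by (subst (asm) integral_nonneg_eq_0_iff_AE) (use tail_integrable[OF vL] p k in auto)
      then show ?thesis
        by eventually_elim (auto simp: indicator_def max_def split: if_splits)
    qed
    \<comment> \<open>The level a / \<theta> itself may be zero, so it is approached from above by positive levels.\<close>
    have "AE x in ?M. \<forall>n::nat. R + 1 \<le> norm x \<longrightarrow> v x \<le> (a / \<theta> + inverse (Suc n)) powr (1 / p)"
    proof (subst AE_all_countable, rule allI, rule bound)
      fix n :: nat
      have pos: "0 < a / \<theta> + inverse (Suc n)" using a0 \<theta> by (intro add_nonneg_pos) auto
      then show "0 < (a / \<theta> + inverse (Suc n)) powr (1 / p)" by simp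
      have "\<theta> * ((a / \<theta> + inverse (Suc n)) powr (1 / p)) powr p = a + \<theta> * inverse (Suc n)"
        using pos p \<theta> by (simp add: powr_powr distrib_left del: of_nat_Suc)
      then show "a \<le> \<theta> * ((a / \<theta> + inverse (Suc n)) powr (1 / p)) powr p" using \<theta> by simp
    qed
    then show "AE x in ?M. R + 1 \<le> norm x \<longrightarrow> v x powr p \<le> 1 / \<theta> * tail_mass p \<Omega> v R 0"
      using v0
    proof eventually_elim
      case (elim x)
      show ?case
      proof
        assume "R + 1 \<le> norm x"
        have "v x powr p \<le> a / \<theta> + inverse (Suc n)" for n :: nat
        proof -
          have pos: "0 < a / \<theta> + inverse (Suc n)" using a0 \<theta> by (intro add_nonneg_pos) auto
          have "v x powr p \<le> ((a / \<theta> + inverse (Suc n)) powr (1 / p)) powr p"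
            using elim \<open>R + 1 \<le> norm x\<close> p by (intro powr_mono2) auto
          then show ?thesis using pos p by (simp add: powr_powr)
        qed
        moreover have "(\<lambda>n. a / \<theta> + inverse (real (Suc n))) \<longlonglongrightarrow> a / \<theta> + 0"
          by (intro tendsto_add tendsto_const LIMSEQ_inverse_real_of_nat)
        ultimately have "v x powr p \<le> a / \<theta> + 0" by (intro LIMSEQ_le_const) auto
        then show "v x powr p \<le> 1 / \<theta> * tail_mass p \<Omega> v R 0" by (simp add: a_def)
      qed
    qed
  qed
qed

section \<open>Exponential decay\<close>

text \<open>With $G$ the identity, $\eta v$ is admissible for the first eigenvalue of the exterior domain, and the
  term with $\mu$ is absorbed on the left. Only the annulus where $\nabla\eta$ lives remains on the
  right, and its mass is a difference of two tail masses. The constant depends on $\mu$ and not on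
  $L$.\<close>

lemma hole_filling:
  fixes p l \<mu> :: real
  assumes p: "p > 1" and l: "0 < l" "l < \<mu>"
  shows "\<exists>C>0. \<forall>(\<Omega> :: 'a::euclidean_space set) v Dv R L r. open \<Omega> \<longrightarrow> subsolution_grad p \<Omega> l v Dv \<longrightarrow>
     0 < R \<longrightarrow> R < r \<longrightarrow> \<mu> < L \<longrightarrow> ereal L \<le> lambda1 p (\<Omega> - closure (ball 0 R)) \<longrightarrow>
     (L - \<mu>) * tail_mass p \<Omega> v (r + 1) 0 \<le> C * (tail_mass p \<Omega> v r 0 - tail_mass p \<Omega> v (r + 1) 0)"
proof -
  obtain C where C: "C > 0" and energy: "\<And>(\<Omega> :: 'a set) v Dv k G r s B \<eta> \<zeta>.
     open \<Omega> \<Longrightarrow> subsolution_grad p \<Omega> l v Dv \<Longrightarrow> 0 \<le> k \<Longrightarrow> truncation k G \<Longrightarrow> radial_cutoff p r s B \<eta> \<zeta> \<Longrightarrow>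
     (LINT x|lebesgue_on \<Omega>. norm ((\<eta> x * deriv G (v x)) *\<^sub>R Dv x + G (v x) *\<^sub>R grad \<eta> x) powr p)
      \<le> \<mu> * (LINT x|lebesgue_on \<Omega>. v x powr (p - 1) * (\<zeta> x * G (v x))) +
         C * (LINT x|lebesgue_on \<Omega>. (norm (grad \<eta> x) * max 0 (v x - k)) powr p)"
    using energy_estimate[OF p l, where 'a='a] by blast
  obtain M where M: "M > 0" and cutoff: "\<And>r s. r < s \<Longrightarrow> \<exists>\<eta> \<zeta> :: 'a \<Rightarrow> real. radial_cutoff p r s (M / (s - r)) \<eta> \<zeta>"
    using exists_radial_cutoff[OF p, where 'a='a] by blast
  show ?thesis
  proof (intro exI[of _ "C * M powr p"] conjI allI impI)
    show "0 < C * M powr p" using C M by simp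
    fix \<Omega> :: "'a set" and v :: "'a \<Rightarrow> real" and Dv :: "'a \<Rightarrow> 'a" and R L r :: real
    let ?M = "lebesgue_on \<Omega>"
    assume \<Omega>: "open \<Omega>" and sub: "subsolution_grad p \<Omega> l v Dv" and R: "0 < R" "R < r"
      and L: "\<mu> < L" "ereal L \<le> lambda1 p (\<Omega> - closure (ball 0 R))"
    note v0 = subsolution_gradD(1)[OF sub] and sv = subsolution_gradD(2)[OF sub] and vL = subsolution_gradD(3)[OF sub]
    define \<Omega>' where "\<Omega>' = \<Omega> - closure (ball 0 R)"
    have \<Omega>': "open \<Omega>'" "\<Omega>' \<subseteq> \<Omega>" "\<Omega>' = \<Omega> - cball 0 R" using \<Omega> R by (auto simp: \<Omega>'_def)
    obtain \<eta> \<zeta> :: "'a \<Rightarrow> real" where cut: "radial_cutoff p r (r + 1) (M / (r + 1 - r)) \<eta> \<zeta>"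
      using cutoff[of r "r + 1"] by auto
    have \<eta>: "0 \<le> \<eta> x" "\<eta> x \<le> 1" "\<zeta> x = \<eta> x powr p" "norm (grad \<eta> x) \<le> M"
      "norm x \<le> r \<Longrightarrow> \<eta> x = 0" "norm x \<le> r \<Longrightarrow> grad \<eta> x = 0" "r + 1 \<le> norm x \<Longrightarrow> \<eta> x = 1"
      "r + 1 \<le> norm x \<Longrightarrow> grad \<eta> x = 0" for x
      using cut by (auto simp: radial_cutoff_def)
    have "closure {x. \<eta> x \<noteq> 0} \<subseteq> {x. r \<le> norm x}"
    proof (rule closure_minimal)
      show "{x. \<eta> x \<noteq> 0} \<subseteq> {x. r \<le> norm x}" using \<eta>(5) by force
      show "closed {x::'a. r \<le> norm x}" by (intro closed_Collect_le continuous_intros)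
    qed
    then have supp: "closure {x. \<eta> x \<noteq> 0} \<inter> \<Omega> \<subseteq> \<Omega>'" using R \<Omega>'(3) by auto
    define w where "w = (\<lambda>x. \<eta> x * v x)"
    define Dw where "Dw = (\<lambda>x. (\<eta> x * deriv (\<lambda>t. t) (v x)) *\<^sub>R Dv x + v x *\<^sub>R grad \<eta> x)"
    have w: "sobolev0 p \<Omega>'' w Dw" if "open \<Omega>''" "\<Omega>'' \<subseteq> \<Omega>" "\<Omega>' \<subseteq> \<Omega>''" for \<Omega>'' unfolding w_def Dw_def
      by (rule cutoff_truncation_sobolev0[OF sv p \<Omega> that(1,2) truncation_id cut]) (use supp that in auto)
    have wL: "w \<in> Lp p \<Omega>" "Dw \<in> Lp p \<Omega>"
      using w[OF \<Omega> order_refl \<Omega>'(2)] by (auto simp: sobolev0_def sobolev_def)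
    have sets: "\<Omega> \<in> sets lebesgue" "\<Omega>' \<in> sets lebesgue" using \<Omega> \<Omega>' by auto
    define W where "W = (LINT x|?M. \<bar>w x\<bar> powr p)"
    define a where "a r = tail_mass p \<Omega> v r 0" for r
    have ti: "integrable (?M) (\<lambda>x. indicator {x. r \<le> norm x} x * max 0 (v x - 0) powr p)" for r
      by (rule tail_integrable[OF vL]) (use p in auto)
    have "(LINT x|lebesgue_on \<Omega>'. \<bar>w x\<bar> powr p) = (LINT x|?M. indicator \<Omega>' x *\<^sub>R \<bar>w x\<bar> powr p)"
      unfolding lebesgue_on_subset[OF \<Omega>'(2) sets]
      by (rule integral_restrict_space[OF sets_lebesgue_on_subset[OF \<Omega>'(2) sets]])
    also have "\<dots> = W"
      unfolding W_def
    proof (rule Bochner_Integration.integral_cong[OF refl])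
      fix x assume "x \<in> space (?M)"
      then show "indicator \<Omega>' x *\<^sub>R \<bar>w x\<bar> powr p = \<bar>w x\<bar> powr p"
        using \<eta>(5)[of x] R p \<Omega>'(3) by (cases "norm x \<le> r") (auto simp: w_def indicator_def)
    qed
    finally have "L * W \<le> (LINT x|lebesgue_on \<Omega>'. norm (Dw x) powr p)"
      using lambda1_le[OF L(2)[folded \<Omega>'_def] w[OF \<Omega>'(1,2) order_refl] p \<Omega>'(1)] by simp
    also have "\<dots> \<le> (LINT x|?M. norm (Dw x) powr p)"
      by (rule integral_lebesgue_on_subset[OF \<Omega>'(2) sets LpD(2)[OF wL(2)]]) simp
    also have "\<dots> \<le> \<mu> * (LINT x|?M. v x powr (p - 1) * (\<zeta> x * v x)) +
         C * (LINT x|?M. (norm (grad \<eta> x) * max 0 (v x - 0)) powr p)"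
      unfolding Dw_def by (rule energy[OF \<Omega> sub order_refl truncation_id cut])
    also have "(LINT x|?M. v x powr (p - 1) * (\<zeta> x * v x)) \<le> W"
      unfolding W_def
    proof (rule integral_mono_AE')
      show "AE x in ?M. v x powr (p - 1) * (\<zeta> x * v x) \<le> \<bar>w x\<bar> powr p"
        using v0
      proof eventually_elim
        case (elim x)
        then have "v x powr (p - 1) * v x = v x powr p" by (rule powr_minus_1_mult)
        moreover have "v x powr (p - 1) * (\<zeta> x * v x) = \<zeta> x * (v x powr (p - 1) * v x)" by (simp only: mult_ac)
        ultimately have "v x powr (p - 1) * (\<zeta> x * v x) = \<eta> x powr p * v x powr p" by (simp add: \<eta>(3))
        then show ?case using elim \<eta>(1)[of x] by (simp add: w_def abs_mult powr_mult)
      qed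
    qed (use LpD(2)[OF wL(1)] in auto)
    also have "(LINT x|?M. (norm (grad \<eta> x) * max 0 (v x - 0)) powr p) \<le> M powr p * (a r - a (r + 1))"
    proof -
      let ?t = "\<lambda>r x. indicator {x. r \<le> norm x} x * max 0 (v x - 0) powr p"
      have "(LINT x|?M. (norm (grad \<eta> x) * max 0 (v x - 0)) powr p) \<le> (LINT x|?M. M powr p * (?t r x - ?t (r + 1) x))"
      proof (rule integral_mono')
        fix x
        show "(norm (grad \<eta> x) * max 0 (v x - 0)) powr p \<le> M powr p * (?t r x - ?t (r + 1) x)"
        proof (cases "norm x \<le> r \<or> r + 1 \<le> norm x")
          case True
          then have "grad \<eta> x = 0" using \<eta>(6,8) by blast
          then show ?thesis by (auto simp: indicator_def)
        next
          case False
          have "(norm (grad \<eta> x) * max 0 (v x)) powr p \<le> (M * max 0 (v x)) powr p"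
            using p \<eta>(4)[of x] by (intro powr_mono2 mult_right_mono) auto
          also have "\<dots> = M powr p * max 0 (v x) powr p" by (rule powr_mult)
          finally show ?thesis using False by simp
        qed
        then show "0 \<le> M powr p * (?t r x - ?t (r + 1) x)"
          by (rule order_trans[rotated]) simp
      qed (use ti in auto)
      also have "\<dots> = M powr p * (a r - a (r + 1))"
        using ti[of r] ti[of "r + 1"] by (simp add: a_def tail_mass_def)
      finally show ?thesis .
    qed
    finally have main: "L * W \<le> \<mu> * W + C * (M powr p * (a r - a (r + 1)))"
      using l C by simp
    have "a (r + 1) \<le> W"
      unfolding a_def W_def tail_mass_def
    proof (rule integral_mono)
      show "indicator {x. r + 1 \<le> norm x} x * max 0 (v x - 0) powr p \<le> \<bar>w x\<bar> powr p" for x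
        using \<eta>(7)[of x] p by (auto simp: indicator_def w_def intro!: powr_mono2)
    qed (use ti LpD(2)[OF wL(1)] in auto)
    then have "(L - \<mu>) * a (r + 1) \<le> (L - \<mu>) * W" using L by (intro mult_left_mono) auto
    then show "(L - \<mu>) * tail_mass p \<Omega> v (r + 1) 0 \<le> C * M powr p * (tail_mass p \<Omega> v r 0 - tail_mass p \<Omega> v (r + 1) 0)"
      using main by (simp add: a_def algebra_simps)
  qed
qed

text \<open>The local bound converts decay of the mass into pointwise decay. Beyond radius $R + 1$ it is applied
  with an integer $n$ such that $|x|$ lies between $R + n + 1$ and $R + n + 2$; close to the origin it is
  applied with radius $-1$.\<close>

lemma geometric_tail_decay:
  fixes p l R \<alpha> :: real
  assumes p: "p > 1" and l: "0 < l" and R: "R \<ge> 0" and \<alpha>: "\<alpha> > 0" and \<Omega>: "open (\<Omega> :: 'a::euclidean_space set)"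
    and decay: "\<And>v Dv r. subsolution_grad p \<Omega> l v Dv \<Longrightarrow> R \<le> r \<Longrightarrow>
      tail_mass p \<Omega> v (r + 1) 0 \<le> exp (- \<alpha> * p) * tail_mass p \<Omega> v r 0"
  shows "\<exists>C>0. \<forall>v. nonneg_subsolution p \<Omega> l v \<longrightarrow> exp_decay_bound p \<Omega> C \<alpha> v"
proof -
  obtain K where K: "K > 0" and sup: "\<And>(\<Omega> :: 'a set) v Dv R. open \<Omega> \<Longrightarrow> subsolution_grad p \<Omega> l v Dv \<Longrightarrow>
     AE x in lebesgue_on \<Omega>. R + 1 \<le> norm x \<longrightarrow> v x powr p \<le> K * tail_mass p \<Omega> v R 0"
    using subsolution_locally_bounded[OF p l, where 'a='a] by blast
  let ?M = "lebesgue_on \<Omega>"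
  show ?thesis
  proof (intro exI[of _ "K powr (1 / p) * exp (\<alpha> * (R + 2))"] conjI allI impI)
    show "0 < K powr (1 / p) * exp (\<alpha> * (R + 2))" using K by simp
    fix v assume "nonneg_subsolution p \<Omega> l v"
    then obtain Dv where sub: "subsolution_grad p \<Omega> l v Dv" by (auto simp: nonneg_subsolution_iff)
    note v0 = subsolution_gradD(1)[OF sub] and sv = subsolution_gradD(2)[OF sub] and vL = subsolution_gradD(3)[OF sub]
    define I where "I = (LINT x|?M. norm (v x) powr p)"
    have tailI: "tail_mass p \<Omega> v r 0 \<le> I" for r
      unfolding tail_mass_def I_def
    proof (rule integral_mono')
      show "indicator {x. r \<le> norm x} x * max 0 (v x - 0) powr p \<le> norm (v x) powr p" for x
        using p by (auto simp: indicator_def intro!: powr_mono2)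
    qed (use LpD(2)[OF vL] in auto)
    have tail: "tail_mass p \<Omega> v (R + real n) 0 \<le> exp (- \<alpha> * p * n) * I" for n
    proof (induction n)
      case 0
      then show ?case using tailI[of R] by simp
    next
      case (Suc n)
      have "tail_mass p \<Omega> v (R + real n + 1) 0 \<le> exp (- \<alpha> * p) * tail_mass p \<Omega> v (R + real n) 0"
        by (rule decay[OF sub]) simp
      also have "\<dots> \<le> exp (- \<alpha> * p) * (exp (- \<alpha> * p * n) * I)"
        by (intro mult_left_mono Suc) simp
      also have "\<dots> = exp (- \<alpha> * p * Suc n) * I" by (simp add: algebra_simps flip: exp_add)
      finally show ?case by (simp add: algebra_simps)
    qed
    have "AE x in ?M. \<forall>n::nat. R + real n + 1 \<le> norm x \<longrightarrow> v x powr p \<le> K * tail_mass p \<Omega> v (R + real n) 0"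
      unfolding AE_all_countable using sup[OF \<Omega> sub] by blast
    moreover have "AE x in ?M. -1 + 1 \<le> norm x \<longrightarrow> v x powr p \<le> K * tail_mass p \<Omega> v (-1) 0"
      by (rule sup[OF \<Omega> sub])
    ultimately have "AE x in ?M. 0 \<le> v x \<and> v x \<le> K powr (1 / p) * exp (\<alpha> * (R + 2)) * Lp_norm p \<Omega> v * exp (- \<alpha> * norm x)"
      using v0
    proof eventually_elim
      case (elim x)
      have "\<exists>n::nat. v x powr p \<le> K * (exp (- \<alpha> * p * n) * I) \<and> norm x - R - 2 \<le> n"
      proof (cases "norm x < R + 1")
        case True
        have "v x powr p \<le> K * tail_mass p \<Omega> v (-1) 0" using elim(2) by simp
        also have "\<dots> \<le> K * I" using K by (intro mult_left_mono tailI) auto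
        finally show ?thesis using True by (intro exI[of _ 0]) auto
      next
        case False
        define n where "n = nat \<lfloor>norm x - R - 1\<rfloor>"
        have n: "R + real n + 1 \<le> norm x" "norm x - R - 2 \<le> n" using False unfolding n_def by linarith+
        then have "v x powr p \<le> K * tail_mass p \<Omega> v (R + real n) 0" using elim(1) by blast
        also have "\<dots> \<le> K * (exp (- \<alpha> * p * n) * I)" using K by (intro mult_left_mono tail) auto
        finally show ?thesis using n by blast
      qed
      then obtain n :: nat where n: "v x powr p \<le> K * (exp (- \<alpha> * p * n) * I)" "norm x - R - 2 \<le> n" by blast
      have "v x = (v x powr p) powr (1 / p)" using elim p by (simp add: powr_powr)
      also have "\<dots> \<le> (K * (exp (- \<alpha> * p * n) * I)) powr (1 / p)"
        using n p by (intro powr_mono2) auto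
      also have "\<dots> = K powr (1 / p) * (exp (- \<alpha> * n) * Lp_norm p \<Omega> v)"
        using p by (simp add: powr_mult exp_powr_real Lp_norm_def I_def)
      also have "\<dots> \<le> K powr (1 / p) * (exp (\<alpha> * (R + 2) + - \<alpha> * norm x) * Lp_norm p \<Omega> v)"
      proof (intro mult_left_mono mult_right_mono)
        have "\<alpha> * (norm x - R - 2) \<le> \<alpha> * n" using n \<alpha> by (intro mult_left_mono) auto
        then show "exp (- \<alpha> * n) \<le> exp (\<alpha> * (R + 2) + - \<alpha> * norm x)" by (simp add: algebra_simps)
      qed (auto simp: Lp_norm_nonneg)
      also have "\<dots> = K powr (1 / p) * exp (\<alpha> * (R + 2)) * Lp_norm p \<Omega> v * exp (- \<alpha> * norm x)"
        unfolding exp_add by (simp only: mult_ac)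
      finally show ?case using elim(3) by blast
    qed
    then show "exp_decay_bound p \<Omega> (K powr (1 / p) * exp (\<alpha> * (R + 2))) \<alpha> v"
      by (simp add: exp_decay_bound_def)
  qed
qed

text \<open>Solving the inequality of the hole filling step for the outer mass gives the contraction factor
  $K/(K + L - \mu)$.\<close>

lemma subsolution_decay:
  fixes p l \<mu> :: real
  assumes p: "p > 1" and l: "0 < l" "l < \<mu>"
  shows "\<exists>K>0. \<forall>(\<Omega> :: 'a::euclidean_space set) L \<alpha>. open \<Omega> \<longrightarrow> \<mu> < L \<longrightarrow> ereal L < lambda_ess p \<Omega> \<longrightarrow>
     0 < \<alpha> \<longrightarrow> K / (K + (L - \<mu>)) \<le> exp (- \<alpha> * p) \<longrightarrow>
     (\<exists>C>0. \<forall>v. nonneg_subsolution p \<Omega> l v \<longrightarrow> exp_decay_bound p \<Omega> C \<alpha> v)"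
proof -
  obtain K where K: "K > 0" and hole: "\<And>(\<Omega> :: 'a set) v Dv R L r. open \<Omega> \<Longrightarrow> subsolution_grad p \<Omega> l v Dv \<Longrightarrow>
     0 < R \<Longrightarrow> R < r \<Longrightarrow> \<mu> < L \<Longrightarrow> ereal L \<le> lambda1 p (\<Omega> - closure (ball 0 R)) \<Longrightarrow>
     (L - \<mu>) * tail_mass p \<Omega> v (r + 1) 0 \<le> K * (tail_mass p \<Omega> v r 0 - tail_mass p \<Omega> v (r + 1) 0)"
    using hole_filling[OF p l, where 'a='a] by blast
  show ?thesis
  proof (rule exI[of _ K], intro conjI allI impI)
    show "K > 0" by (rule K)
    fix \<Omega> :: "'a set" and L \<alpha>
    assume \<Omega>: "open \<Omega>" and L: "\<mu> < L" "ereal L < lambda_ess p \<Omega>"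
      and \<alpha>: "0 < \<alpha>" "K / (K + (L - \<mu>)) \<le> exp (- \<alpha> * p)"
    obtain R where R: "R > 0" "ereal L < lambda1 p (\<Omega> - closure (ball 0 R))"
      using L(2) unfolding lambda_ess_def less_SUP_iff by auto
    show "\<exists>C>0. \<forall>v. nonneg_subsolution p \<Omega> l v \<longrightarrow> exp_decay_bound p \<Omega> C \<alpha> v"
    proof (rule geometric_tail_decay[OF p l(1) _ \<alpha>(1) \<Omega>, of "R + 1"])
      fix v :: "'a \<Rightarrow> real" and Dv r assume sub: "subsolution_grad p \<Omega> l v Dv" and r: "R + 1 \<le> r"
      have "(L - \<mu>) * tail_mass p \<Omega> v (r + 1) 0 \<le> K * (tail_mass p \<Omega> v r 0 - tail_mass p \<Omega> v (r + 1) 0)"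
        by (rule hole[OF \<Omega> sub R(1) _ L(1)]) (use r R in auto)
      then have "tail_mass p \<Omega> v (r + 1) 0 \<le> K / (K + (L - \<mu>)) * tail_mass p \<Omega> v r 0"
        using K L by (simp add: field_simps)
      also have "\<dots> \<le> exp (- \<alpha> * p) * tail_mass p \<Omega> v r 0"
        by (intro mult_right_mono \<alpha> tail_mass_nonneg)
      finally show "tail_mass p \<Omega> v (r + 1) 0 \<le> exp (- \<alpha> * p) * tail_mass p \<Omega> v r 0" .
    qed (use R in simp)
  qed
qed

lemma exists_decay_rate:
  fixes p l :: real
  assumes p: "p > 1" and l: "0 < l" and \<Omega>: "open (\<Omega> :: 'a::euclidean_space set)" and ess: "ereal l < lambda_ess p \<Omega>"
  shows "\<exists>\<alpha>>0. \<exists>C>0. \<forall>v. nonneg_subsolution p \<Omega> l v \<longrightarrow> exp_decay_bound p \<Omega> C \<alpha> v"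
proof -
  obtain L where L: "l < L" "ereal L < lambda_ess p \<Omega>"
    using ereal_dense2[OF ess] by auto
  \<comment> \<open>Half of the gap is spent on the Caccioppoli inequality, the other half on the contraction.\<close>
  define \<mu> where "\<mu> = (l + L) / 2"
  have \<mu>: "l < \<mu>" "\<mu> < L" using L by (auto simp: \<mu>_def)
  obtain K where K: "K > 0" and dec: "\<And>(\<Omega> :: 'a set) L \<alpha>. open \<Omega> \<Longrightarrow> \<mu> < L \<Longrightarrow> ereal L < lambda_ess p \<Omega> \<Longrightarrow>
     0 < \<alpha> \<Longrightarrow> K / (K + (L - \<mu>)) \<le> exp (- \<alpha> * p) \<Longrightarrow>
     (\<exists>C>0. \<forall>v. nonneg_subsolution p \<Omega> l v \<longrightarrow> exp_decay_bound p \<Omega> C \<alpha> v)"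
    using subsolution_decay[OF p l \<mu>(1), where 'a='a] by blast
  define \<theta> where "\<theta> = K / (K + (L - \<mu>))"
  have \<theta>: "0 < \<theta>" "\<theta> < 1" using K \<mu> by (auto simp: \<theta>_def field_simps)
  define \<alpha> where "\<alpha> = - ln \<theta> / p"
  have "0 < \<alpha>" using \<theta> p by (simp add: \<alpha>_def divide_neg_pos)
  moreover have "\<theta> \<le> exp (- \<alpha> * p)" using \<theta> p by (simp add: \<alpha>_def)
  ultimately show ?thesis using dec[OF \<Omega> \<mu>(2) L(2)] unfolding \<theta>_def by blast
qed

text \<open>Here $L$ may be chosen arbitrarily large with $\mu$ and hence $K$ fixed, so the contraction factor
  becomes as small as desired.\<close>

lemma every_decay_rate:
  fixes p l \<alpha> :: real
  assumes p: "p > 1" and l: "0 < l" and \<Omega>: "open (\<Omega> :: 'a::euclidean_space set)" and ess: "lambda_ess p \<Omega> = \<infinity>" and \<alpha>: "\<alpha> > 0"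
  shows "\<exists>C>0. \<forall>v. nonneg_subsolution p \<Omega> l v \<longrightarrow> exp_decay_bound p \<Omega> C \<alpha> v"
proof -
  have \<mu>: "l < 2 * l" using l by simp
  obtain K where K: "K > 0" and dec: "\<And>(\<Omega> :: 'a set) L \<alpha>. open \<Omega> \<Longrightarrow> 2 * l < L \<Longrightarrow> ereal L < lambda_ess p \<Omega> \<Longrightarrow>
     0 < \<alpha> \<Longrightarrow> K / (K + (L - 2 * l)) \<le> exp (- \<alpha> * p) \<Longrightarrow>
     (\<exists>C>0. \<forall>v. nonneg_subsolution p \<Omega> l v \<longrightarrow> exp_decay_bound p \<Omega> C \<alpha> v)"
    using subsolution_decay[OF p l \<mu>, where 'a='a] by blast
  show ?thesis
  proof (rule dec[OF \<Omega> _ _ \<alpha>, of "2 * l + K * exp (\<alpha> * p)"])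
    have "K / (K + K * exp (\<alpha> * p)) \<le> K / (K * exp (\<alpha> * p))"
      using K by (intro divide_left_mono) (auto intro!: mult_pos_pos add_pos_pos)
    then show "K / (K + (2 * l + K * exp (\<alpha> * p) - 2 * l)) \<le> exp (- \<alpha> * p)"
      using K by (simp add: exp_minus inverse_eq_divide)
  qed (use K ess in auto)
qed

lemma nonneg_subsolution_mono:
  assumes "nonneg_subsolution p \<Omega> l v" "l \<le> l'"
  shows "nonneg_subsolution p \<Omega> l' v"
proof -
  obtain Dv where v0: "AE x in lebesgue_on \<Omega>. 0 \<le> v x" and s: "sobolev0 p \<Omega> v Dv"
    and le: "\<And>\<phi> D\<phi>. sobolev0 p \<Omega> \<phi> D\<phi> \<Longrightarrow> AE x in lebesgue_on \<Omega>. 0 \<le> \<phi> x \<Longrightarrow>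
           (LINT x|lebesgue_on \<Omega>. (norm (Dv x) powr (p - 2) *\<^sub>R Dv x) \<bullet> D\<phi> x)
             \<le> l * (LINT x|lebesgue_on \<Omega>. v x powr (p - 1) * \<phi> x)"
    using assms(1) unfolding nonneg_subsolution_def by blast
  have "(LINT x|lebesgue_on \<Omega>. (norm (Dv x) powr (p - 2) *\<^sub>R Dv x) \<bullet> D\<phi> x)
             \<le> l' * (LINT x|lebesgue_on \<Omega>. v x powr (p - 1) * \<phi> x)"
    if "sobolev0 p \<Omega> \<phi> D\<phi>" and \<phi>: "AE x in lebesgue_on \<Omega>. 0 \<le> \<phi> x" for \<phi> D\<phi>
  proof -
    have "0 \<le> (LINT x|lebesgue_on \<Omega>. v x powr (p - 1) * \<phi> x)"
      by (rule integral_nonneg_AE) (use \<phi> in eventually_elim, auto)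
    then show ?thesis using le[OF that] mult_right_mono[OF assms(2)] by (meson order_trans)
  qed
  then show ?thesis unfolding nonneg_subsolution_def using v0 s by blast
qed

lemma exp_decay_bound_mono:
  assumes "exp_decay_bound p \<Omega> C \<alpha> v" "\<alpha>' \<le> \<alpha>" "C \<ge> 0"
  shows "exp_decay_bound p \<Omega> C \<alpha>' v"
  using assms(1) unfolding exp_decay_bound_def
proof eventually_elim
  case (elim x)
  have "C * Lp_norm p \<Omega> v * exp (- \<alpha> * norm x) \<le> C * Lp_norm p \<Omega> v * exp (- \<alpha>' * norm x)"
    using assms by (intro mult_left_mono) (auto intro: mult_right_mono simp: Lp_norm_nonneg)
  then show ?case using elim by linarith
qed

section \<open>The decay theorem\<close>

theorem proposition3p1:
  fixes p :: real and \<Omega> :: "(real ^ 'n) set"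
  assumes "1 < p" and "open \<Omega>" and "0 < lambda1 p \<Omega>"
  shows "(lambda_ess p \<Omega> < \<infinity> \<longrightarrow>
           (\<exists>\<alpha> :: real \<Rightarrow> real.
             (\<forall>l. lambda1 p \<Omega> \<le> ereal l \<and> ereal l < lambda_ess p \<Omega> \<longrightarrow>
                0 < \<alpha> l \<and>
                (\<exists>C>0. \<forall>v. nonneg_subsolution p \<Omega> l v \<longrightarrow> exp_decay_bound p \<Omega> C (\<alpha> l) v)) \<and>
             strict_antimono_on {l. lambda1 p \<Omega> \<le> ereal l \<and> ereal l < lambda_ess p \<Omega>} \<alpha> \<and>
             (\<alpha> \<longlongrightarrow> 0) (at_left (real_of_ereal (lambda_ess p \<Omega>))))) \<and>
         (lambda_ess p \<Omega> = \<infinity> \<longrightarrow>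
           (\<forall>l. lambda1 p \<Omega> \<le> ereal l \<and> ereal l < lambda_ess p \<Omega> \<longrightarrow>
             (\<forall>\<alpha>>0. \<exists>C>0. \<forall>v. nonneg_subsolution p \<Omega> l v \<longrightarrow> exp_decay_bound p \<Omega> C \<alpha> v)))"
proof (intro conjI impI allI)
  have pos: "0 < l" if "lambda1 p \<Omega> \<le> ereal l" for l
    using less_le_trans[OF assms(3) that] by simp
  {
    fix l \<alpha> :: real
    assume "lambda_ess p \<Omega> = \<infinity>" "lambda1 p \<Omega> \<le> ereal l \<and> ereal l < lambda_ess p \<Omega>" "\<alpha> > 0"
    then show "\<exists>C>0. \<forall>v. nonneg_subsolution p \<Omega> l v \<longrightarrow> exp_decay_bound p \<Omega> C \<alpha> v"
      using every_decay_rate[OF assms(1) pos assms(2)] by blast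
  }
  assume fin: "lambda_ess p \<Omega> < \<infinity>"
  define E where "E = real_of_ereal (lambda_ess p \<Omega>)"
  define S where "S = {l. lambda1 p \<Omega> \<le> ereal l \<and> ereal l < lambda_ess p \<Omega>}"
  have S: "0 < l" "l < E" "ereal l < lambda_ess p \<Omega>" if "l \<in> S" for l
  proof -
    show "0 < l" "ereal l < lambda_ess p \<Omega>" using that pos by (auto simp: S_def)
    then show "l < E" using fin unfolding E_def by (cases "lambda_ess p \<Omega>") auto
  qed
  \<comment> \<open>The admissible rates, truncated at 1 to have a finite supremum. These sets shrink as l grows, because
    subsolutions for l are subsolutions for larger constants.\<close>
  define A where "A l = {a. 0 < a \<and> a \<le> 1 \<and> (\<exists>C>0. \<forall>v. nonneg_subsolution p \<Omega> l v \<longrightarrow> exp_decay_bound p \<Omega> C a v)}" for l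
  have A_bdd: "bdd_above (A l)" for l by (auto simp: A_def bdd_above_def)
  have A_ne: "A l \<noteq> {}" if lS: "l \<in> S" for l
  proof -
    obtain a C where a: "a > 0" "C > 0" "\<And>v. nonneg_subsolution p \<Omega> l v \<Longrightarrow> exp_decay_bound p \<Omega> C a v"
      using exists_decay_rate[OF assms(1) S(1)[OF lS] assms(2) S(3)[OF lS]] by blast
    then have "min a 1 \<in> A l" using exp_decay_bound_mono[of p \<Omega> C a _ "min a 1"] by (auto simp: A_def)
    then show ?thesis by blast
  qed
  have A_mono: "A l' \<subseteq> A l" if "l \<le> l'" for l l'
    using nonneg_subsolution_mono[OF _ that] unfolding A_def by blast
  define \<beta> where "\<beta> l = (if l \<in> S then Sup (A l) / 2 else 1 / 2)" for l
  have \<beta>1: "0 < Sup (A l)" "Sup (A l) \<le> 1" if "l \<in> S" for l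
  proof -
    obtain a where a: "a \<in> A l" using A_ne[OF \<open>l \<in> S\<close>] by blast
    then have "0 < a" by (simp add: A_def)
    also have "a \<le> Sup (A l)" using a A_bdd by (rule cSup_upper)
    finally show "0 < Sup (A l)" .
    show "Sup (A l) \<le> 1" using A_ne[OF that] by (rule cSup_least) (simp add: A_def)
  qed
  \<comment> \<open>The second factor makes the monotone rate strictly decreasing and forces the limit; half of the supremum
    keeps the product below an admissible rate.\<close>
  define \<alpha> where "\<alpha> l = \<beta> l * ((E - l) / E)" for l
  have frac: "0 < (E - l) / E" "(E - l) / E < 1" if "l \<in> S" for l using S[OF that] by (auto simp: field_simps)
  show "\<exists>\<alpha> :: real \<Rightarrow> real.
             (\<forall>l. lambda1 p \<Omega> \<le> ereal l \<and> ereal l < lambda_ess p \<Omega> \<longrightarrow>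
                0 < \<alpha> l \<and>
                (\<exists>C>0. \<forall>v. nonneg_subsolution p \<Omega> l v \<longrightarrow> exp_decay_bound p \<Omega> C (\<alpha> l) v)) \<and>
             strict_antimono_on {l. lambda1 p \<Omega> \<le> ereal l \<and> ereal l < lambda_ess p \<Omega>} \<alpha> \<and>
             (\<alpha> \<longlongrightarrow> 0) (at_left (real_of_ereal (lambda_ess p \<Omega>)))"
  proof (intro exI[of _ \<alpha>] conjI allI impI)
    fix l assume "lambda1 p \<Omega> \<le> ereal l \<and> ereal l < lambda_ess p \<Omega>"
    then have l: "l \<in> S" by (simp add: S_def)
    show "0 < \<alpha> l"
      unfolding \<alpha>_def \<beta>_def using \<beta>1[OF l] frac[OF l] l by (simp only: if_True) (intro mult_pos_pos, auto)
    have "\<alpha> l \<le> Sup (A l) / 2 * 1"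
      unfolding \<alpha>_def \<beta>_def using \<beta>1[OF l] frac[OF l] l by (simp only: if_True) (intro mult_left_mono, auto)
    also have "\<dots> < Sup (A l)" using \<beta>1[OF l] by simp
    finally obtain a where "a \<in> A l" "\<alpha> l < a" using less_cSup_iff[OF A_ne[OF l] A_bdd] by blast
    then show "\<exists>C>0. \<forall>v. nonneg_subsolution p \<Omega> l v \<longrightarrow> exp_decay_bound p \<Omega> C (\<alpha> l) v"
      unfolding A_def using exp_decay_bound_mono less_imp_le by blast
  next
    show "strict_antimono_on {l. lambda1 p \<Omega> \<le> ereal l \<and> ereal l < lambda_ess p \<Omega>} \<alpha>"
      unfolding S_def[symmetric]
    proof (rule monotone_onI)
      fix l l' assume l: "l \<in> S" "l' \<in> S" "l < l'"
      have "Sup (A l') \<le> Sup (A l)"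
        using l by (intro cSup_subset_mono A_ne A_bdd A_mono) auto
      then have "\<alpha> l' \<le> Sup (A l) / 2 * ((E - l') / E)"
        unfolding \<alpha>_def \<beta>_def using l frac[OF l(2)] by (simp only: if_True) (intro mult_right_mono, auto)
      also have "\<dots> < Sup (A l) / 2 * ((E - l) / E)"
        using \<beta>1[OF l(1)] l S[OF l(1)] by (intro mult_strict_left_mono divide_strict_right_mono) auto
      also have "\<dots> = \<alpha> l" using l by (simp add: \<alpha>_def \<beta>_def)
      finally show "\<alpha> l > \<alpha> l'" .
    qed
  next
    have "((\<lambda>l. \<bar>(E - l) / E\<bar>) \<longlongrightarrow> \<bar>(E - E) / E\<bar>) (at_left E)"
      unfolding divide_inverse by (intro tendsto_intros)
    then have lim: "((\<lambda>l. \<bar>(E - l) / E\<bar>) \<longlongrightarrow> 0) (at_left E)" by simp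
    show "(\<alpha> \<longlongrightarrow> 0) (at_left (real_of_ereal (lambda_ess p \<Omega>)))"
      unfolding E_def[symmetric]
    proof (rule Lim_null_comparison[OF _ lim], intro always_eventually allI)
      fix l
      have "\<bar>\<beta> l\<bar> \<le> 1" using \<beta>1[of l] by (auto simp: \<beta>_def)
      then show "norm (\<alpha> l) \<le> \<bar>(E - l) / E\<bar>"
        using mult_right_mono[of "\<bar>\<beta> l\<bar>" 1 "\<bar>(E - l) / E\<bar>"] by (simp add: \<alpha>_def abs_mult)
    qed
  qed
qed

end
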